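(* Let $\mathsf K$ be a locally finitely presentable abelian category, and let $\mathsf S\subset\mathsf K$ be a class of (some) finitely presentable objects closed under extensions in $\mathsf K$. Put $\mathsf C=\varinjlim\mathsf S\subset\mathsf K$. Then: (i) If the class $\mathsf S$ consists of (some) objects of type $\mathrm{FP}_2$, then the class $\mathsf C$ is closed under extensions in $\mathsf K$. (ii) If the class $\mathsf C$ is closed under extensions in $\mathsf K$, then the class $\mathsf C$ is deconstructible in $\mathsf K$.
   Context: An object $S$ is finitely presentable if $\mathrm{Hom}_{\mathsf K}(S,-)$ preserves direct limits (colimits indexed by directed posets). An abelian category with set-indexed coproducts is locally finitely presentable if it has a set of generators consisting of finitely presentable objects (such a category is Grothendieck). An object $S$ is of type $\mathrm{FP}_n$ ($n\ge1$) if the functors $\mathrm{Ext}^i_{\mathsf K}(S,-)$ from $\mathsf K$ to abelian groups preserve direct limits for all $0\le i\le n-1$. $\varinjlim\mathsf S$ is the class of all direct limits in $\mathsf K$ of diagrams of objects from $\mathsf S$ indexed by directed posets. A filtration on an object $F$ indexed by an ordinal $\alpha$ is a family of subobjects $(F_\beta)_{0\le\beta\le\alpha}$, increasing in $\beta$, with $F_0=0$, $F_\alpha=F$, and $F_\beta=\bigcup_{\gamma<\beta}F_\gamma$ for limit ordinals $\beta\le\alpha$; $F$ is then a transfinitely iterated extension of the objects $F_{\beta+1}/F_\beta$, $\beta<\alpha$. $\mathrm{Fil}(\mathsf T)$ is the class of all transfinitely iterated extensions of objects isomorphic to objects from $\mathsf T$. A class $\mathsf F$ is deconstructible if $\mathsf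 F=\mathrm{Fil}(\mathsf T)$ for some set of objects $\mathsf T$. A class of objects closed under extensions is understood to be closed under isomorphisms and to contain the zero object. *)

theory Defs
  imports "HOL-Algebra.Group"
begin

unbundle cardinal_syntax

section \<open>Small sets\<close>

text \<open>The distinction between sets and proper classes is made relative to a Grothendieck universe,
  given by a strongly inaccessible cardinal \<open>\<kappa>\<close>: ``set'' means ``set of cardinality less
  than \<open>\<kappa>\<close>'', while a class is an arbitrary HOL set. As \<open>\<kappa>\<close> is an initial ordinal, the elements of
  \<open>Field \<kappa>\<close>, ordered by \<open>\<kappa>\<close>, are the small ordinals. Every small set is equipotent to a subset of the
  type \<open>'u\<close> of elements of \<open>\<kappa>\<close>, so it suffices to use subsets of \<open>'u\<close> as index sets.\<close>

definition inaccessible :: "'u rel \<Rightarrow> bool" where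
  "inaccessible \<kappa> \<longleftrightarrow> Card_order \<kappa> \<and> natLeq <o \<kappa> \<and> regularCard \<kappa> \<and>
     (\<forall>A :: 'u set. |A| <o \<kappa> \<longrightarrow> |Pow A| <o \<kappa>)"

definition small :: "'u rel \<Rightarrow> 'a set \<Rightarrow> bool" where
  "small \<kappa> A \<longleftrightarrow> |A| <o \<kappa>"

section \<open>Abelian categories\<close>

text \<open>The operation \<open>comp K g f\<close> is the composite ``\<open>g\<close> after \<open>f\<close>''; \<open>plus_arr\<close> and \<open>zero_arr\<close> are
  the abelian group structure on the Hom sets.\<close>

record ('o, 'm) cat =
  Ob :: "'o set"
  Ar :: "'m set"
  Dom :: "'m \<Rightarrow> 'o"
  Cod :: "'m \<Rightarrow> 'o"
  ident :: "'o \<Rightarrow> 'm"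
  comp :: "'m \<Rightarrow> 'm \<Rightarrow> 'm"  (infixr \<open>\<cdot>\<index>\<close> 70)

record ('o, 'm) abcat = "('o, 'm) cat" +
  plus_arr :: "'m \<Rightarrow> 'm \<Rightarrow> 'm"  (infixl \<open>\<boxplus>\<index>\<close> 65)
  zero_arr :: "'o \<Rightarrow> 'o \<Rightarrow> 'm"

definition Hom :: "('o, 'm, 'x) cat_scheme \<Rightarrow> 'o \<Rightarrow> 'o \<Rightarrow> 'm set" where
  "Hom K X Y = {f \<in> Ar K. Dom K f = X \<and> Cod K f = Y}"

locale category =
  fixes K :: "('o, 'm, 'x) cat_scheme" (structure)
  assumes Dom_Ob: "f \<in> Ar K \<Longrightarrow> Dom K f \<in> Ob K"
    and Cod_Ob: "f \<in> Ar K \<Longrightarrow> Cod K f \<in> Ob K"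
    and ident_Hom: "X \<in> Ob K \<Longrightarrow> ident K X \<in> Hom K X X"
    and comp_Hom: "\<lbrakk>f \<in> Hom K X Y; g \<in> Hom K Y Z\<rbrakk> \<Longrightarrow> g \<cdot> f \<in> Hom K X Z"
    and comp_assoc: "\<lbrakk>f \<in> Hom K W X; g \<in> Hom K X Y; h \<in> Hom K Y Z\<rbrakk> \<Longrightarrow> (h \<cdot> g) \<cdot> f = h \<cdot> (g \<cdot> f)"
    and comp_ident_left: "f \<in> Hom K X Y \<Longrightarrow> ident K Y \<cdot> f = f"
    and comp_ident_right: "f \<in> Hom K X Y \<Longrightarrow> f \<cdot> ident K X = f"

definition hom_group :: "('o, 'm, 'x) abcat_scheme \<Rightarrow> 'o \<Rightarrow> 'o \<Rightarrow> 'm monoid" where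
  "hom_group K X Y = \<lparr>carrier = Hom K X Y, monoid.mult = plus_arr K, one = zero_arr K X Y\<rparr>"

locale preadditive_category = category K
  for K :: "('o, 'm, 'x) abcat_scheme" (structure) +
  assumes hom_group: "\<lbrakk>X \<in> Ob K; Y \<in> Ob K\<rbrakk> \<Longrightarrow> comm_group (hom_group K X Y)"
    and comp_plus_left: "\<lbrakk>f \<in> Hom K X Y; g \<in> Hom K Y Z; g' \<in> Hom K Y Z\<rbrakk>
      \<Longrightarrow> (g \<boxplus> g') \<cdot> f = (g \<cdot> f) \<boxplus> (g' \<cdot> f)"
    and comp_plus_right: "\<lbrakk>f \<in> Hom K X Y; f' \<in> Hom K X Y; g \<in> Hom K Y Z\<rbrakk>
      \<Longrightarrow> g \<cdot> (f \<boxplus> f') = (g \<cdot> f) \<boxplus> (g \<cdot> f')"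

definition zero_object :: "('o, 'm, 'x) cat_scheme \<Rightarrow> 'o \<Rightarrow> bool" where
  "zero_object K Z \<longleftrightarrow> Z \<in> Ob K \<and>
     (\<forall>X \<in> Ob K. (\<exists>!f. f \<in> Hom K X Z) \<and> (\<exists>!f. f \<in> Hom K Z X))"

definition monic :: "('o, 'm, 'x) cat_scheme \<Rightarrow> 'm \<Rightarrow> bool" where
  "monic K m \<longleftrightarrow> m \<in> Ar K \<and>
     (\<forall>X \<in> Ob K. \<forall>f \<in> Hom K X (Dom K m). \<forall>g \<in> Hom K X (Dom K m).
        m \<cdot>\<^bsub>K\<^esub> f = m \<cdot>\<^bsub>K\<^esub> g \<longrightarrow> f = g)"

definition epic :: "('o, 'm, 'x) cat_scheme \<Rightarrow> 'm \<Rightarrow> bool" where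
  "epic K e \<longleftrightarrow> e \<in> Ar K \<and>
     (\<forall>Y \<in> Ob K. \<forall>f \<in> Hom K (Cod K e) Y. \<forall>g \<in> Hom K (Cod K e) Y.
        f \<cdot>\<^bsub>K\<^esub> e = g \<cdot>\<^bsub>K\<^esub> e \<longrightarrow> f = g)"

definition iso_arr :: "('o, 'm, 'x) cat_scheme \<Rightarrow> 'm \<Rightarrow> bool" where
  "iso_arr K f \<longleftrightarrow> f \<in> Ar K \<and> (\<exists>g \<in> Hom K (Cod K f) (Dom K f).
     g \<cdot>\<^bsub>K\<^esub> f = ident K (Dom K f) \<and> f \<cdot>\<^bsub>K\<^esub> g = ident K (Cod K f))"

definition isomorphic :: "('o, 'm, 'x) cat_scheme \<Rightarrow> 'o \<Rightarrow> 'o \<Rightarrow> bool" where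
  "isomorphic K X Y \<longleftrightarrow> (\<exists>f \<in> Hom K X Y. iso_arr K f)"

definition is_kernel :: "('o, 'm, 'x) abcat_scheme \<Rightarrow> 'm \<Rightarrow> 'm \<Rightarrow> bool" where
  "is_kernel K f k \<longleftrightarrow> f \<in> Ar K \<and> k \<in> Ar K \<and> Cod K k = Dom K f \<and>
     f \<cdot>\<^bsub>K\<^esub> k = zero_arr K (Dom K k) (Cod K f) \<and>
     (\<forall>X \<in> Ob K. \<forall>g \<in> Hom K X (Dom K f). f \<cdot>\<^bsub>K\<^esub> g = zero_arr K X (Cod K f) \<longrightarrow>
        (\<exists>!h. h \<in> Hom K X (Dom K k) \<and> k \<cdot>\<^bsub>K\<^esub> h = g))"

definition is_cokernel :: "('o, 'm, 'x) abcat_scheme \<Rightarrow> 'm \<Rightarrow> 'm \<Rightarrow> bool" where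
  "is_cokernel K f c \<longleftrightarrow> f \<in> Ar K \<and> c \<in> Ar K \<and> Dom K c = Cod K f \<and>
     c \<cdot>\<^bsub>K\<^esub> f = zero_arr K (Dom K f) (Cod K c) \<and>
     (\<forall>Y \<in> Ob K. \<forall>g \<in> Hom K (Cod K f) Y. g \<cdot>\<^bsub>K\<^esub> f = zero_arr K (Dom K f) Y \<longrightarrow>
        (\<exists>!h. h \<in> Hom K (Cod K c) Y \<and> h \<cdot>\<^bsub>K\<^esub> c = g))"

definition biproduct ::
  "('o, 'm, 'x) abcat_scheme \<Rightarrow> 'o \<Rightarrow> 'o \<Rightarrow> 'o \<Rightarrow> 'm \<Rightarrow> 'm \<Rightarrow> 'm \<Rightarrow> 'm \<Rightarrow> bool" where
  "biproduct K X Y P i1 i2 p1 p2 \<longleftrightarrow> P \<in> Ob K \<and>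
     i1 \<in> Hom K X P \<and> i2 \<in> Hom K Y P \<and> p1 \<in> Hom K P X \<and> p2 \<in> Hom K P Y \<and>
     p1 \<cdot>\<^bsub>K\<^esub> i1 = ident K X \<and> p2 \<cdot>\<^bsub>K\<^esub> i2 = ident K Y \<and>
     (i1 \<cdot>\<^bsub>K\<^esub> p1) \<boxplus>\<^bsub>K\<^esub> (i2 \<cdot>\<^bsub>K\<^esub> p2) = ident K P"

locale abelian_category = preadditive_category K
  for K :: "('o, 'm, 'x) abcat_scheme" (structure) +
  assumes ex_zero_object: "\<exists>Z. zero_object K Z"
    and ex_biproduct: "\<lbrakk>X \<in> Ob K; Y \<in> Ob K\<rbrakk> \<Longrightarrow> \<exists>P i1 i2 p1 p2. biproduct K X Y P i1 i2 p1 p2"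
    and ex_kernel: "f \<in> Ar K \<Longrightarrow> \<exists>k. is_kernel K f k"
    and ex_cokernel: "f \<in> Ar K \<Longrightarrow> \<exists>c. is_cokernel K f c"
    and monic_is_kernel: "monic K m \<Longrightarrow> \<exists>f. is_kernel K f m"
    and epic_is_cokernel: "epic K e \<Longrightarrow> \<exists>f. is_cokernel K f e"

definition is_coproduct ::
  "('o, 'm, 'x) cat_scheme \<Rightarrow> 'i set \<Rightarrow> ('i \<Rightarrow> 'o) \<Rightarrow> 'o \<Rightarrow> ('i \<Rightarrow> 'm) \<Rightarrow> bool" where
  "is_coproduct K I X C \<iota> \<longleftrightarrow> C \<in> Ob K \<and> (\<forall>i \<in> I. \<iota> i \<in> Hom K (X i) C) \<and>
     (\<forall>Y \<in> Ob K. \<forall>t. (\<forall>i \<in> I. t i \<in> Hom K (X i) Y) \<longrightarrow>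
        (\<exists>!h. h \<in> Hom K C Y \<and> (\<forall>i \<in> I. h \<cdot>\<^bsub>K\<^esub> \<iota> i = t i)))"

definition has_small_coproducts :: "'u rel \<Rightarrow> ('o, 'm, 'x) cat_scheme \<Rightarrow> bool" where
  "has_small_coproducts \<kappa> K \<longleftrightarrow>
     (\<forall>(I :: 'u set) X. small \<kappa> I \<and> (\<forall>i \<in> I. X i \<in> Ob K) \<longrightarrow> (\<exists>C \<iota>. is_coproduct K I X C \<iota>))"

definition locally_small :: "'u rel \<Rightarrow> ('o, 'm, 'x) cat_scheme \<Rightarrow> bool" where
  "locally_small \<kappa> K \<longleftrightarrow> (\<forall>X \<in> Ob K. \<forall>Y \<in> Ob K. small \<kappa> (Hom K X Y))"

definition generating :: "('o, 'm, 'x) cat_scheme \<Rightarrow> 'o set \<Rightarrow> bool" where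
  "generating K \<G> \<longleftrightarrow> \<G> \<subseteq> Ob K \<and>
     (\<forall>X \<in> Ob K. \<forall>Y \<in> Ob K. \<forall>f \<in> Hom K X Y. \<forall>g \<in> Hom K X Y. f \<noteq> g \<longrightarrow>
        (\<exists>G \<in> \<G>. \<exists>h \<in> Hom K G X. f \<cdot>\<^bsub>K\<^esub> h \<noteq> g \<cdot>\<^bsub>K\<^esub> h))"

section \<open>Direct limits\<close>

definition directed_poset :: "'i set \<Rightarrow> 'i rel \<Rightarrow> bool" where
  "directed_poset I R \<longleftrightarrow> partial_order_on I R \<and> I \<noteq> {} \<and>
     (\<forall>i \<in> I. \<forall>j \<in> I. \<exists>k \<in> I. (i, k) \<in> R \<and> (j, k) \<in> R)"

definition direct_system ::
  "('o, 'm, 'x) cat_scheme \<Rightarrow> 'i set \<Rightarrow> 'i rel \<Rightarrow> ('i \<Rightarrow> 'o) \<Rightarrow> ('i \<Rightarrow> 'i \<Rightarrow> 'm) \<Rightarrow> bool" where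
  "direct_system K I R X x \<longleftrightarrow> directed_poset I R \<and> (\<forall>i \<in> I. X i \<in> Ob K) \<and>
     (\<forall>i j. (i, j) \<in> R \<longrightarrow> x i j \<in> Hom K (X i) (X j)) \<and>
     (\<forall>i \<in> I. x i i = ident K (X i)) \<and>
     (\<forall>i j k. (i, j) \<in> R \<and> (j, k) \<in> R \<longrightarrow> x j k \<cdot>\<^bsub>K\<^esub> x i j = x i k)"

definition is_cocone ::
  "('o, 'm, 'x) cat_scheme \<Rightarrow> 'i set \<Rightarrow> 'i rel \<Rightarrow> ('i \<Rightarrow> 'o) \<Rightarrow> ('i \<Rightarrow> 'i \<Rightarrow> 'm)
     \<Rightarrow> 'o \<Rightarrow> ('i \<Rightarrow> 'm) \<Rightarrow> bool" where
  "is_cocone K I R X x L l \<longleftrightarrow> L \<in> Ob K \<and> (\<forall>i \<in> I. l i \<in> Hom K (X i) L) \<and>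
     (\<forall>i j. (i, j) \<in> R \<longrightarrow> l j \<cdot>\<^bsub>K\<^esub> x i j = l i)"

definition is_direct_limit ::
  "('o, 'm, 'x) cat_scheme \<Rightarrow> 'i set \<Rightarrow> 'i rel \<Rightarrow> ('i \<Rightarrow> 'o) \<Rightarrow> ('i \<Rightarrow> 'i \<Rightarrow> 'm)
     \<Rightarrow> 'o \<Rightarrow> ('i \<Rightarrow> 'm) \<Rightarrow> bool" where
  "is_direct_limit K I R X x L l \<longleftrightarrow> direct_system K I R X x \<and> is_cocone K I R X x L l \<and>
     (\<forall>Y t. is_cocone K I R X x Y t \<longrightarrow>
        (\<exists>!h. h \<in> Hom K L Y \<and> (\<forall>i \<in> I. h \<cdot>\<^bsub>K\<^esub> l i = t i)))"

definition direct_limits :: "'u rel \<Rightarrow> ('o, 'm, 'x) cat_scheme \<Rightarrow> 'o set \<Rightarrow> 'o set" where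
  "direct_limits \<kappa> K \<S> =
     {L. \<exists>(I :: 'u set) R X x l. small \<kappa> I \<and> (\<forall>i \<in> I. X i \<in> \<S>) \<and> is_direct_limit K I R X x L l}"

text \<open>The same for a direct system of abelian groups \<open>G i\<close> with transition maps \<open>\<phi> i j\<close> and a cocone
  \<open>\<psi> i\<close> to \<open>L\<close>. The universal property is tested on all abelian groups \<open>H\<close> with carrier in the type
  \<open>('i \<times> 'g) set\<close>. This loses nothing: the usual construction of the direct limit, as a quotient set of
  the disjoint union of the \<open>G i\<close>, is such a group.\<close>

definition is_group_direct_limit ::
  "'i set \<Rightarrow> 'i rel \<Rightarrow> ('i \<Rightarrow> 'g monoid) \<Rightarrow> ('i \<Rightarrow> 'i \<Rightarrow> 'g \<Rightarrow> 'g) \<Rightarrow> 'g monoid \<Rightarrow> ('i \<Rightarrow> 'g \<Rightarrow> 'g) \<Rightarrow> bool"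
  where
  "is_group_direct_limit I R G \<phi> L \<psi> \<longleftrightarrow>
     (\<forall>i \<in> I. comm_group (G i)) \<and> (\<forall>i j. (i, j) \<in> R \<longrightarrow> \<phi> i j \<in> hom (G i) (G j)) \<and>
     comm_group L \<and> (\<forall>i \<in> I. \<psi> i \<in> hom (G i) L) \<and>
     (\<forall>i j. (i, j) \<in> R \<longrightarrow> (\<forall>a \<in> carrier (G i). \<psi> j (\<phi> i j a) = \<psi> i a)) \<and>
     (\<forall>(H :: ('i \<times> 'g) set monoid) t.
        comm_group H \<and> (\<forall>i \<in> I. t i \<in> hom (G i) H) \<and>
        (\<forall>i j. (i, j) \<in> R \<longrightarrow> (\<forall>a \<in> carrier (G i). t j (\<phi> i j a) = t i a)) \<longrightarrow>
        (\<exists>h \<in> hom L H. (\<forall>i \<in> I. \<forall>a \<in> carrier (G i). h (\<psi> i a) = t i a) \<and>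
           (\<forall>h' \<in> hom L H. (\<forall>i \<in> I. \<forall>a \<in> carrier (G i). h' (\<psi> i a) = t i a) \<longrightarrow>
              (\<forall>b \<in> carrier L. h' b = h b))))"

text \<open>A functor from \<open>K\<close> to abelian groups is given by its action \<open>F\<close> on objects and its action \<open>Fm\<close>
  on arrows.\<close>

definition preserves_direct_limits ::
  "'u rel \<Rightarrow> ('o, 'm, 'x) cat_scheme \<Rightarrow> ('o \<Rightarrow> 'g monoid) \<Rightarrow> ('m \<Rightarrow> 'g \<Rightarrow> 'g) \<Rightarrow> bool" where
  "preserves_direct_limits \<kappa> K F Fm \<longleftrightarrow>
     (\<forall>(I :: 'u set) R X x L l. small \<kappa> I \<and> is_direct_limit K I R X x L l \<longrightarrow>
        is_group_direct_limit I R (\<lambda>i. F (X i)) (\<lambda>i j. Fm (x i j)) (F L) (\<lambda>i. Fm (l i)))"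

definition finitely_presentable :: "'u rel \<Rightarrow> ('o, 'm, 'x) abcat_scheme \<Rightarrow> 'o \<Rightarrow> bool" where
  "finitely_presentable \<kappa> K S \<longleftrightarrow> S \<in> Ob K \<and>
     preserves_direct_limits \<kappa> K (hom_group K S) (\<lambda>f g. f \<cdot>\<^bsub>K\<^esub> g)"

definition locally_finitely_presentable_abelian ::
  "'u rel \<Rightarrow> ('o, 'm, 'x) abcat_scheme \<Rightarrow> bool" where
  "locally_finitely_presentable_abelian \<kappa> K \<longleftrightarrow>
     abelian_category K \<and> locally_small \<kappa> K \<and> has_small_coproducts \<kappa> K \<and>
     (\<exists>\<G>. small \<kappa> \<G> \<and> generating K \<G> \<and> (\<forall>G \<in> \<G>. finitely_presentable \<kappa> K G))"

section \<open>Ext groups\<close>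

text \<open>For \<open>n \<ge> 1\<close>, \<open>Ext\<^sup>n(S, A)\<close> is Yoneda's group of equivalence classes of exact sequences
  \<open>0 \<rightarrow> A \<rightarrow> E\<^sub>1 \<rightarrow> \<dots> \<rightarrow> E\<^sub>n \<rightarrow> S \<rightarrow> 0\<close>. Such a sequence is encoded as the list of its \<open>n + 1\<close> arrows from
  \<open>A\<close> to \<open>S\<close>. Exactness at the middle term of two consecutive arrows \<open>f\<close>, \<open>g\<close> means that the image of
  \<open>f\<close> is the kernel of \<open>g\<close>.\<close>

definition exact_at :: "('o, 'm, 'x) abcat_scheme \<Rightarrow> 'm \<Rightarrow> 'm \<Rightarrow> bool" where
  "exact_at K f g \<longleftrightarrow> f \<in> Ar K \<and> g \<in> Ar K \<and> Cod K f = Dom K g \<and>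
     (\<exists>e k. epic K e \<and> is_kernel K g k \<and> Cod K e = Dom K k \<and> k \<cdot>\<^bsub>K\<^esub> e = f)"

definition n_extensions :: "('o, 'm, 'x) abcat_scheme \<Rightarrow> nat \<Rightarrow> 'o \<Rightarrow> 'o \<Rightarrow> 'm list set" where
  "n_extensions K n S A = {\<xi>. length \<xi> = Suc n \<and> set \<xi> \<subseteq> Ar K \<and>
     Dom K (\<xi> ! 0) = A \<and> Cod K (\<xi> ! n) = S \<and> monic K (\<xi> ! 0) \<and> epic K (\<xi> ! n) \<and>
     (\<forall>i < n. exact_at K (\<xi> ! i) (\<xi> ! Suc i))}"

text \<open>The object in position \<open>i\<close> of an \<open>n\<close>-extension, \<open>0 \<le> i \<le> n + 1\<close>, including both ends.\<close>

definition ext_obj :: "('o, 'm, 'x) cat_scheme \<Rightarrow> 'm list \<Rightarrow> nat \<Rightarrow> 'o" where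
  "ext_obj K \<xi> i = (if i < length \<xi> then Dom K (\<xi> ! i) else Cod K (last \<xi>))"

definition ext_morphism ::
  "('o, 'm, 'x) cat_scheme \<Rightarrow> nat \<Rightarrow> 'm \<Rightarrow> 'm \<Rightarrow> 'm list \<Rightarrow> 'm list \<Rightarrow> bool" where
  "ext_morphism K n a s \<xi> \<xi>' \<longleftrightarrow> (\<exists>\<phi>. \<phi> 0 = a \<and> \<phi> (Suc n) = s \<and>
     (\<forall>i \<le> Suc n. \<phi> i \<in> Hom K (ext_obj K \<xi> i) (ext_obj K \<xi>' i)) \<and>
     (\<forall>i \<le> n. (\<xi>' ! i) \<cdot>\<^bsub>K\<^esub> \<phi> i = \<phi> (Suc i) \<cdot>\<^bsub>K\<^esub> (\<xi> ! i)))"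

definition yoneda_equiv ::
  "('o, 'm, 'x) abcat_scheme \<Rightarrow> nat \<Rightarrow> 'o \<Rightarrow> 'o \<Rightarrow> 'm list rel" where
  "yoneda_equiv K n S A =
     (let E = n_extensions K n S A;
          r = {(\<xi>, \<xi>'). \<xi> \<in> E \<and> \<xi>' \<in> E \<and> ext_morphism K n (ident K A) (ident K S) \<xi> \<xi>'}
      in (r \<union> r\<inverse>)\<^sup>* \<inter> E \<times> E)"

text \<open>\<open>\<eta>\<close> is a Baer sum \<open>\<nabla>(\<xi> \<oplus> \<xi>')\<Delta>\<close> of two \<open>n\<close>-extensions of \<open>S\<close> by \<open>A\<close>: here \<open>\<zeta>\<close> is a termwise
  direct sum of \<open>\<xi>\<close> and \<open>\<xi>'\<close>, pushed out to \<open>\<omega>\<close> along the codiagonal of \<open>A\<close> and then pulled back to \<open>\<eta>\<close>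
  along the diagonal of \<open>S\<close>.\<close>

definition baer_sum ::
  "('o, 'm, 'x) abcat_scheme \<Rightarrow> nat \<Rightarrow> 'o \<Rightarrow> 'o \<Rightarrow> 'm list \<Rightarrow> 'm list \<Rightarrow> 'm list \<Rightarrow> bool" where
  "baer_sum K n S A \<xi> \<xi>' \<eta> \<longleftrightarrow> \<eta> \<in> n_extensions K n S A \<and>
     (\<exists>P i1 i2 p1 p2 \<zeta> \<omega>.
        (\<forall>i \<le> Suc n. biproduct K (ext_obj K \<xi> i) (ext_obj K \<xi>' i) (P i) (i1 i) (i2 i) (p1 i) (p2 i)) \<and>
        \<zeta> \<in> n_extensions K n (P (Suc n)) (P 0) \<and>
        (\<forall>i \<le> n. \<zeta> ! i = (i1 (Suc i) \<cdot>\<^bsub>K\<^esub> (\<xi> ! i) \<cdot>\<^bsub>K\<^esub> p1 i) \<boxplus>\<^bsub>K\<^esub> (i2 (Suc i) \<cdot>\<^bsub>K\<^esub> (\<xi>' ! i) \<cdot>\<^bsub>K\<^esub> p2 i)) \<and>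
        \<omega> \<in> n_extensions K n (P (Suc n)) A \<and>
        ext_morphism K n (p1 0 \<boxplus>\<^bsub>K\<^esub> p2 0) (ident K (P (Suc n))) \<zeta> \<omega> \<and>
        ext_morphism K n (ident K A) (i1 (Suc n) \<boxplus>\<^bsub>K\<^esub> i2 (Suc n)) \<eta> \<omega>)"

text \<open>The zero element is the class of the \<open>n\<close>-extensions whose first arrow is a split monomorphism:
  for \<open>n = 1\<close> the split extensions; for \<open>n \<ge> 2\<close> these are all equivalent to
  \<open>A = A \<rightarrow> 0 \<rightarrow> \<dots> \<rightarrow> 0 \<rightarrow> S = S\<close>.\<close>

definition Ext_group :: "('o, 'm, 'x) abcat_scheme \<Rightarrow> nat \<Rightarrow> 'o \<Rightarrow> 'o \<Rightarrow> 'm list set monoid" where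
  "Ext_group K n S A =
     \<lparr>carrier = n_extensions K n S A // yoneda_equiv K n S A,
      monoid.mult = (\<lambda>c d. yoneda_equiv K n S A `` {\<eta>. \<exists>\<xi> \<in> c. \<exists>\<xi>' \<in> d. baer_sum K n S A \<xi> \<xi>' \<eta>}),
      one = yoneda_equiv K n S A `` {\<eta> \<in> n_extensions K n S A.
              \<exists>r \<in> Hom K (Cod K (\<eta> ! 0)) A. r \<cdot>\<^bsub>K\<^esub> (\<eta> ! 0) = ident K A}\<rparr>"

text \<open>\<open>Ext\<^sup>n(S, f)\<close> is pushout along \<open>f\<close>: the class of \<open>\<xi>\<close> goes to the class of any \<open>\<xi>'\<close> that receives
  a morphism from \<open>\<xi>\<close> which is \<open>f\<close> on the left end and the identity on the right end.\<close>

definition Ext_map :: "('o, 'm, 'x) abcat_scheme \<Rightarrow> nat \<Rightarrow> 'o \<Rightarrow> 'm \<Rightarrow> 'm list set \<Rightarrow> 'm list set" where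
  "Ext_map K n S f c = yoneda_equiv K n S (Cod K f) ``
     {\<xi>' \<in> n_extensions K n S (Cod K f). \<exists>\<xi> \<in> c. ext_morphism K n f (ident K S) \<xi> \<xi>'}"

text \<open>In \<open>type_FP\<close> the case \<open>i = 0\<close> is separate, because \<open>Ext\<^sup>0(S, -) = Hom(S, -)\<close>.\<close>

definition type_FP :: "'u rel \<Rightarrow> ('o, 'm, 'x) abcat_scheme \<Rightarrow> nat \<Rightarrow> 'o \<Rightarrow> bool" where
  "type_FP \<kappa> K n S \<longleftrightarrow> S \<in> Ob K \<and>
     preserves_direct_limits \<kappa> K (hom_group K S) (\<lambda>f g. f \<cdot>\<^bsub>K\<^esub> g) \<and>
     (\<forall>i. 1 \<le> i \<and> i \<le> n - 1 \<longrightarrow> preserves_direct_limits \<kappa> K (Ext_group K i S) (Ext_map K i S))"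

section \<open>Extensions and filtrations\<close>

definition short_exact :: "('o, 'm, 'x) abcat_scheme \<Rightarrow> 'm \<Rightarrow> 'm \<Rightarrow> bool" where
  "short_exact K f g \<longleftrightarrow> is_kernel K g f \<and> is_cokernel K f g"

definition closed_under_extensions :: "('o, 'm, 'x) abcat_scheme \<Rightarrow> 'o set \<Rightarrow> bool" where
  "closed_under_extensions K \<C> \<longleftrightarrow> \<C> \<subseteq> Ob K \<and>
     (\<exists>Z \<in> \<C>. zero_object K Z) \<and>
     (\<forall>X \<in> \<C>. \<forall>Y \<in> Ob K. isomorphic K X Y \<longrightarrow> Y \<in> \<C>) \<and>
     (\<forall>f g. short_exact K f g \<and> Dom K f \<in> \<C> \<and> Cod K g \<in> \<C> \<longrightarrow> Cod K f \<in> \<C>)"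

text \<open>A subobject of \<open>F\<close> is represented by a monomorphism to \<open>F\<close>.\<close>

definition subobject :: "('o, 'm, 'x) cat_scheme \<Rightarrow> 'o \<Rightarrow> 'm \<Rightarrow> bool" where
  "subobject K F m \<longleftrightarrow> monic K m \<and> Cod K m = F"

definition sub_le :: "('o, 'm, 'x) cat_scheme \<Rightarrow> 'm \<Rightarrow> 'm \<Rightarrow> bool" where
  "sub_le K m m' \<longleftrightarrow> (\<exists>h \<in> Hom K (Dom K m) (Dom K m'). m' \<cdot>\<^bsub>K\<^esub> h = m)"

definition is_union :: "('o, 'm, 'x) cat_scheme \<Rightarrow> 'o \<Rightarrow> 'm set \<Rightarrow> 'm \<Rightarrow> bool" where
  "is_union K F M u \<longleftrightarrow> subobject K F u \<and> (\<forall>m \<in> M. sub_le K m u) \<and>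
     (\<forall>v. subobject K F v \<and> (\<forall>m \<in> M. sub_le K m v) \<longrightarrow> sub_le K u v)"

text \<open>\<open>m\<close> is a filtration of \<open>F\<close> indexed by the ordinal \<open>\<alpha> \<in> Field \<kappa>\<close>. The order on ordinals is
  \<open>(\<beta>, \<gamma>) \<in> \<kappa>\<close>, the set \<open>underS \<kappa> \<beta>\<close> consists of all ordinals less than \<open>\<beta>\<close> (so it is empty exactly for
  \<open>\<beta> = 0\<close>), and the successor of \<open>\<beta>\<close> is \<open>wo_rel.suc \<kappa> {\<beta>}\<close>.\<close>

definition limit_ordinal :: "'u rel \<Rightarrow> 'u \<Rightarrow> bool" where
  "limit_ordinal \<kappa> \<beta> \<longleftrightarrow> \<beta> \<in> Field \<kappa> \<and> underS \<kappa> \<beta> \<noteq> {} \<and> (\<forall>\<gamma> \<in> underS \<kappa> \<beta>. \<beta> \<noteq> wo_rel.suc \<kappa> {\<gamma>})"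

definition is_filtration ::
  "'u rel \<Rightarrow> ('o, 'm, 'x) cat_scheme \<Rightarrow> 'o \<Rightarrow> 'u \<Rightarrow> ('u \<Rightarrow> 'm) \<Rightarrow> bool" where
  "is_filtration \<kappa> K F \<alpha> m \<longleftrightarrow> \<alpha> \<in> Field \<kappa> \<and>
     (\<forall>\<beta>. (\<beta>, \<alpha>) \<in> \<kappa> \<longrightarrow> subobject K F (m \<beta>)) \<and>
     (\<forall>\<beta> \<gamma>. (\<beta>, \<gamma>) \<in> \<kappa> \<and> (\<gamma>, \<alpha>) \<in> \<kappa> \<longrightarrow> sub_le K (m \<beta>) (m \<gamma>)) \<and>
     (\<forall>\<beta>. (\<beta>, \<alpha>) \<in> \<kappa> \<and> underS \<kappa> \<beta> = {} \<longrightarrow> zero_object K (Dom K (m \<beta>))) \<and>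
     iso_arr K (m \<alpha>) \<and>
     (\<forall>\<beta>. (\<beta>, \<alpha>) \<in> \<kappa> \<and> limit_ordinal \<kappa> \<beta> \<longrightarrow> is_union K F (m ` underS \<kappa> \<beta>) (m \<beta>))"

text \<open>The quotient of consecutive subobjects is the codomain of a cokernel of the inclusion \<open>j\<close>.\<close>

definition Fil :: "'u rel \<Rightarrow> ('o, 'm, 'x) abcat_scheme \<Rightarrow> 'o set \<Rightarrow> 'o set" where
  "Fil \<kappa> K \<T> = {F \<in> Ob K. \<exists>\<alpha> m. is_filtration \<kappa> K F \<alpha> m \<and>
     (\<forall>\<beta> \<in> underS \<kappa> \<alpha>. \<exists>j q T.
        j \<in> Hom K (Dom K (m \<beta>)) (Dom K (m (wo_rel.suc \<kappa> {\<beta>}))) \<and>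
        m (wo_rel.suc \<kappa> {\<beta>}) \<cdot>\<^bsub>K\<^esub> j = m \<beta> \<and>
        is_cokernel K j q \<and> T \<in> \<T> \<and> isomorphic K (Cod K q) T)}"

definition deconstructible :: "'u rel \<Rightarrow> ('o, 'm, 'x) abcat_scheme \<Rightarrow> 'o set \<Rightarrow> bool" where
  "deconstructible \<kappa> K \<F> \<longleftrightarrow> (\<exists>\<T>. \<T> \<subseteq> Ob K \<and> small \<kappa> \<T> \<and> \<F> = Fil \<kappa> K \<T>)"

end

theory Submission
  imports Defs "HOL-Algebra.Coset"
begin

text \<open>
  The class \<open>\<C>\<close> of direct limits of objects in \<open>\<S>\<close> has an intrinsic description, Lenzing's criterion
  (\<open>direct_limits_iff\<close>): an object \<open>N\<close> is in \<open>\<C>\<close> iff every map to \<open>N\<close> from the cokernel of a map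
  between finitely presentable objects factors through an object in \<open>\<S>\<close>. For such \<open>N\<close> the maps from
  objects in \<open>\<S>\<close> (up to isomorphism) to \<open>N\<close> form a filtered category, and \<open>N\<close> is its colimit. It remains
  to replace this category by a directed poset (\<open>approximable_is_direct_limit\<close>). It follows from the
  criterion that \<open>\<C>\<close> is closed under direct limits.

  (i) Let \<open>B\<close> be an extension of \<open>C\<close> by \<open>A\<close>, both in \<open>\<C>\<close>. A map \<open>E \<rightarrow> B\<close> as in the criterion gives a map
  \<open>E \<rightarrow> C\<close>, which factors through some \<open>S\<close> in \<open>\<S>\<close>, and then \<open>E \<rightarrow> B\<close> factors through the pullback of the
  extension to \<open>S\<close>. Write \<open>A\<close> as the direct limit of objects \<open>A\<^sub>i\<close> in \<open>\<S>\<close>. As \<open>Ext\<^sup>1(S, -)\<close> preserves direct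
  limits, the pullback comes from an extension of \<open>S\<close> by some \<open>A\<^sub>i\<close>, so it is the direct limit of
  the pushouts of that extension to the later stages. These are in \<open>\<S>\<close>, because \<open>\<S>\<close> is closed under
  extensions. Hence \<open>E \<rightarrow> B\<close> factors through one of them (\<open>approximable_extension\<close>).

  (ii) Let \<open>M\<close> be the direct limit of a system of objects \<open>X i\<close> from a small set \<open>T\<close> of representatives
  for \<open>\<S>\<close>. There is a directed subset \<open>J\<close> of the index set, whose cardinality is bounded independently
  of \<open>M\<close>, such that each transition arrow out of an \<open>X j\<close> with \<open>j \<in> J\<close> is equal to one with target in \<open>J\<close>.
  The direct limit \<open>P\<close> over \<open>J\<close> is in \<open>\<C>\<close>. It is a subobject of \<open>M\<close>, and maps from finitely presentable
  objects to \<open>M/P\<close> lift to \<open>M\<close>; so \<open>M/P\<close> is in \<open>\<C>\<close> by the criterion (\<open>subsystem_pure\<close>,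
  \<open>small_pure_subobject\<close>). The objects \<open>P\<close> that arise in this way form a small set up to isomorphism,
  since they are quotients of one fixed coproduct. Splitting off such subobjects transfinitely, with
  unions at limit steps, filters \<open>M\<close> by these objects; the iteration stops at a small ordinal since \<open>M\<close> has
  only a small set of subobjects (\<open>direct_limits_subset_Fil\<close>). Conversely, a class that is closed under
  extensions and direct limits is closed under filtrations (\<open>Fil_subset_direct_limits\<close>).

  Throughout, an arrow from a generator to \<open>X\<close> is called an element of \<open>X\<close>. Exactness of direct limits
  is used only in the form that certain maps out of direct limits are monic, which can be tested on
  elements because the generators are finitely presentable.
\<close>

section \<open>Small sets\<close>

lemma inaccessibleD:
  assumes "inaccessible \<kappa>"
  shows "Card_order \<kappa>" "Cinfinite \<kappa>" "regularCard \<kappa>" "infinite (Field \<kappa>)" "|UNIV :: nat set| <o \<kappa>"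
proof -
  show 1: "Card_order \<kappa>" and 2: "regularCard \<kappa>" using assms by (auto simp: inaccessible_def)
  have "natLeq <o \<kappa>" using assms by (auto simp: inaccessible_def)
  then show 3: "|UNIV :: nat set| <o \<kappa>" using card_of_nat ordIso_ordLess_trans by blast
  have "|UNIV :: nat set| \<le>o |Field \<kappa>|"
    by (rule ordLess_imp_ordLeq[OF ordLess_ordIso_trans[OF 3 ordIso_symmetric[OF card_of_Field_ordIso[OF 1]]]])
  then show 4: "infinite (Field \<kappa>)" by (simp add: infinite_iff_card_of_nat)
  then show "Cinfinite \<kappa>" using 1 by (simp add: cinfinite_def)
qed

lemma small_inj_image:
  fixes \<kappa> :: "'u rel" and A :: "'a set"
  assumes "inaccessible \<kappa>" "small \<kappa> A"
  shows "\<exists>g :: 'a \<Rightarrow> 'u. inj_on g A"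
proof -
  have "|A| \<le>o |Field \<kappa>|"
    using ordLess_imp_ordLeq[OF ordLess_ordIso_trans[OF _ ordIso_symmetric[OF
          card_of_Field_ordIso[OF inaccessibleD(1)[OF assms(1)]]]]] assms(2)
    by (simp add: small_def)
  then show ?thesis unfolding card_of_ordLeq[symmetric] by blast
qed

lemma small_ordLeq: "small \<kappa> A \<Longrightarrow> |B| \<le>o |A| \<Longrightarrow> small \<kappa> B"
  unfolding small_def by (rule ordLeq_ordLess_trans)

lemma small_subset: "small \<kappa> A \<Longrightarrow> B \<subseteq> A \<Longrightarrow> small \<kappa> B"
  by (erule small_ordLeq) (rule card_of_mono1)

lemma small_image: "small \<kappa> A \<Longrightarrow> small \<kappa> (f ` A)"
  by (erule small_ordLeq) (rule card_of_image)

lemma small_inj: "small \<kappa> B \<Longrightarrow> inj_on f A \<Longrightarrow> f ` A \<subseteq> B \<Longrightarrow> small \<kappa> A"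
  by (erule small_ordLeq) (use card_of_ordLeq in blast)

lemma small_countable: "inaccessible \<kappa> \<Longrightarrow> small \<kappa> (A :: nat set)"
  using inaccessibleD(5) small_subset[of \<kappa> UNIV A] by (auto simp: small_def)

lemma small_UN:
  assumes "inaccessible \<kappa>" "small \<kappa> I" "\<And>i. i \<in> I \<Longrightarrow> small \<kappa> (A i)"
  shows "small \<kappa> (\<Union>i\<in>I. A i)"
  using assms card_of_UNION_ordLess_infinite_Field_regularCard[of \<kappa> I A] inaccessibleD[of \<kappa>]
  by (simp add: small_def)

lemma small_Times:
  assumes "inaccessible \<kappa>" "small \<kappa> A" "small \<kappa> B"
  shows "small \<kappa> (A \<times> B)"
proof -
  have "A \<times> B = (\<Union>a\<in>A. Pair a ` B)" by auto
  then show ?thesis using assms by (auto intro: small_UN small_image)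
qed

text \<open>The closure of \<open>\<kappa>\<close> under power sets is stated for subsets of \<open>'u\<close> only; any small set is
  equipotent to one of those.\<close>

lemma small_Pow:
  fixes \<kappa> :: "'u rel"
  assumes "inaccessible \<kappa>" "small \<kappa> A"
  shows "small \<kappa> (Pow A)"
proof -
  obtain g :: "_ \<Rightarrow> 'u" where g: "inj_on g A" using small_inj_image[OF assms] by blast
  have "small \<kappa> (Pow (g ` A))"
    using assms small_image[OF assms(2), of g] by (auto simp: inaccessible_def small_def)
  moreover have "inj_on (image g) (Pow A)" by (rule inj_on_image_Pow[OF g])
  ultimately show ?thesis by (rule small_inj) (auto simp: image_def)
qed

lemma directed_posetD:
  assumes "directed_poset I R"
  shows directed_poset_Field: "(i, j) \<in> R \<Longrightarrow> i \<in> I \<and> j \<in> I"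
    and directed_poset_refl: "i \<in> I \<Longrightarrow> (i, i) \<in> R"
    and directed_poset_trans: "(i, j) \<in> R \<Longrightarrow> (j, k) \<in> R \<Longrightarrow> (i, k) \<in> R"
    and directed_poset_bound: "i \<in> I \<Longrightarrow> j \<in> I \<Longrightarrow> \<exists>k. k \<in> I \<and> (i, k) \<in> R \<and> (j, k) \<in> R"
    and directed_poset_nonempty: "I \<noteq> {}"
proof -
  have *: "R \<subseteq> I \<times> I" "refl_on I R" "trans R" "I \<noteq> {}"
      "\<forall>i \<in> I. \<forall>j \<in> I. \<exists>k \<in> I. (i, k) \<in> R \<and> (j, k) \<in> R"
    using assms by (simp_all add: directed_poset_def partial_order_on_def preorder_on_def)
  show "(i, j) \<in> R \<Longrightarrow> i \<in> I \<and> j \<in> I" using *(1) by auto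
  show "i \<in> I \<Longrightarrow> (i, i) \<in> R" using *(2) by (simp add: refl_on_def)
  show "(i, j) \<in> R \<Longrightarrow> (j, k) \<in> R \<Longrightarrow> (i, k) \<in> R" using *(3) by (rule transD)
  show "i \<in> I \<Longrightarrow> j \<in> I \<Longrightarrow> \<exists>k. k \<in> I \<and> (i, k) \<in> R \<and> (j, k) \<in> R" using *(5) by blast
  show "I \<noteq> {}" by (rule *(4))
qed

section \<open>Direct limits of abelian groups\<close>

text \<open>If the elements \<open>\<psi> i a\<close> formed a proper subgroup \<open>N\<close> of \<open>L\<close>, then the projection of \<open>L\<close> to the
  quotient and the trivial map would be two different mediating maps for the zero cocone. The
  quotient \<open>L Mod N\<close> has to be transported to the type on which the universal property is
  tested, by tagging each coset with a fixed index.\<close>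

lemma group_direct_limit_surj:
  fixes G :: "'i \<Rightarrow> 'g monoid"
  assumes lim: "is_group_direct_limit I R G \<phi> L \<psi>" and dir: "directed_poset I R"
    and b: "b \<in> carrier L"
  shows "\<exists>i\<in>I. \<exists>a\<in>carrier (G i). b = \<psi> i a"
proof -
  note c = lim[unfolded is_group_direct_limit_def]
  have G: "\<And>i. i \<in> I \<Longrightarrow> comm_group (G i)" and \<phi>: "\<And>i j. (i, j) \<in> R \<Longrightarrow> \<phi> i j \<in> hom (G i) (G j)"
    and L: "comm_group L" and \<psi>: "\<And>i. i \<in> I \<Longrightarrow> \<psi> i \<in> hom (G i) L"
    and \<psi>\<phi>: "\<And>i j a. (i, j) \<in> R \<Longrightarrow> a \<in> carrier (G i) \<Longrightarrow> \<psi> j (\<phi> i j a) = \<psi> i a"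
    using c by simp_all
  have uni: "\<exists>h \<in> hom L H. (\<forall>i \<in> I. \<forall>a \<in> carrier (G i). h (\<psi> i a) = t i a) \<and>
      (\<forall>h' \<in> hom L H. (\<forall>i \<in> I. \<forall>a \<in> carrier (G i). h' (\<psi> i a) = t i a) \<longrightarrow> (\<forall>b \<in> carrier L. h' b = h b))"
    if "comm_group H" "\<forall>i \<in> I. t i \<in> hom (G i) H" "\<forall>i j. (i, j) \<in> R \<longrightarrow> (\<forall>a \<in> carrier (G i). t j (\<phi> i j a) = t i a)"
    for H :: "('i \<times> 'g) set monoid" and t
    using c[THEN conjunct2, THEN conjunct2, THEN conjunct2, THEN conjunct2, THEN conjunct2, THEN spec[of _ H],
        THEN spec[of _ t], THEN mp] that by simp
  have gr: "group (G i)" if "i \<in> I" for i using G[OF that] by (simp add: comm_group_def)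
  have RI: "\<And>i j. (i, j) \<in> R \<Longrightarrow> i \<in> I \<and> j \<in> I"
    using dir by (auto simp: directed_poset_def partial_order_on_def preorder_on_def)
  obtain i0 where i0: "i0 \<in> I" using dir by (auto simp: directed_poset_def)
  interpret L: comm_group L by fact
  define N where "N = {\<psi> i a |i a. i \<in> I \<and> a \<in> carrier (G i)}"
  have N_sub: "N \<subseteq> carrier L" using \<psi> by (auto simp: N_def hom_def)
  have N: "subgroup N L"
  proof (rule L.subgroupI)
    show "N \<subseteq> carrier L" by fact
    have "\<one>\<^bsub>G i0\<^esub> \<in> carrier (G i0)" using gr[OF i0] by (simp add: group.is_monoid)
    then show "N \<noteq> {}" using i0 by (auto simp: N_def)
  next
    fix x assume "x \<in> N"
    then obtain i a where i: "i \<in> I" and a: "a \<in> carrier (G i)" and x: "x = \<psi> i a" by (auto simp: N_def)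
    note gi = gr[OF i]
    have "inv\<^bsub>L\<^esub> x = \<psi> i (inv\<^bsub>G i\<^esub> a)"
      using group_hom.hom_inv[of "G i" L "\<psi> i" a] gi \<psi>[OF i] a x
      by (simp add: group_hom_def group_hom_axioms_def L.is_group)
    then show "inv\<^bsub>L\<^esub> x \<in> N" using i group.inv_closed[OF gi a] by (auto simp: N_def)
  next
    fix x y assume "x \<in> N" "y \<in> N"
    then obtain i a j c where ij: "i \<in> I" "j \<in> I" "a \<in> carrier (G i)" "c \<in> carrier (G j)"
      and xy: "x = \<psi> i a" "y = \<psi> j c" by (auto simp: N_def)
    then obtain k where k: "k \<in> I" "(i, k) \<in> R" "(j, k) \<in> R"
      using dir unfolding directed_poset_def by blast
    have m: "\<phi> i k a \<in> carrier (G k)" "\<phi> j k c \<in> carrier (G k)"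
      using \<phi>[OF k(2)] \<phi>[OF k(3)] ij by (auto simp: hom_def)
    have "x \<otimes>\<^bsub>L\<^esub> y = \<psi> k (\<phi> i k a) \<otimes>\<^bsub>L\<^esub> \<psi> k (\<phi> j k c)" using \<psi>\<phi> k ij xy by simp
    also have "\<dots> = \<psi> k (\<phi> i k a \<otimes>\<^bsub>G k\<^esub> \<phi> j k c)" using \<psi>[OF k(1)] m by (simp add: hom_def)
    finally show "x \<otimes>\<^bsub>L\<^esub> y \<in> N"
      using k(1) m group.is_monoid[OF gr[OF k(1)]] by (auto simp: N_def intro: monoid.m_closed)
  qed
  have Nn: "N \<lhd> L" using N by (simp add: L.normal_iff_subgroup)
  \<comment> \<open>The universal property is only available for groups of this type.\<close>
  define tag :: "'g set \<Rightarrow> ('i \<times> 'g) set" where "tag c = Pair i0 ` c" for c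
  define untag :: "('i \<times> 'g) set \<Rightarrow> 'g set" where "untag d = snd ` d" for d
  have ut: "untag (tag c) = c" for c by (force simp: tag_def untag_def)
  define Q where "Q = L Mod N"
  have Q: "comm_group Q" unfolding Q_def by (rule L.abelian_FactGroup[OF N])
  interpret Q: comm_group Q by fact
  define H :: "('i \<times> 'g) set monoid" where
    "H = \<lparr>carrier = tag ` carrier Q, monoid.mult = (\<lambda>x y. tag (untag x \<otimes>\<^bsub>Q\<^esub> untag y)), one = tag \<one>\<^bsub>Q\<^esub>\<rparr>"
  have H: "comm_group H"
  proof (rule comm_groupI)
    fix x assume "x \<in> carrier H"
    then obtain c where "c \<in> carrier Q" "x = tag c" by (auto simp: H_def)
    then show "\<exists>y\<in>carrier H. y \<otimes>\<^bsub>H\<^esub> x = \<one>\<^bsub>H\<^esub>"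
      by (intro bexI[of _ "tag (inv\<^bsub>Q\<^esub> c)"]) (auto simp: H_def ut)
  qed (auto simp: H_def ut Q.m_ac)
  define p where "p x = tag (N #>\<^bsub>L\<^esub> x)" for x
  have p: "p \<in> hom L H"
    using normal.r_coset_hom_Mod[OF Nn] by (auto simp: hom_def p_def H_def ut Q_def Pi_def)
  have z: "(\<lambda>x. \<one>\<^bsub>H\<^esub>) \<in> hom K' H" for K' :: "'g monoid"
    using H by (auto simp: hom_def comm_group_def group.is_monoid)
  have pN: "p x = \<one>\<^bsub>H\<^esub>" if "x \<in> N" for x
    using L.coset_join2[OF _ N that] that N_sub by (auto simp: p_def H_def Q_def FactGroup_def)
  have "\<exists>h \<in> hom L H. (\<forall>i \<in> I. \<forall>a \<in> carrier (G i). h (\<psi> i a) = \<one>\<^bsub>H\<^esub>) \<and>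
      (\<forall>h' \<in> hom L H. (\<forall>i \<in> I. \<forall>a \<in> carrier (G i). h' (\<psi> i a) = \<one>\<^bsub>H\<^esub>) \<longrightarrow> (\<forall>b \<in> carrier L. h' b = h b))"
    by (rule uni) (use H z in auto)
  then obtain h where h: "\<forall>h' \<in> hom L H. (\<forall>i \<in> I. \<forall>a \<in> carrier (G i). h' (\<psi> i a) = \<one>\<^bsub>H\<^esub>) \<longrightarrow>
      (\<forall>b \<in> carrier L. h' b = h b)"
    by (elim bexE conjE)
  have "p b = h b" by (rule h[THEN bspec, OF p, THEN mp, THEN bspec, OF _ b]) (use pN N_def in blast)
  moreover have "\<one>\<^bsub>H\<^esub> = h b" by (rule h[THEN bspec, OF z, THEN mp, THEN bspec, OF _ b]) simp
  ultimately have "p b = \<one>\<^bsub>H\<^esub>" by simp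
  then have "tag (N #>\<^bsub>L\<^esub> b) = tag N" by (simp add: p_def H_def Q_def FactGroup_def)
  then have "N #>\<^bsub>L\<^esub> b = N" using ut by metis
  then have "b \<in> N" using L.coset_join1[OF _ b N] by simp
  then show ?thesis by (auto simp: N_def)
qed

text \<open>Here the universal property is applied to the usual direct limit of the groups \<open>G i\<close>, in which
  the class of \<open>(i, a)\<close> is trivial only if \<open>a\<close> is trivial at some later stage.\<close>

lemma group_direct_limit_kernel:
  fixes G :: "'i \<Rightarrow> 'g monoid"
  assumes lim: "is_group_direct_limit I R G \<phi> L \<psi>" and dir: "directed_poset I R"
    and comp: "\<And>i j k a. (i, j) \<in> R \<Longrightarrow> (j, k) \<in> R \<Longrightarrow> a \<in> carrier (G i) \<Longrightarrow> \<phi> j k (\<phi> i j a) = \<phi> i k a"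
    and i: "i \<in> I" and a: "a \<in> carrier (G i)" and 0: "\<psi> i a = \<one>\<^bsub>L\<^esub>"
  shows "\<exists>j. (i, j) \<in> R \<and> \<phi> i j a = \<one>\<^bsub>G j\<^esub>"
proof -
  note c = lim[unfolded is_group_direct_limit_def]
  have G: "\<And>i. i \<in> I \<Longrightarrow> comm_group (G i)" and \<phi>: "\<And>i j. (i, j) \<in> R \<Longrightarrow> \<phi> i j \<in> hom (G i) (G j)"
    and L: "comm_group L"
    using c by simp_all
  have uni: "\<exists>h \<in> hom L H. (\<forall>i \<in> I. \<forall>a \<in> carrier (G i). h (\<psi> i a) = t i a) \<and>
      (\<forall>h' \<in> hom L H. (\<forall>i \<in> I. \<forall>a \<in> carrier (G i). h' (\<psi> i a) = t i a) \<longrightarrow> (\<forall>b \<in> carrier L. h' b = h b))"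
    if "comm_group H" "\<forall>i \<in> I. t i \<in> hom (G i) H" "\<forall>i j. (i, j) \<in> R \<longrightarrow> (\<forall>a \<in> carrier (G i). t j (\<phi> i j a) = t i a)"
    for H :: "('i \<times> 'g) set monoid" and t
    using c[THEN conjunct2, THEN conjunct2, THEN conjunct2, THEN conjunct2, THEN conjunct2, THEN spec[of _ H],
        THEN spec[of _ t], THEN mp] that by simp
  have gr: "group (G i)" and mo: "monoid (G i)" and cmo: "comm_monoid (G i)" if "i \<in> I" for i
    using G[OF that] by (auto simp: comm_group_def group_def)
  note RI = directed_poset_Field[OF dir] and Rr = directed_poset_refl[OF dir]
    and Rt = directed_poset_trans[OF dir] and Rd = directed_poset_bound[OF dir]
  have \<phi>c: "\<phi> i j a \<in> carrier (G j)" if "(i, j) \<in> R" "a \<in> carrier (G i)" for i j a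
    using \<phi>[OF that(1)] that(2) by (auto simp: hom_def)
  have \<phi>m: "\<phi> i j (a \<otimes>\<^bsub>G i\<^esub> b) = \<phi> i j a \<otimes>\<^bsub>G j\<^esub> \<phi> i j b"
    if "(i, j) \<in> R" "a \<in> carrier (G i)" "b \<in> carrier (G i)" for i j a b
    using \<phi>[OF that(1)] that(2,3) by (auto simp: hom_def)
  have \<phi>1: "\<phi> i j \<one>\<^bsub>G i\<^esub> = \<one>\<^bsub>G j\<^esub>" if "(i, j) \<in> R" for i j
    using group_hom.hom_one[of "G i" "G j" "\<phi> i j"] \<phi>[OF that] gr RI[OF that]
    by (simp add: group_hom_def group_hom_axioms_def)
  \<comment> \<open>The equivalence relation that defines the direct limit: \<open>a\<close> and \<open>b\<close> agree at some later stage.\<close>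
  define E where "E i a j b \<longleftrightarrow> (\<exists>k. (i, k) \<in> R \<and> (j, k) \<in> R \<and> \<phi> i k a = \<phi> j k b)" for i a j b
  have E_sym: "E i a j b \<Longrightarrow> E j b i a" for i a j b by (auto simp: E_def)
  have E_trans: "E i a l d" if ij: "E i a j b" and jl: "E j b l d"
    and inn: "a \<in> carrier (G i)" "b \<in> carrier (G j)" "d \<in> carrier (G l)" for i a j b l d
  proof -
    obtain k where k: "(i, k) \<in> R" "(j, k) \<in> R" "\<phi> i k a = \<phi> j k b" using ij by (auto simp: E_def)
    obtain m where m: "(j, m) \<in> R" "(l, m) \<in> R" "\<phi> j m b = \<phi> l m d" using jl by (auto simp: E_def)
    obtain n where n: "(k, n) \<in> R" "(m, n) \<in> R" using Rd k m RI by blast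
    have "\<phi> i n a = \<phi> k n (\<phi> i k a)" using comp[OF k(1) n(1)] inn by simp
    also have "\<dots> = \<phi> j n b" using comp[OF k(2) n(1)] k inn by simp
    also have "\<dots> = \<phi> m n (\<phi> j m b)" using comp[OF m(1) n(2)] inn by simp
    also have "\<dots> = \<phi> l n d" using comp[OF m(2) n(2)] m inn by simp
    finally show ?thesis using Rt k m n by (auto simp: E_def)
  qed
  have E_push: "E k (\<phi> i k a) i a" if "(i, k) \<in> R" "a \<in> carrier (G i)" for i k a
    unfolding E_def using comp[OF that(1) Rr that(2)] RI[OF that(1)] Rr that(1) by (intro exI[of _ k]) auto
  define cls where "cls i a = {(j, b). j \<in> I \<and> b \<in> carrier (G j) \<and> E i a j b}" for i a
  have cls_eq: "cls i a = cls j b \<longleftrightarrow> E i a j b"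
    if inn: "i \<in> I" "j \<in> I" "a \<in> carrier (G i)" "b \<in> carrier (G j)" for i j a b
  proof
    assume "cls i a = cls j b"
    moreover have "(j, b) \<in> cls j b" using inn Rr by (auto simp: cls_def E_def)
    ultimately show "E i a j b" by (auto simp: cls_def)
  next
    assume "E i a j b"
    then have "E i a l d \<longleftrightarrow> E j b l d" if "d \<in> carrier (G l)" for l d
      using E_trans[of i a j b l d] E_trans[of j b i a l d] E_sym[of i a j b] inn that by blast
    then show "cls i a = cls j b" by (auto simp: cls_def)
  qed
  have push: "cls k (\<phi> i k a) = cls i a" if "(i, k) \<in> R" "a \<in> carrier (G i)" for i k a
    using cls_eq[of k i] E_push[OF that] RI[OF that(1)] \<phi>c[OF that] that(2) by simp
  define H :: "('i \<times> 'g) set monoid" where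
    "H = \<lparr>carrier = {cls i a |i a. i \<in> I \<and> a \<in> carrier (G i)},
      monoid.mult = (\<lambda>c d. \<Union>{cls k (a \<otimes>\<^bsub>G k\<^esub> b) |k a b. k \<in> I \<and> a \<in> carrier (G k) \<and> b \<in> carrier (G k) \<and>
        c = cls k a \<and> d = cls k b}), one = cls i \<one>\<^bsub>G i\<^esub>\<rparr>"
  have mult_wd: "cls k' (a' \<otimes>\<^bsub>G k'\<^esub> b') = cls k (a \<otimes>\<^bsub>G k\<^esub> b)"
    if inn: "k \<in> I" "a \<in> carrier (G k)" "b \<in> carrier (G k)" "k' \<in> I" "a' \<in> carrier (G k')" "b' \<in> carrier (G k')"
      and eq: "cls k a = cls k' a'" "cls k b = cls k' b'" for k a b k' a' b'
  proof -
    obtain m where m: "(k, m) \<in> R" "(k', m) \<in> R" "\<phi> k m a = \<phi> k' m a'"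
      using eq(1) cls_eq inn by (auto simp: E_def)
    obtain n where n: "(k, n) \<in> R" "(k', n) \<in> R" "\<phi> k n b = \<phi> k' n b'"
      using eq(2) cls_eq inn by (auto simp: E_def)
    obtain p where p: "(m, p) \<in> R" "(n, p) \<in> R" using Rd m n RI by blast
    have kp: "(k, p) \<in> R" "(k', p) \<in> R" using Rt m p by blast+
    have "\<phi> k p a = \<phi> k' p a'" using comp[OF m(1) p(1)] comp[OF m(2) p(1)] m(3) inn by metis
    moreover have "\<phi> k p b = \<phi> k' p b'" using comp[OF n(1) p(2)] comp[OF n(2) p(2)] n(3) inn by metis
    ultimately have "\<phi> k' p (a' \<otimes>\<^bsub>G k'\<^esub> b') = \<phi> k p (a \<otimes>\<^bsub>G k\<^esub> b)" using \<phi>m kp inn by simp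
    then show ?thesis
      using push[OF kp(1), of "a \<otimes>\<^bsub>G k\<^esub> b"] push[OF kp(2), of "a' \<otimes>\<^bsub>G k'\<^esub> b'"] inn mo
      by (simp add: monoid.m_closed)
  qed
  have mult_cls: "cls k a \<otimes>\<^bsub>H\<^esub> cls k b = cls k (a \<otimes>\<^bsub>G k\<^esub> b)"
    if inn: "k \<in> I" "a \<in> carrier (G k)" "b \<in> carrier (G k)" for k a b
  proof -
    have "{cls k' (a' \<otimes>\<^bsub>G k'\<^esub> b') |k' a' b'. k' \<in> I \<and> a' \<in> carrier (G k') \<and> b' \<in> carrier (G k') \<and>
        cls k a = cls k' a' \<and> cls k b = cls k' b'} = {cls k (a \<otimes>\<^bsub>G k\<^esub> b)}"
      using mult_wd[OF inn] inn by blast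
    then show ?thesis by (simp add: H_def)
  qed
  have one_cls: "\<one>\<^bsub>H\<^esub> = cls k \<one>\<^bsub>G k\<^esub>" if "k \<in> I" for k
  proof -
    obtain m where m: "(i, m) \<in> R" "(k, m) \<in> R" using Rd i \<open>k \<in> I\<close> by blast
    show ?thesis
      using push[OF m(1), of "\<one>\<^bsub>G i\<^esub>"] push[OF m(2), of "\<one>\<^bsub>G k\<^esub>"] \<phi>1 m mo i that
      by (simp add: H_def monoid.one_closed)
  qed
  have clsH: "cls k a \<in> carrier H" if "k \<in> I" "a \<in> carrier (G k)" for k a using that by (auto simp: H_def)
  have rep: "\<exists>k a. k \<in> I \<and> a \<in> carrier (G k) \<and> x = cls k a" if "x \<in> carrier H" for x
    using that by (auto simp: H_def)
  have rep2: "\<exists>k a b. k \<in> I \<and> a \<in> carrier (G k) \<and> b \<in> carrier (G k) \<and> x = cls k a \<and> y = cls k b"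
    if xy: "x \<in> carrier H" "y \<in> carrier H" for x y
  proof -
    obtain k a l b where inn: "k \<in> I" "l \<in> I" "a \<in> carrier (G k)" "b \<in> carrier (G l)" "x = cls k a" "y = cls l b"
      using rep xy by metis
    obtain m where m: "(k, m) \<in> R" "(l, m) \<in> R" using Rd inn by blast
    have "x = cls m (\<phi> k m a)" "y = cls m (\<phi> l m b)" using push m inn by simp_all
    then show ?thesis using \<phi>c[OF m(1) inn(3)] \<phi>c[OF m(2) inn(4)] RI[OF m(1)] by blast
  qed
  have rep3: "\<exists>k a b d. k \<in> I \<and> a \<in> carrier (G k) \<and> b \<in> carrier (G k) \<and> d \<in> carrier (G k) \<and>
      x = cls k a \<and> y = cls k b \<and> z = cls k d"
    if xyz: "x \<in> carrier H" "y \<in> carrier H" "z \<in> carrier H" for x y z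
  proof -
    obtain k a b where k: "k \<in> I" "a \<in> carrier (G k)" "b \<in> carrier (G k)" "x = cls k a" "y = cls k b"
      using rep2 xyz by metis
    obtain l d where l: "l \<in> I" "d \<in> carrier (G l)" "z = cls l d" using rep xyz by metis
    obtain m where m: "(k, m) \<in> R" "(l, m) \<in> R" using Rd k l by blast
    have "x = cls m (\<phi> k m a)" "y = cls m (\<phi> k m b)" "z = cls m (\<phi> l m d)" using push m k l by simp_all
    then show ?thesis using \<phi>c[OF m(1) k(2)] \<phi>c[OF m(1) k(3)] \<phi>c[OF m(2) l(2)] RI[OF m(1)] by blast
  qed
  have H: "comm_group H"
  proof (rule comm_groupI)
    show "\<one>\<^bsub>H\<^esub> \<in> carrier H" using one_cls[OF i] clsH i mo by (simp add: monoid.one_closed)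
  next
    fix x y assume "x \<in> carrier H" "y \<in> carrier H"
    then obtain k a b where k: "k \<in> I" "a \<in> carrier (G k)" "b \<in> carrier (G k)" "x = cls k a" "y = cls k b"
      using rep2 by metis
    then show "x \<otimes>\<^bsub>H\<^esub> y \<in> carrier H" "x \<otimes>\<^bsub>H\<^esub> y = y \<otimes>\<^bsub>H\<^esub> x"
      using mo[OF k(1)] cmo[OF k(1)] by (simp_all add: mult_cls clsH monoid.m_closed comm_monoid.m_comm)
  next
    fix x y z assume "x \<in> carrier H" "y \<in> carrier H" "z \<in> carrier H"
    then obtain k a b d where k: "k \<in> I" "a \<in> carrier (G k)" "b \<in> carrier (G k)" "d \<in> carrier (G k)"
      "x = cls k a" "y = cls k b" "z = cls k d"
      using rep3 by metis
    then show "x \<otimes>\<^bsub>H\<^esub> y \<otimes>\<^bsub>H\<^esub> z = x \<otimes>\<^bsub>H\<^esub> (y \<otimes>\<^bsub>H\<^esub> z)"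
      using mo[OF k(1)] by (simp add: mult_cls monoid.m_closed monoid.m_assoc)
  next
    fix x assume "x \<in> carrier H"
    then obtain k a where k: "k \<in> I" "a \<in> carrier (G k)" "x = cls k a" using rep by metis
    show "\<one>\<^bsub>H\<^esub> \<otimes>\<^bsub>H\<^esub> x = x"
      using k mo[OF k(1)] by (simp add: one_cls[OF k(1)] mult_cls monoid.one_closed)
    have "inv\<^bsub>G k\<^esub> a \<in> carrier (G k)" "inv\<^bsub>G k\<^esub> a \<otimes>\<^bsub>G k\<^esub> a = \<one>\<^bsub>G k\<^esub>"
      using group.inv_closed[OF gr] group.l_inv[OF gr] k by blast+
    then show "\<exists>y\<in>carrier H. y \<otimes>\<^bsub>H\<^esub> x = \<one>\<^bsub>H\<^esub>"
      using k clsH by (intro bexI[of _ "cls k (inv\<^bsub>G k\<^esub> a)"]) (simp_all add: one_cls[OF k(1)] mult_cls)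
  qed
  have "\<exists>h \<in> hom L H. (\<forall>i \<in> I. \<forall>a \<in> carrier (G i). h (\<psi> i a) = cls i a) \<and>
      (\<forall>h' \<in> hom L H. (\<forall>i \<in> I. \<forall>a \<in> carrier (G i). h' (\<psi> i a) = cls i a) \<longrightarrow> (\<forall>b \<in> carrier L. h' b = h b))"
    by (rule uni) (use H clsH mult_cls push in \<open>auto simp: hom_def\<close>)
  then obtain h where h: "h \<in> hom L H" "\<And>i a. i \<in> I \<Longrightarrow> a \<in> carrier (G i) \<Longrightarrow> h (\<psi> i a) = cls i a"
    by (elim bexE conjE) simp
  have "h \<one>\<^bsub>L\<^esub> = \<one>\<^bsub>H\<^esub>"
    using group_hom.hom_one[of L H h] h(1) L H by (simp add: group_hom_def group_hom_axioms_def comm_group_def)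
  then have "cls i a = cls i \<one>\<^bsub>G i\<^esub>" using h(2)[OF i a] 0 one_cls[OF i] by simp
  then have "E i a i \<one>\<^bsub>G i\<^esub>" using cls_eq i a mo by (simp add: monoid.one_closed)
  then show ?thesis using \<phi>1 by (auto simp: E_def)
qed

section \<open>Abelian categories\<close>

context category
begin

text \<open>Membership in Hom sets is unfolded to typing equations for domain and codomain. With the
  composition law in the form below, the simplifier normalises composites to the right and checks
  all typing conditions.\<close>

lemma Hom_iff [simp]: "f \<in> Hom K X Y \<longleftrightarrow> f \<in> Ar K \<and> Dom K f = X \<and> Cod K f = Y"
  by (simp add: Hom_def)

lemma arr_Ob [simp]: "f \<in> Ar K \<Longrightarrow> Dom K f \<in> Ob K" "f \<in> Ar K \<Longrightarrow> Cod K f \<in> Ob K"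
  by (simp_all add: Dom_Ob Cod_Ob)

lemma ident_arr [simp]:
  "X \<in> Ob K \<Longrightarrow> ident K X \<in> Ar K" "X \<in> Ob K \<Longrightarrow> Dom K (ident K X) = X" "X \<in> Ob K \<Longrightarrow> Cod K (ident K X) = X"
  using ident_Hom[of X] by simp_all

lemma comp_arr [simp]:
  assumes "f \<in> Ar K" "g \<in> Ar K" "Cod K f = Dom K g"
  shows "g \<cdot> f \<in> Ar K" "Dom K (g \<cdot> f) = Dom K f" "Cod K (g \<cdot> f) = Cod K g"
  using comp_Hom[of f "Dom K f" "Cod K f" g "Cod K g"] assms by simp_all

lemma assoc [simp]:
  assumes "f \<in> Ar K" "g \<in> Ar K" "h \<in> Ar K" "Cod K f = Dom K g" "Cod K g = Dom K h"
  shows "(h \<cdot> g) \<cdot> f = h \<cdot> g \<cdot> f"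
  using comp_assoc[of f "Dom K f" "Cod K f" g "Cod K g" h "Cod K h"] assms by simp

lemma ident_comp [simp]:
  "f \<in> Ar K \<Longrightarrow> Cod K f = Y \<Longrightarrow> ident K Y \<cdot> f = f"
  "f \<in> Ar K \<Longrightarrow> Dom K f = X \<Longrightarrow> f \<cdot> ident K X = f"
  using comp_ident_left[of f "Dom K f" Y] comp_ident_right[of f X "Cod K f"] by simp_all

lemma reassoc:
  assumes "g \<cdot> f = h" "f \<in> Ar K" "g \<in> Ar K" "k \<in> Ar K" "Cod K f = Dom K g" "Cod K k = Dom K f"
  shows "g \<cdot> f \<cdot> k = h \<cdot> k"
  using assms assoc[of k f g] by simp

lemma monicD:
  assumes "monic K m" "m \<cdot> f = m \<cdot> g" "f \<in> Ar K" "g \<in> Ar K" "Cod K f = Dom K m" "Cod K g = Dom K m"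
    "Dom K f = Dom K g"
  shows "f = g"
  using assms arr_Ob(1)[OF assms(4)] unfolding monic_def by (metis Hom_iff)

lemma epicD:
  assumes "epic K e" "f \<cdot> e = g \<cdot> e" "f \<in> Ar K" "g \<in> Ar K" "Dom K f = Cod K e" "Dom K g = Cod K e"
    "Cod K f = Cod K g"
  shows "f = g"
  using assms arr_Ob(2)[OF assms(4)] unfolding epic_def by (metis Hom_iff)

lemma monic_arr: "monic K m \<Longrightarrow> m \<in> Ar K" and epic_arr: "epic K m \<Longrightarrow> m \<in> Ar K"
  by (simp_all add: monic_def epic_def)

lemma iso_arrE:
  assumes "iso_arr K f"
  obtains g where "f \<in> Ar K" "g \<in> Ar K" "Dom K g = Cod K f" "Cod K g = Dom K f"
    "g \<cdot> f = ident K (Dom K f)" "f \<cdot> g = ident K (Cod K f)"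
  using assms by (auto simp: iso_arr_def)

lemma iso_arrI:
  assumes "f \<in> Ar K" "g \<in> Ar K" "Dom K g = Cod K f" "Cod K g = Dom K f"
    "g \<cdot> f = ident K (Dom K f)" "f \<cdot> g = ident K (Cod K f)"
  shows "iso_arr K f"
  using assms unfolding iso_arr_def by (intro conjI bexI[of _ g]) auto

lemma iso_monic:
  assumes "iso_arr K f" shows "monic K f"
proof -
  obtain g where g: "f \<in> Ar K" "g \<in> Ar K" "Dom K g = Cod K f" "Cod K g = Dom K f"
    "g \<cdot> f = ident K (Dom K f)" using assms by (rule iso_arrE)
  have "u = v" if uv: "u \<in> Hom K X (Dom K f)" "v \<in> Hom K X (Dom K f)" "f \<cdot> u = f \<cdot> v" for X u v
  proof -
    have "(g \<cdot> f) \<cdot> u = (g \<cdot> f) \<cdot> v" using uv g(1-4) by simp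
    then show ?thesis using uv g by simp
  qed
  then show ?thesis using g(1) unfolding monic_def by blast
qed

lemma isomorphicE:
  assumes "isomorphic K X Y"
  obtains f g where "f \<in> Ar K" "g \<in> Ar K" "Dom K f = X" "Cod K f = Y" "Dom K g = Y" "Cod K g = X"
    "g \<cdot> f = ident K X" "f \<cdot> g = ident K Y"
  using assms by (auto simp: isomorphic_def elim: iso_arrE)

lemma isomorphicI:
  assumes "f \<in> Ar K" "g \<in> Ar K" "Dom K f = X" "Cod K f = Y" "Dom K g = Y" "Cod K g = X"
    "g \<cdot> f = ident K X" "f \<cdot> g = ident K Y"
  shows "isomorphic K X Y"
  unfolding isomorphic_def using assms by (intro bexI[of _ f] iso_arrI[of _ g]) auto

lemma iso_arr_isomorphic: "iso_arr K \<theta> \<Longrightarrow> isomorphic K (Dom K \<theta>) (Cod K \<theta>)"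
  unfolding isomorphic_def by (intro bexI[of _ \<theta>]) (auto elim: iso_arrE)

lemma isomorphic_sym: "isomorphic K X Y \<Longrightarrow> isomorphic K Y X"
  by (erule isomorphicE) (rule isomorphicI)

lemma isomorphic_Ob: "isomorphic K X Y \<Longrightarrow> X \<in> Ob K" "isomorphic K X Y \<Longrightarrow> Y \<in> Ob K"
  by (auto elim!: isomorphicE)

end

definition minus_arr :: "('o, 'm, 'x) abcat_scheme \<Rightarrow> 'm \<Rightarrow> 'm \<Rightarrow> 'm" (infixl \<open>\<boxminus>\<index>\<close> 65) where
  "minus_arr K f g = f \<boxplus>\<^bsub>K\<^esub> inv\<^bsub>hom_group K (Dom K f) (Cod K f)\<^esub> g"

text \<open>In a pushout (pullback) square, \<open>f'\<close> is the pushout (pullback) of \<open>f\<close> along \<open>g\<close>, and \<open>g'\<close> is that of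
  \<open>g\<close> along \<open>f\<close>.\<close>

definition is_pushout :: "('o, 'm, 'x) cat_scheme \<Rightarrow> 'm \<Rightarrow> 'm \<Rightarrow> 'm \<Rightarrow> 'm \<Rightarrow> bool" where
  "is_pushout K f g f' g' \<longleftrightarrow> f \<in> Ar K \<and> g \<in> Ar K \<and> f' \<in> Ar K \<and> g' \<in> Ar K \<and>
     Dom K f = Dom K g \<and> Dom K f' = Cod K g \<and> Dom K g' = Cod K f \<and> Cod K f' = Cod K g' \<and>
     f' \<cdot>\<^bsub>K\<^esub> g = g' \<cdot>\<^bsub>K\<^esub> f \<and>
     (\<forall>u v. u \<in> Ar K \<and> v \<in> Ar K \<and> Dom K u = Cod K g \<and> Dom K v = Cod K f \<and> Cod K u = Cod K v \<and>
        u \<cdot>\<^bsub>K\<^esub> g = v \<cdot>\<^bsub>K\<^esub> f \<longrightarrow>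
        (\<exists>!h. h \<in> Hom K (Cod K f') (Cod K u) \<and> h \<cdot>\<^bsub>K\<^esub> f' = u \<and> h \<cdot>\<^bsub>K\<^esub> g' = v))"

definition is_pullback :: "('o, 'm, 'x) cat_scheme \<Rightarrow> 'm \<Rightarrow> 'm \<Rightarrow> 'm \<Rightarrow> 'm \<Rightarrow> bool" where
  "is_pullback K f g f' g' \<longleftrightarrow> f \<in> Ar K \<and> g \<in> Ar K \<and> f' \<in> Ar K \<and> g' \<in> Ar K \<and>
     Cod K f = Cod K g \<and> Cod K f' = Dom K g \<and> Cod K g' = Dom K f \<and> Dom K f' = Dom K g' \<and>
     g \<cdot>\<^bsub>K\<^esub> f' = f \<cdot>\<^bsub>K\<^esub> g' \<and>
     (\<forall>u v. u \<in> Ar K \<and> v \<in> Ar K \<and> Cod K u = Dom K g \<and> Cod K v = Dom K f \<and> Dom K u = Dom K v \<and>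
        g \<cdot>\<^bsub>K\<^esub> u = f \<cdot>\<^bsub>K\<^esub> v \<longrightarrow>
        (\<exists>!h. h \<in> Hom K (Dom K u) (Dom K f') \<and> f' \<cdot>\<^bsub>K\<^esub> h = u \<and> g' \<cdot>\<^bsub>K\<^esub> h = v))"

text \<open>The quotient of \<open>M\<close> by the images of all arrows in a family \<open>F\<close>: the universal epimorphism
  killing \<open>F\<close>.\<close>

definition is_quotient :: "('o, 'm, 'x) abcat_scheme \<Rightarrow> 'o \<Rightarrow> 'm set \<Rightarrow> 'm \<Rightarrow> bool" where
  "is_quotient K M F q \<longleftrightarrow> epic K q \<and> Dom K q = M \<and>
     (\<forall>f \<in> F. f \<in> Ar K \<and> Cod K f = M \<and> q \<cdot>\<^bsub>K\<^esub> f = zero_arr K (Dom K f) (Cod K q)) \<and>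
     (\<forall>g \<in> Ar K. Dom K g = M \<and> (\<forall>f \<in> F. g \<cdot>\<^bsub>K\<^esub> f = zero_arr K (Dom K f) (Cod K g)) \<longrightarrow>
        (\<exists>h. h \<in> Ar K \<and> Dom K h = Cod K q \<and> Cod K h = Cod K g \<and> h \<cdot>\<^bsub>K\<^esub> q = g))"

context preadditive_category
begin

lemma hom_group_simps [simp]:
  "carrier (hom_group K X Y) = Hom K X Y" "monoid.mult (hom_group K X Y) = plus_arr K"
  "one (hom_group K X Y) = zero_arr K X Y"
  by (simp_all add: hom_group_def)

lemma hom_is_group: "X \<in> Ob K \<Longrightarrow> Y \<in> Ob K \<Longrightarrow> group (hom_group K X Y)"
  using hom_group[of X Y] by (simp add: comm_group_def)

lemma zero_arr [simp]:
  assumes "X \<in> Ob K" "Y \<in> Ob K"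
  shows "zero_arr K X Y \<in> Ar K" "Dom K (zero_arr K X Y) = X" "Cod K (zero_arr K X Y) = Y"
  using monoid.one_closed[OF group.is_monoid[OF hom_is_group[OF assms]]] by simp_all

lemma plus_arr [simp]:
  assumes "f \<in> Ar K" "g \<in> Ar K" "Dom K f = Dom K g" "Cod K f = Cod K g"
  shows "f \<boxplus> g \<in> Ar K" "Dom K (f \<boxplus> g) = Dom K g" "Cod K (f \<boxplus> g) = Cod K g"
  using monoid.m_closed[OF group.is_monoid[OF hom_is_group[of "Dom K g" "Cod K g"]], of f g] assms by simp_all

lemma plus_zero [simp]:
  assumes "f \<in> Ar K" "Dom K f = X" "Cod K f = Y"
  shows "f \<boxplus> zero_arr K X Y = f" "zero_arr K X Y \<boxplus> f = f"
  using monoid.r_one[OF group.is_monoid[OF hom_is_group[of X Y]], of f]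
    monoid.l_one[OF group.is_monoid[OF hom_is_group[of X Y]], of f] assms by auto

lemma comp_plus [simp]:
  "\<lbrakk>f \<in> Ar K; g \<in> Ar K; g' \<in> Ar K; Cod K f = Dom K g; Dom K g' = Dom K g; Cod K g' = Cod K g\<rbrakk>
    \<Longrightarrow> (g \<boxplus> g') \<cdot> f = g \<cdot> f \<boxplus> g' \<cdot> f"
  "\<lbrakk>f \<in> Ar K; f' \<in> Ar K; g \<in> Ar K; Cod K f = Dom K g; Dom K f' = Dom K f; Cod K f' = Cod K f\<rbrakk>
    \<Longrightarrow> g \<cdot> (f \<boxplus> f') = g \<cdot> f \<boxplus> g \<cdot> f'"
  using comp_plus_left[of f "Dom K f" "Dom K g" g "Cod K g" g']
    comp_plus_right[of f "Dom K f" "Cod K f" f' g "Cod K g"] by simp_all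

lemma plus_self_zero:
  assumes "f \<in> Ar K" "g \<in> Ar K" "Dom K f = Dom K g" "Cod K f = Cod K g" "f \<boxplus> g = f"
  shows "g = zero_arr K (Dom K g) (Cod K g)"
  using group.r_cancel_one'[OF hom_is_group[of "Dom K g" "Cod K g"], of f g]
    group.l_cancel_one'[OF hom_is_group[of "Dom K g" "Cod K g"], of f g] assms
  by simp

lemma comp_zero [simp]:
  "f \<in> Ar K \<Longrightarrow> Dom K f = Y \<Longrightarrow> X \<in> Ob K \<Longrightarrow> f \<cdot> zero_arr K X Y = zero_arr K X (Cod K f)"
  "f \<in> Ar K \<Longrightarrow> Cod K f = Y \<Longrightarrow> Z \<in> Ob K \<Longrightarrow> zero_arr K Y Z \<cdot> f = zero_arr K (Dom K f) Z"
proof -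
  assume a: "f \<in> Ar K" "Dom K f = Y" "X \<in> Ob K"
  have b: "Y \<in> Ob K" using a by auto
  have "f \<cdot> zero_arr K X Y \<boxplus> f \<cdot> zero_arr K X Y = f \<cdot> zero_arr K X Y"
    using a b comp_plus(2)[of "zero_arr K X Y" "zero_arr K X Y" f] by simp
  from plus_self_zero[OF _ _ _ _ this] a b show "f \<cdot> zero_arr K X Y = zero_arr K X (Cod K f)" by simp
next
  assume a: "f \<in> Ar K" "Cod K f = Y" "Z \<in> Ob K"
  have b: "Y \<in> Ob K" using a by auto
  have "zero_arr K Y Z \<cdot> f \<boxplus> zero_arr K Y Z \<cdot> f = zero_arr K Y Z \<cdot> f"
    using a b comp_plus(1)[of f "zero_arr K Y Z" "zero_arr K Y Z"] by simp
  from plus_self_zero[OF _ _ _ _ this] a b show "zero_arr K Y Z \<cdot> f = zero_arr K (Dom K f) Z" by simp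
qed

lemma minus_arr [simp]:
  assumes "f \<in> Ar K" "g \<in> Ar K" "Dom K f = Dom K g" "Cod K f = Cod K g"
  shows "f \<boxminus> g \<in> Ar K" "Dom K (f \<boxminus> g) = Dom K g" "Cod K (f \<boxminus> g) = Cod K g"
  using group.inv_closed[OF hom_is_group[of "Dom K g" "Cod K g"], of g] assms
  by (simp_all add: minus_arr_def)

lemma minus_plus:
  assumes "f \<in> Ar K" "g \<in> Ar K" "Dom K f = Dom K g" "Cod K f = Cod K g"
  shows "(f \<boxminus> g) \<boxplus> g = f"
proof -
  interpret H: group "hom_group K (Dom K g) (Cod K g)" using assms by (simp add: hom_is_group)
  show ?thesis using H.m_assoc[of f "inv\<^bsub>hom_group K (Dom K g) (Cod K g)\<^esub> g" g] H.inv_closed[of g] H.l_inv[of g] assms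
    by (simp add: minus_arr_def)
qed

lemma minus_unique:
  assumes "f \<in> Ar K" "g \<in> Ar K" "h \<in> Ar K" "Dom K f = Dom K g" "Cod K f = Cod K g" "Dom K h = Dom K g" "Cod K h = Cod K g"
    "h \<boxplus> g = f"
  shows "f \<boxminus> g = h"
proof -
  interpret H: group "hom_group K (Dom K g) (Cod K g)" using assms by (simp add: hom_is_group)
  show ?thesis using H.right_cancel[of g "f \<boxminus> g" h] minus_plus[of f g] assms by simp
qed

lemma minus_eq_zero [simp]:
  assumes "f \<in> Ar K" "g \<in> Ar K" "Dom K f = X" "Cod K f = Y" "Dom K g = X" "Cod K g = Y"
  shows "f \<boxminus> g = zero_arr K X Y \<longleftrightarrow> f = g"
  using minus_plus[of f g] minus_unique[of g g "zero_arr K X Y"] assms by auto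

lemma minus_zero [simp]:
  assumes "f \<in> Ar K" "Dom K f = X" "Cod K f = Y"
  shows "f \<boxminus> zero_arr K X Y = f"
  using minus_unique[of f "zero_arr K X Y" f] assms by auto

lemma comp_minus [simp]:
  "\<lbrakk>f \<in> Ar K; g \<in> Ar K; g' \<in> Ar K; Cod K f = Dom K g; Dom K g' = Dom K g; Cod K g' = Cod K g\<rbrakk>
    \<Longrightarrow> (g \<boxminus> g') \<cdot> f = g \<cdot> f \<boxminus> g' \<cdot> f"
  "\<lbrakk>f \<in> Ar K; f' \<in> Ar K; g \<in> Ar K; Cod K f = Dom K g; Dom K f' = Dom K f; Cod K f' = Cod K f\<rbrakk>
    \<Longrightarrow> g \<cdot> (f \<boxminus> f') = g \<cdot> f \<boxminus> g \<cdot> f'"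
proof -
  assume a: "f \<in> Ar K" "g \<in> Ar K" "g' \<in> Ar K" "Cod K f = Dom K g" "Dom K g' = Dom K g" "Cod K g' = Cod K g"
  have "(g \<boxminus> g') \<cdot> f \<boxplus> g' \<cdot> f = ((g \<boxminus> g') \<boxplus> g') \<cdot> f" using a by simp
  also have "\<dots> = g \<cdot> f" using a by (simp add: minus_plus)
  finally show "(g \<boxminus> g') \<cdot> f = g \<cdot> f \<boxminus> g' \<cdot> f" using a by (intro minus_unique[symmetric]) auto
next
  assume a: "f \<in> Ar K" "f' \<in> Ar K" "g \<in> Ar K" "Cod K f = Dom K g" "Dom K f' = Dom K f" "Cod K f' = Cod K f"
  have "g \<cdot> (f \<boxminus> f') \<boxplus> g \<cdot> f' = g \<cdot> ((f \<boxminus> f') \<boxplus> f')" using a by simp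
  also have "\<dots> = g \<cdot> f" using a by (simp add: minus_plus)
  finally show "g \<cdot> (f \<boxminus> f') = g \<cdot> f \<boxminus> g \<cdot> f'" using a by (intro minus_unique[symmetric]) auto
qed

lemma monicI:
  assumes "m \<in> Ar K" "\<And>f. f \<in> Ar K \<Longrightarrow> Cod K f = Dom K m \<Longrightarrow> m \<cdot> f = zero_arr K (Dom K f) (Cod K m)
    \<Longrightarrow> f = zero_arr K (Dom K f) (Dom K m)"
  shows "monic K m"
  unfolding monic_def
proof (intro conjI ballI impI assms(1))
  fix X f g assume a: "X \<in> Ob K" "f \<in> Hom K X (Dom K m)" "g \<in> Hom K X (Dom K m)" "m \<cdot> f = m \<cdot> g"
  then show "f = g" using assms(2)[of "f \<boxminus> g"] assms(1) by simp
qed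

lemma epicI:
  assumes "e \<in> Ar K" "\<And>f. f \<in> Ar K \<Longrightarrow> Dom K f = Cod K e \<Longrightarrow> f \<cdot> e = zero_arr K (Dom K e) (Cod K f)
    \<Longrightarrow> f = zero_arr K (Cod K e) (Cod K f)"
  shows "epic K e"
  unfolding epic_def
proof (intro conjI ballI impI assms(1))
  fix Y f g assume a: "Y \<in> Ob K" "f \<in> Hom K (Cod K e) Y" "g \<in> Hom K (Cod K e) Y" "f \<cdot> e = g \<cdot> e"
  then show "f = g" using assms(2)[of "f \<boxminus> g"] assms(1) by simp
qed

lemma monic_zeroD:
  assumes "monic K m" "f \<in> Ar K" "Cod K f = Dom K m" "m \<cdot> f = zero_arr K X Y" "X = Dom K f" "Y = Cod K m"
  shows "f = zero_arr K (Dom K f) (Dom K m)"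
  by (rule monicD[OF assms(1)]) (use assms monic_arr[OF assms(1)] in auto)

lemma epic_zeroD:
  assumes "epic K e" "f \<in> Ar K" "Dom K f = Cod K e" "f \<cdot> e = zero_arr K X Y" "X = Dom K e" "Y = Cod K f"
  shows "f = zero_arr K (Cod K e) (Cod K f)"
  by (rule epicD[OF assms(1)]) (use assms epic_arr[OF assms(1)] in auto)

lemma zero_object_iff: "zero_object K Z \<longleftrightarrow> Z \<in> Ob K \<and> ident K Z = zero_arr K Z Z"
proof
  assume a: "zero_object K Z"
  then have Z: "Z \<in> Ob K" by (simp add: zero_object_def)
  then have "\<exists>!f. f \<in> Hom K Z Z" using a by (simp add: zero_object_def)
  moreover have "ident K Z \<in> Hom K Z Z" "zero_arr K Z Z \<in> Hom K Z Z" using Z by simp_all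
  ultimately show "Z \<in> Ob K \<and> ident K Z = zero_arr K Z Z" using Z by blast
next
  assume a: "Z \<in> Ob K \<and> ident K Z = zero_arr K Z Z"
  have "f = zero_arr K X Z" if "f \<in> Hom K X Z" for f X
    using ident_comp(1)[of f Z] that a by auto
  moreover have "f = zero_arr K Z X" if "f \<in> Hom K Z X" for f X
    using ident_comp(2)[of f Z] that a by auto
  moreover have "zero_arr K X Z \<in> Hom K X Z" "zero_arr K Z X \<in> Hom K Z X" if "X \<in> Ob K" for X
    using that a by simp_all
  ultimately show "zero_object K Z" unfolding zero_object_def using a by blast
qed

lemma zero_object_to:
  assumes "zero_object K Z" "f \<in> Ar K" "Cod K f = Z"
  shows "f = zero_arr K (Dom K f) Z"
  using assms by (metis zero_object_iff ident_comp(1) comp_zero(2))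

lemma zero_object_from:
  assumes "zero_object K Z" "f \<in> Ar K" "Dom K f = Z"
  shows "f = zero_arr K Z (Cod K f)"
  using assms by (metis zero_object_iff ident_comp(2) comp_zero(1))

lemma kernel_arr:
  assumes "is_kernel K f k"
  shows "f \<in> Ar K" "k \<in> Ar K" "Cod K k = Dom K f" "f \<cdot> k = zero_arr K (Dom K k) (Cod K f)"
  using assms by (auto simp: is_kernel_def)

lemma kernel_factor:
  assumes "is_kernel K f k" "g \<in> Ar K" "Cod K g = Dom K f" "f \<cdot> g = zero_arr K X Y" "X = Dom K g" "Y = Cod K f"
  shows "\<exists>h. h \<in> Ar K \<and> Dom K h = Dom K g \<and> Cod K h = Dom K k \<and> k \<cdot> h = g"
proof -
  have "\<exists>!h. h \<in> Hom K (Dom K g) (Dom K k) \<and> k \<cdot> h = g"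
    using assms unfolding is_kernel_def by auto
  then show ?thesis by auto
qed

lemma kernel_monic:
  assumes "is_kernel K f k" shows "monic K k"
proof (rule monicI)
  note k = kernel_arr[OF assms]
  show "k \<in> Ar K" by fact
  fix u assume u: "u \<in> Ar K" "Cod K u = Dom K k" "k \<cdot> u = zero_arr K (Dom K u) (Cod K k)"
  have "\<exists>!h. h \<in> Hom K (Dom K u) (Dom K k) \<and> k \<cdot> h = zero_arr K (Dom K u) (Dom K f)"
    using assms k u unfolding is_kernel_def by simp
  moreover have "u \<in> Hom K (Dom K u) (Dom K k)" "zero_arr K (Dom K u) (Dom K k) \<in> Hom K (Dom K u) (Dom K k)"
    "k \<cdot> zero_arr K (Dom K u) (Dom K k) = zero_arr K (Dom K u) (Dom K f)" "k \<cdot> u = zero_arr K (Dom K u) (Dom K f)"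
    using u k by simp_all
  ultimately show "u = zero_arr K (Dom K u) (Dom K k)" by blast
qed

lemma kernelI:
  assumes "monic K k" "f \<in> Ar K" "Cod K k = Dom K f" "f \<cdot> k = zero_arr K (Dom K k) (Cod K f)"
    "\<And>g. g \<in> Ar K \<Longrightarrow> Cod K g = Dom K f \<Longrightarrow> f \<cdot> g = zero_arr K (Dom K g) (Cod K f) \<Longrightarrow>
      \<exists>h. h \<in> Ar K \<and> Dom K h = Dom K g \<and> Cod K h = Dom K k \<and> k \<cdot> h = g"
  shows "is_kernel K f k"
  unfolding is_kernel_def
proof (intro conjI ballI impI)
  fix X g assume g: "X \<in> Ob K" "g \<in> Hom K X (Dom K f)" "f \<cdot> g = zero_arr K X (Cod K f)"
  obtain h where h: "h \<in> Ar K" "Dom K h = Dom K g" "Cod K h = Dom K k" "k \<cdot> h = g"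
    using assms(5)[of g] g by auto
  then show "\<exists>!h. h \<in> Hom K X (Dom K k) \<and> k \<cdot> h = g"
    using g by (intro ex1I[of _ h]) (auto intro!: monicD[OF assms(1)])
qed (use assms monic_arr in auto)

lemma cokernel_arr:
  assumes "is_cokernel K f c"
  shows "f \<in> Ar K" "c \<in> Ar K" "Dom K c = Cod K f" "c \<cdot> f = zero_arr K (Dom K f) (Cod K c)"
  using assms by (auto simp: is_cokernel_def)

lemma cokernel_factor:
  assumes "is_cokernel K f c" "g \<in> Ar K" "Dom K g = Cod K f" "g \<cdot> f = zero_arr K X Y" "X = Dom K f" "Y = Cod K g"
  shows "\<exists>h. h \<in> Ar K \<and> Dom K h = Cod K c \<and> Cod K h = Cod K g \<and> h \<cdot> c = g"
proof -
  have "\<exists>!h. h \<in> Hom K (Cod K c) (Cod K g) \<and> h \<cdot> c = g"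
    using assms unfolding is_cokernel_def by auto
  then show ?thesis by auto
qed

lemma cokernel_epic:
  assumes "is_cokernel K f c" shows "epic K c"
proof (rule epicI)
  note c = cokernel_arr[OF assms]
  show "c \<in> Ar K" by fact
  fix u assume u: "u \<in> Ar K" "Dom K u = Cod K c" "u \<cdot> c = zero_arr K (Dom K c) (Cod K u)"
  have "\<exists>!h. h \<in> Hom K (Cod K c) (Cod K u) \<and> h \<cdot> c = zero_arr K (Cod K f) (Cod K u)"
    using assms c u unfolding is_cokernel_def by simp
  moreover have "u \<in> Hom K (Cod K c) (Cod K u)" "zero_arr K (Cod K c) (Cod K u) \<in> Hom K (Cod K c) (Cod K u)"
    "zero_arr K (Cod K c) (Cod K u) \<cdot> c = zero_arr K (Cod K f) (Cod K u)" "u \<cdot> c = zero_arr K (Cod K f) (Cod K u)"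
    using u c by simp_all
  ultimately show "u = zero_arr K (Cod K c) (Cod K u)" by blast
qed

lemma cokernelI:
  assumes "epic K c" "f \<in> Ar K" "Dom K c = Cod K f" "c \<cdot> f = zero_arr K (Dom K f) (Cod K c)"
    "\<And>g. g \<in> Ar K \<Longrightarrow> Dom K g = Cod K f \<Longrightarrow> g \<cdot> f = zero_arr K (Dom K f) (Cod K g) \<Longrightarrow>
      \<exists>h. h \<in> Ar K \<and> Dom K h = Cod K c \<and> Cod K h = Cod K g \<and> h \<cdot> c = g"
  shows "is_cokernel K f c"
  unfolding is_cokernel_def
proof (intro conjI ballI impI)
  fix Y g assume g: "Y \<in> Ob K" "g \<in> Hom K (Cod K f) Y" "g \<cdot> f = zero_arr K (Dom K f) Y"
  obtain h where h: "h \<in> Ar K" "Dom K h = Cod K c" "Cod K h = Cod K g" "h \<cdot> c = g"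
    using assms(5)[of g] g by auto
  then show "\<exists>!h. h \<in> Hom K (Cod K c) Y \<and> h \<cdot> c = g"
    using g by (intro ex1I[of _ h]) (auto intro!: epicD[OF assms(1)])
qed (use assms epic_arr in auto)

end

context abelian_category
begin

lemma obtain_kernel: assumes "f \<in> Ar K" obtains k where "is_kernel K f k"
  using ex_kernel[OF assms] by blast

lemma obtain_cokernel: assumes "f \<in> Ar K" obtains c where "is_cokernel K f c"
  using ex_cokernel[OF assms] by blast

lemma monic_kernel_of_cokernel:
  assumes "monic K m" "is_cokernel K m c" shows "is_kernel K c m"
proof (rule kernelI[OF assms(1)])
  note c = cokernel_arr[OF assms(2)]
  show "c \<in> Ar K" "Cod K m = Dom K c" "c \<cdot> m = zero_arr K (Dom K m) (Cod K c)" using c by simp_all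
  fix g assume g: "g \<in> Ar K" "Cod K g = Dom K c" "c \<cdot> g = zero_arr K (Dom K g) (Cod K c)"
  obtain f where f: "is_kernel K f m" using monic_is_kernel[OF assms(1)] by blast
  note f' = kernel_arr[OF f]
  obtain f1 where f1: "f1 \<in> Ar K" "Dom K f1 = Cod K c" "Cod K f1 = Cod K f" "f1 \<cdot> c = f"
    using cokernel_factor[OF assms(2), of f] f' c by auto
  have "f \<cdot> g = (f1 \<cdot> c) \<cdot> g" using f1 by simp
  also have "\<dots> = zero_arr K (Dom K g) (Cod K f)" using f1(1-3) c g by simp
  finally show "\<exists>h. h \<in> Ar K \<and> Dom K h = Dom K g \<and> Cod K h = Dom K m \<and> m \<cdot> h = g"
    using kernel_factor[OF f, of g] g c f' by auto
qed

lemma epic_cokernel_of_kernel: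
  assumes "epic K e" "is_kernel K e k" shows "is_cokernel K k e"
proof (rule cokernelI[OF assms(1)])
  note c = kernel_arr[OF assms(2)]
  show "k \<in> Ar K" "Dom K e = Cod K k" "e \<cdot> k = zero_arr K (Dom K k) (Cod K e)" using c by simp_all
  fix g assume g: "g \<in> Ar K" "Dom K g = Cod K k" "g \<cdot> k = zero_arr K (Dom K k) (Cod K g)"
  obtain f where f: "is_cokernel K f e" using epic_is_cokernel[OF assms(1)] by blast
  note f' = cokernel_arr[OF f]
  obtain f1 where f1: "f1 \<in> Ar K" "Cod K f1 = Dom K k" "Dom K f1 = Dom K f" "k \<cdot> f1 = f"
    using kernel_factor[OF assms(2), of f] f' c by auto
  have "g \<cdot> f = zero_arr K (Dom K f) (Cod K g)"
    using reassoc[OF g(3), of f1] f1 c(2,3) g(1,2) by simp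
  then show "\<exists>h. h \<in> Ar K \<and> Dom K h = Cod K e \<and> Cod K h = Cod K g \<and> h \<cdot> e = g"
    using cokernel_factor[OF f, of g] g c f' by auto
qed

lemma monic_epic_iso:
  assumes "monic K f" "epic K f" shows "iso_arr K f"
proof -
  have f: "f \<in> Ar K" using assms monic_arr by blast
  obtain c where c: "is_cokernel K f c" using obtain_cokernel[OF f] by blast
  note c' = cokernel_arr[OF c]
  have "c = zero_arr K (Cod K f) (Cod K c)" using epic_zeroD[OF assms(2), of c] c' by simp
  then have "c \<cdot> ident K (Cod K f) = zero_arr K (Cod K f) (Cod K c)" using c' f by simp
  then obtain g where g: "g \<in> Ar K" "Dom K g = Cod K f" "Cod K g = Dom K f" "f \<cdot> g = ident K (Cod K f)"
    using kernel_factor[OF monic_kernel_of_cokernel[OF assms(1) c], of "ident K (Cod K f)"] c' f by auto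
  moreover have "g \<cdot> f = ident K (Dom K f)"
    by (rule monicD[OF assms(1)]) (use f g in \<open>simp_all add: reassoc[OF g(4)]\<close>)
  ultimately show ?thesis using f by (intro iso_arrI[of f g]) auto
qed

lemma biproduct_arr:
  assumes "biproduct K X Y P i1 i2 p1 p2" and "X \<in> Ob K" "Y \<in> Ob K"
  shows "P \<in> Ob K" "i1 \<in> Ar K" "i2 \<in> Ar K" "p1 \<in> Ar K" "p2 \<in> Ar K"
    "Dom K i1 = X" "Dom K i2 = Y" "Cod K i1 = P" "Cod K i2 = P"
    "Dom K p1 = P" "Dom K p2 = P" "Cod K p1 = X" "Cod K p2 = Y"
    "p1 \<cdot> i1 = ident K X" "p2 \<cdot> i2 = ident K Y" "(i1 \<cdot> p1) \<boxplus> (i2 \<cdot> p2) = ident K P"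
    "p1 \<cdot> i2 = zero_arr K Y X" "p2 \<cdot> i1 = zero_arr K X Y"
proof -
  show t: "P \<in> Ob K" "i1 \<in> Ar K" "i2 \<in> Ar K" "p1 \<in> Ar K" "p2 \<in> Ar K"
    "Dom K i1 = X" "Dom K i2 = Y" "Cod K i1 = P" "Cod K i2 = P"
    "Dom K p1 = P" "Dom K p2 = P" "Cod K p1 = X" "Cod K p2 = Y"
    and e: "p1 \<cdot> i1 = ident K X" "p2 \<cdot> i2 = ident K Y" "(i1 \<cdot> p1) \<boxplus> (i2 \<cdot> p2) = ident K P"
    using assms by (simp_all add: biproduct_def)
  have "p1 \<cdot> i2 \<boxplus> p1 \<cdot> i2 = p1 \<cdot> ((i1 \<cdot> p1) \<boxplus> (i2 \<cdot> p2)) \<cdot> i2"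
    using t assms(2,3) by (simp del: e add: e(2) reassoc[OF e(1)])
  also have "\<dots> = p1 \<cdot> i2" using t assms(2,3) e by simp
  finally show "p1 \<cdot> i2 = zero_arr K Y X" using plus_self_zero[of "p1 \<cdot> i2" "p1 \<cdot> i2"] t by simp
  have "p2 \<cdot> i1 \<boxplus> p2 \<cdot> i1 = p2 \<cdot> ((i1 \<cdot> p1) \<boxplus> (i2 \<cdot> p2)) \<cdot> i1"
    using t assms(2,3) by (simp del: e add: e(1) reassoc[OF e(2)])
  also have "\<dots> = p2 \<cdot> i1" using t assms(2,3) e by simp
  finally show "p2 \<cdot> i1 = zero_arr K X Y" using plus_self_zero[of "p2 \<cdot> i1" "p2 \<cdot> i1"] t by simp
qed

end

section \<open>Pullbacks, pushouts and short exact sequences\<close>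

context abelian_category
begin

text \<open>The pullback is the kernel \<open>k\<close> of \<open>\<phi> = e \<cdot> p1 \<boxminus> f \<cdot> p2\<close> on the biproduct. Since \<open>\<phi>\<close> restricts to \<open>e\<close>,
  it is epic, hence the cokernel of \<open>k\<close>. If \<open>w\<close> kills the projection \<open>p2 \<cdot> k\<close>, then \<open>w \<cdot> p2\<close> factors
  through \<open>\<phi>\<close> by some \<open>v\<close>, and restricting to the first summand gives \<open>v \<cdot> e = 0\<close>, so \<open>v\<close> and \<open>w\<close> vanish.\<close>

lemma ex_pullback_epic:
  assumes e: "epic K e" and f: "f \<in> Ar K" "Cod K f = Cod K e"
  shows "\<exists>e' f'. is_pullback K e f e' f' \<and> epic K e'"
proof -
  have e': "e \<in> Ar K" using e epic_arr by blast
  obtain P i1 i2 p1 p2 where "biproduct K (Dom K e) (Dom K f) P i1 i2 p1 p2"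
    using ex_biproduct e' f by (meson arr_Ob)
  note b = biproduct_arr[OF this arr_Ob(1)[OF e'] arr_Ob(1)[OF f(1)]]
  define \<phi> where "\<phi> = e \<cdot> p1 \<boxminus> f \<cdot> p2"
  have \<phi>: "\<phi> \<in> Ar K" "Dom K \<phi> = P" "Cod K \<phi> = Cod K e" using b e' f by (simp_all add: \<phi>_def)
  have \<phi>i1: "\<phi> \<cdot> i1 = e" using b e' f by (simp add: \<phi>_def)
  have \<phi>e: "epic K \<phi>"
  proof (rule epicI)
    fix u assume u: "u \<in> Ar K" "Dom K u = Cod K \<phi>" "u \<cdot> \<phi> = zero_arr K (Dom K \<phi>) (Cod K u)"
    have "u \<cdot> e = zero_arr K (Dom K e) (Cod K u)"
      using reassoc[OF u(3), of i1] u(1,2) \<phi> \<phi>i1 b by simp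
    then show "u = zero_arr K (Cod K \<phi>) (Cod K u)" using epic_zeroD[OF e, of u] u \<phi> by simp
  qed fact
  obtain k where k: "is_kernel K \<phi> k" using obtain_kernel[OF \<phi>(1)] .
  note k' = kernel_arr[OF k]
  have sq: "f \<cdot> p2 \<cdot> k = e \<cdot> p1 \<cdot> k"
  proof -
    have "e \<cdot> p1 \<cdot> k \<boxminus> f \<cdot> p2 \<cdot> k = zero_arr K (Dom K k) (Cod K e)"
      using k' \<phi> b e' f by (simp add: \<phi>_def)
    then show ?thesis using k' \<phi> b e' f by (subst (asm) minus_eq_zero) auto
  qed
  have ep: "epic K (p2 \<cdot> k)"
  proof (rule epicI)
    show "p2 \<cdot> k \<in> Ar K" using b k' \<phi> by simp
    fix w assume w: "w \<in> Ar K" "Dom K w = Cod K (p2 \<cdot> k)" "w \<cdot> p2 \<cdot> k = zero_arr K (Dom K (p2 \<cdot> k)) (Cod K w)"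
    have w': "Dom K w = Dom K f" using w b k' \<phi> by simp
    obtain v where v: "v \<in> Ar K" "Dom K v = Cod K \<phi>" "Cod K v = Cod K w" "v \<cdot> \<phi> = w \<cdot> p2"
      using cokernel_factor[OF epic_cokernel_of_kernel[OF \<phi>e k], of "w \<cdot> p2"] w w' b k' \<phi> by auto
    have "v \<cdot> e = w \<cdot> p2 \<cdot> i1" using reassoc[OF v(4), of i1] v(1,2) \<phi> \<phi>i1 b w w' by simp
    then have "v \<cdot> e = zero_arr K (Dom K e) (Cod K v)" using b w(1) w' v e' by simp
    then have "v = zero_arr K (Cod K e) (Cod K w)" using epic_zeroD[OF e, of v] v \<phi> by simp
    then have "w \<cdot> p2 = zero_arr K P (Cod K w)" using v(4) \<phi> w by simp
    then have "w \<cdot> p2 \<cdot> i2 = zero_arr K (Dom K f) (Cod K w)" using reassoc[of w p2 _ i2] w w' b f by simp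
    then show "w = zero_arr K (Cod K (p2 \<cdot> k)) (Cod K w)" using w w' b k' \<phi> by simp
  qed
  have "\<exists>!h. h \<in> Hom K (Dom K u) (Dom K (p2 \<cdot> k)) \<and> (p2 \<cdot> k) \<cdot> h = u \<and> (p1 \<cdot> k) \<cdot> h = v"
    if uv: "u \<in> Ar K" "v \<in> Ar K" "Cod K u = Dom K f" "Cod K v = Dom K e" "Dom K u = Dom K v" "f \<cdot> u = e \<cdot> v" for u v
  proof (rule ex_ex1I)
    define x where "x = i1 \<cdot> v \<boxplus> i2 \<cdot> u"
    have x: "x \<in> Ar K" "Dom K x = Dom K u" "Cod K x = P" "p1 \<cdot> x = v" "p2 \<cdot> x = u"
      using uv b e' f by (simp_all add: x_def reassoc[OF b(14)] reassoc[OF b(15)] reassoc[OF b(17)] reassoc[OF b(18)])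
    have "\<phi> \<cdot> x = zero_arr K (Dom K x) (Cod K \<phi>)"
      using x uv b e' f by (simp add: \<phi>_def)
    then obtain h where h: "h \<in> Ar K" "Dom K h = Dom K u" "Cod K h = Dom K k" "k \<cdot> h = x"
      using kernel_factor[OF k, of x] x uv b \<phi> by auto
    have "p2 \<cdot> k \<cdot> h = u" "p1 \<cdot> k \<cdot> h = v" unfolding h(4) using x by simp_all
    then show "\<exists>h. h \<in> Hom K (Dom K u) (Dom K (p2 \<cdot> k)) \<and> (p2 \<cdot> k) \<cdot> h = u \<and> (p1 \<cdot> k) \<cdot> h = v"
      using h(1-3) b k' \<phi> by (intro exI[of _ h]) simp
  next
    fix h h' assume a: "h \<in> Hom K (Dom K u) (Dom K (p2 \<cdot> k)) \<and> (p2 \<cdot> k) \<cdot> h = u \<and> (p1 \<cdot> k) \<cdot> h = v"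
      "h' \<in> Hom K (Dom K u) (Dom K (p2 \<cdot> k)) \<and> (p2 \<cdot> k) \<cdot> h' = u \<and> (p1 \<cdot> k) \<cdot> h' = v"
    have t: "h \<in> Ar K" "h' \<in> Ar K" "Dom K h = Dom K u" "Dom K h' = Dom K u" "Cod K h = Dom K k" "Cod K h' = Dom K k"
      using a b k' \<phi> by auto
    have c: "p2 \<cdot> k \<cdot> h = u" "p1 \<cdot> k \<cdot> h = v" "p2 \<cdot> k \<cdot> h' = u" "p1 \<cdot> k \<cdot> h' = v" using a t b k' \<phi> by auto
    have "k \<cdot> x = i1 \<cdot> p1 \<cdot> k \<cdot> x \<boxplus> i2 \<cdot> p2 \<cdot> k \<cdot> x" if "x \<in> Ar K" "Cod K x = Dom K k" for x
    proof -
      have "(i1 \<cdot> p1 \<boxplus> i2 \<cdot> p2) \<cdot> k \<cdot> x = k \<cdot> x" using that b(16) k' \<phi> by simp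
      then show ?thesis using that b(1-13) k' \<phi> by simp
    qed
    then have "k \<cdot> h = k \<cdot> h'" using c t by metis
    then show "h = h'" using monicD[OF kernel_monic[OF k]] t by simp
  qed
  then have "is_pullback K e f (p2 \<cdot> k) (p1 \<cdot> k)"
    unfolding is_pullback_def using e' f b k' \<phi> sq by simp
  with ep show ?thesis by blast
qed

text \<open>The pushout is the cokernel of \<open>\<psi> = i1 \<cdot> f \<boxminus> i2 \<cdot> g\<close>, and the argument for monomorphisms is dual to
  the previous one.\<close>

lemma ex_pushout:
  assumes f: "f \<in> Ar K" and g: "g \<in> Ar K" "Dom K f = Dom K g"
  shows "\<exists>f' g'. is_pushout K f g f' g' \<and> (monic K f \<longrightarrow> monic K f')"
proof -
  obtain P i1 i2 p1 p2 where "biproduct K (Cod K f) (Cod K g) P i1 i2 p1 p2"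
    using ex_biproduct f g by (meson arr_Ob)
  note b = biproduct_arr[OF this arr_Ob(2)[OF f] arr_Ob(2)[OF g(1)]]
  define \<psi> where "\<psi> = i1 \<cdot> f \<boxminus> i2 \<cdot> g"
  have \<psi>: "\<psi> \<in> Ar K" "Dom K \<psi> = Dom K g" "Cod K \<psi> = P" using b g f by (simp_all add: \<psi>_def)
  obtain c where c: "is_cokernel K \<psi> c" using obtain_cokernel[OF \<psi>(1)] .
  note c' = cokernel_arr[OF c]
  have sq: "c \<cdot> i2 \<cdot> g = c \<cdot> i1 \<cdot> f"
  proof -
    have "c \<cdot> i1 \<cdot> f \<boxminus> c \<cdot> i2 \<cdot> g = zero_arr K (Dom K g) (Cod K c)"
      using c' \<psi> b g f by (simp add: \<psi>_def)
    then show ?thesis using c' \<psi> b g f by (subst (asm) minus_eq_zero) auto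
  qed
  have mon: "monic K (c \<cdot> i2)" if m: "monic K f"
  proof (rule monicI)
    show "c \<cdot> i2 \<in> Ar K" using b c' \<psi> by simp
    have p1\<psi>: "p1 \<cdot> \<psi> = f"
      using b f g by (simp add: \<psi>_def reassoc[OF b(14)] reassoc[OF b(17)])
    have \<psi>m: "monic K \<psi>"
    proof (rule monicI)
      fix u assume u: "u \<in> Ar K" "Cod K u = Dom K \<psi>" "\<psi> \<cdot> u = zero_arr K (Dom K u) (Cod K \<psi>)"
      have "f \<cdot> u = zero_arr K (Dom K u) (Cod K f)" using reassoc[OF p1\<psi>, of u] u \<psi> b by simp
      then show "u = zero_arr K (Dom K u) (Dom K \<psi>)" using monic_zeroD[OF m, of u] u \<psi> g by simp
    qed fact
    fix w assume w: "w \<in> Ar K" "Cod K w = Dom K (c \<cdot> i2)" "(c \<cdot> i2) \<cdot> w = zero_arr K (Dom K w) (Cod K (c \<cdot> i2))"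
    have w': "Cod K w = Cod K g" using w b c' \<psi> by simp
    have cw: "c \<cdot> i2 \<cdot> w = zero_arr K (Dom K w) (Cod K c)" using w w' b c' \<psi> by simp
    obtain v where v: "v \<in> Ar K" "Dom K v = Dom K w" "Cod K v = Dom K \<psi>" "\<psi> \<cdot> v = i2 \<cdot> w"
      using kernel_factor[OF monic_kernel_of_cokernel[OF \<psi>m c], of "i2 \<cdot> w"] w w' cw b c' \<psi> by auto
    have "f \<cdot> v = p1 \<cdot> i2 \<cdot> w" using reassoc[OF p1\<psi>, of v] v \<psi> b by simp
    then have "f \<cdot> v = zero_arr K (Dom K v) (Cod K f)" using w(1) w' b v f by (simp add: reassoc[OF b(17)])
    then have "v = zero_arr K (Dom K w) (Dom K g)" using monic_zeroD[OF m, of v] v \<psi> g by simp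
    then have "i2 \<cdot> w = zero_arr K (Dom K w) P" using v(4) \<psi> w by simp
    then have "p2 \<cdot> i2 \<cdot> w = zero_arr K (Dom K w) (Cod K g)" using b w by simp
    then show "w = zero_arr K (Dom K w) (Dom K (c \<cdot> i2))" using w w' b c' \<psi> by (simp add: reassoc[OF b(15)])
  qed
  have "\<exists>!h. h \<in> Hom K (Cod K (c \<cdot> i2)) (Cod K u) \<and> h \<cdot> c \<cdot> i2 = u \<and> h \<cdot> c \<cdot> i1 = v"
    if uv: "u \<in> Ar K" "v \<in> Ar K" "Dom K u = Cod K g" "Dom K v = Cod K f" "Cod K u = Cod K v" "u \<cdot> g = v \<cdot> f" for u v
  proof (rule ex_ex1I)
    have "(v \<cdot> p1 \<boxplus> u \<cdot> p2) \<cdot> \<psi> = zero_arr K (Dom K f) (Cod K u)"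
      using uv b g f by (simp add: \<psi>_def reassoc[OF b(14)] reassoc[OF b(15)] reassoc[OF b(17)] reassoc[OF b(18)])
    then obtain h where h: "h \<in> Ar K" "Dom K h = Cod K c" "Cod K h = Cod K u" "h \<cdot> c = v \<cdot> p1 \<boxplus> u \<cdot> p2"
      using cokernel_factor[OF c, of "v \<cdot> p1 \<boxplus> u \<cdot> p2"] uv b \<psi> g by auto
    have "h \<cdot> c \<cdot> i2 = u" "h \<cdot> c \<cdot> i1 = v"
      using reassoc[OF h(4), of i2] reassoc[OF h(4), of i1] uv b h(1-3) c' \<psi> f g by simp_all
    then show "\<exists>h. h \<in> Hom K (Cod K (c \<cdot> i2)) (Cod K u) \<and> h \<cdot> c \<cdot> i2 = u \<and> h \<cdot> c \<cdot> i1 = v"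
      using h(1-3) b c' \<psi> by (intro exI[of _ h]) simp
  next
    fix h h' assume a: "h \<in> Hom K (Cod K (c \<cdot> i2)) (Cod K u) \<and> h \<cdot> c \<cdot> i2 = u \<and> h \<cdot> c \<cdot> i1 = v"
      "h' \<in> Hom K (Cod K (c \<cdot> i2)) (Cod K u) \<and> h' \<cdot> c \<cdot> i2 = u \<and> h' \<cdot> c \<cdot> i1 = v"
    have t: "h \<in> Ar K" "h' \<in> Ar K" "Cod K h = Cod K u" "Cod K h' = Cod K u" "Dom K h = Cod K c" "Dom K h' = Cod K c"
      using a b c' \<psi> by auto
    have "x \<cdot> c = (x \<cdot> c \<cdot> i1) \<cdot> p1 \<boxplus> (x \<cdot> c \<cdot> i2) \<cdot> p2" if "x \<in> Ar K" "Dom K x = Cod K c" for x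
    proof -
      have "(x \<cdot> c) \<cdot> (i1 \<cdot> p1 \<boxplus> i2 \<cdot> p2) = x \<cdot> c" using that b(16) c' \<psi> by simp
      then show ?thesis using that b(1-13) c' \<psi> by simp
    qed
    then have "h \<cdot> c = h' \<cdot> c" using a t by metis
    then show "h = h'" using epicD[OF cokernel_epic[OF c]] t by simp
  qed
  then have "is_pushout K f g (c \<cdot> i2) (c \<cdot> i1)"
    unfolding is_pushout_def using f g b c' \<psi> sq by simp
  with mon show ?thesis by blast
qed

lemma pullback_arr:
  assumes "is_pullback K f g f' g'"
  shows "f \<in> Ar K" "g \<in> Ar K" "f' \<in> Ar K" "g' \<in> Ar K" "Cod K f = Cod K g" "Cod K f' = Dom K g"
    "Cod K g' = Dom K f" "Dom K f' = Dom K g'" "g \<cdot> f' = f \<cdot> g'"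
  using assms by (auto simp: is_pullback_def)

lemma pullback_factor:
  assumes "is_pullback K f g f' g'" "u \<in> Ar K" "v \<in> Ar K" "Cod K u = Dom K g" "Cod K v = Dom K f"
    "Dom K u = Dom K v" "g \<cdot> u = f \<cdot> v"
  shows "\<exists>h. h \<in> Ar K \<and> Dom K h = Dom K v \<and> Cod K h = Dom K f' \<and> f' \<cdot> h = u \<and> g' \<cdot> h = v"
proof -
  have "\<exists>!h. h \<in> Hom K (Dom K u) (Dom K f') \<and> f' \<cdot> h = u \<and> g' \<cdot> h = v"
    using assms unfolding is_pullback_def by blast
  then show ?thesis using assms(6) by auto
qed

lemma pullback_unique:
  assumes "is_pullback K f g f' g'" "h \<in> Ar K" "h' \<in> Ar K" "Cod K h = Dom K f'" "Cod K h' = Dom K f'"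
    "Dom K h = Dom K h'" "f' \<cdot> h = f' \<cdot> h'" "g' \<cdot> h = g' \<cdot> h'"
  shows "h = h'"
proof -
  note p = pullback_arr[OF assms(1)]
  have "g \<cdot> f' \<cdot> h = f \<cdot> g' \<cdot> h" using reassoc[OF p(9), of h] p assms by simp
  then have "\<exists>!x. x \<in> Hom K (Dom K (f' \<cdot> h)) (Dom K f') \<and> f' \<cdot> x = f' \<cdot> h \<and> g' \<cdot> x = g' \<cdot> h"
    using assms(1)[unfolded is_pullback_def, THEN conjunct2, THEN conjunct2, THEN conjunct2, THEN conjunct2,
      THEN conjunct2, THEN conjunct2, THEN conjunct2, THEN conjunct2, THEN conjunct2, THEN spec[of _ "f' \<cdot> h"], THEN spec[of _ "g' \<cdot> h"]]
      p assms by simp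
  moreover have "h \<in> Hom K (Dom K (f' \<cdot> h)) (Dom K f') \<and> f' \<cdot> h = f' \<cdot> h \<and> g' \<cdot> h = g' \<cdot> h"
    "h' \<in> Hom K (Dom K (f' \<cdot> h)) (Dom K f') \<and> f' \<cdot> h' = f' \<cdot> h \<and> g' \<cdot> h' = g' \<cdot> h"
    using assms p by simp_all
  ultimately show ?thesis by blast
qed

lemma pushout_arr:
  assumes "is_pushout K f g f' g'"
  shows "f \<in> Ar K" "g \<in> Ar K" "f' \<in> Ar K" "g' \<in> Ar K" "Dom K f = Dom K g" "Dom K f' = Cod K g"
    "Dom K g' = Cod K f" "Cod K f' = Cod K g'" "f' \<cdot> g = g' \<cdot> f"
  using assms by (auto simp: is_pushout_def)

lemma pushout_factor:
  assumes "is_pushout K f g f' g'" "u \<in> Ar K" "v \<in> Ar K" "Dom K u = Cod K g" "Dom K v = Cod K f"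
    "Cod K u = Cod K v" "u \<cdot> g = v \<cdot> f"
  shows "\<exists>h. h \<in> Ar K \<and> Cod K h = Cod K v \<and> Dom K h = Cod K f' \<and> h \<cdot> f' = u \<and> h \<cdot> g' = v"
proof -
  have "\<exists>!h. h \<in> Hom K (Cod K f') (Cod K u) \<and> h \<cdot> f' = u \<and> h \<cdot> g' = v"
    using assms unfolding is_pushout_def by blast
  then show ?thesis using assms(6) by auto
qed

lemma pushout_unique:
  assumes "is_pushout K f g f' g'" "h \<in> Ar K" "h' \<in> Ar K" "Dom K h = Cod K f'" "Dom K h' = Cod K f'"
    "Cod K h = Cod K h'" "h \<cdot> f' = h' \<cdot> f'" "h \<cdot> g' = h' \<cdot> g'"
  shows "h = h'"
proof -
  note p = pushout_arr[OF assms(1)]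
  have "(h \<cdot> f') \<cdot> g = (h \<cdot> g') \<cdot> f" using p assms(2-6) by simp
  then have "\<exists>!x. x \<in> Hom K (Cod K f') (Cod K (h \<cdot> f')) \<and> x \<cdot> f' = h \<cdot> f' \<and> x \<cdot> g' = h \<cdot> g'"
    using assms(1)[unfolded is_pushout_def, THEN conjunct2, THEN conjunct2, THEN conjunct2, THEN conjunct2,
      THEN conjunct2, THEN conjunct2, THEN conjunct2, THEN conjunct2, THEN conjunct2, THEN spec[of _ "h \<cdot> f'"], THEN spec[of _ "h \<cdot> g'"]]
      p assms(2-6) by simp
  moreover have "h \<in> Hom K (Cod K f') (Cod K (h \<cdot> f')) \<and> h \<cdot> f' = h \<cdot> f' \<and> h \<cdot> g' = h \<cdot> g'"
    "h' \<in> Hom K (Cod K f') (Cod K (h \<cdot> f')) \<and> h' \<cdot> f' = h \<cdot> f' \<and> h' \<cdot> g' = h \<cdot> g'"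
    using assms p by simp_all
  ultimately show ?thesis by blast
qed

text \<open>The epic pullback constructed above factors through \<open>e'\<close>.\<close>

lemma pullback_of_epic:
  assumes "is_pullback K e f e' f'" "epic K e" shows "epic K e'"
proof -
  note p = pullback_arr[OF assms(1)]
  obtain e1 f1 where 1: "is_pullback K e f e1 f1" "epic K e1"
    using ex_pullback_epic[OF assms(2), of f] p by auto
  note p1 = pullback_arr[OF 1(1)]
  obtain h where h: "h \<in> Ar K" "Dom K h = Dom K e1" "Cod K h = Dom K e'" "e' \<cdot> h = e1"
    using pullback_factor[OF assms(1), of e1 f1] p p1 by auto
  show ?thesis
  proof (rule epicI[OF p(3)])
    fix u assume u: "u \<in> Ar K" "Dom K u = Cod K e'" "u \<cdot> e' = zero_arr K (Dom K e') (Cod K u)"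
    have "u \<cdot> e1 = zero_arr K (Dom K e1) (Cod K u)"
      using reassoc[OF u(3), of h] h p u(1,2) by simp
    then show "u = zero_arr K (Cod K e') (Cod K u)" using epic_zeroD[OF 1(2), of u] u p p1 by simp
  qed
qed

lemma pushout_of_monic:
  assumes "is_pushout K m f m' f'" "monic K m" shows "monic K m'"
proof -
  note p = pushout_arr[OF assms(1)]
  obtain m1 f1 where 1: "is_pushout K m f m1 f1" "monic K m1"
    using ex_pushout[of m f] p assms(2) by auto
  note p1 = pushout_arr[OF 1(1)]
  obtain h where h: "h \<in> Ar K" "Cod K h = Cod K m1" "Dom K h = Cod K m'" "h \<cdot> m' = m1"
    using pushout_factor[OF assms(1), of m1 f1] p p1 by auto
  show ?thesis
  proof (rule monicI[OF p(3)])
    fix u assume u: "u \<in> Ar K" "Cod K u = Dom K m'" "m' \<cdot> u = zero_arr K (Dom K u) (Cod K m')"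
    have "m1 \<cdot> u = zero_arr K (Dom K u) (Cod K m1)"
      using reassoc[OF h(4), of u] h(1-3) p u by simp
    then show "u = zero_arr K (Dom K u) (Dom K m')" using monic_zeroD[OF 1(2), of u] u p p1 by simp
  qed
qed

lemma pushout_cokernel:
  assumes "is_pushout K f g f' g'" "is_cokernel K f q"
  shows "\<exists>q'. is_cokernel K f' q' \<and> q' \<cdot> g' = q"
proof -
  note p = pushout_arr[OF assms(1)] and q = cokernel_arr[OF assms(2)]
  obtain q' where q': "q' \<in> Ar K" "Cod K q' = Cod K q" "Dom K q' = Cod K f'"
    "q' \<cdot> f' = zero_arr K (Cod K g) (Cod K q)" "q' \<cdot> g' = q"
    using pushout_factor[OF assms(1), of "zero_arr K (Cod K g) (Cod K q)" q] p q by auto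
  have "is_cokernel K f' q'"
  proof (rule cokernelI)
    show "epic K q'"
    proof (rule epicI[OF q'(1)])
      fix u assume u: "u \<in> Ar K" "Dom K u = Cod K q'" "u \<cdot> q' = zero_arr K (Dom K q') (Cod K u)"
      have "u \<cdot> q = zero_arr K (Dom K q) (Cod K u)" using reassoc[OF u(3), of g'] u(1,2) q q' p by simp
      then show "u = zero_arr K (Cod K q') (Cod K u)"
        using epic_zeroD[OF cokernel_epic[OF assms(2)], of u] u q' by simp
    qed
    show "f' \<in> Ar K" "Dom K q' = Cod K f'" "q' \<cdot> f' = zero_arr K (Dom K f') (Cod K q')" using p q' by simp_all
    fix t assume t: "t \<in> Ar K" "Dom K t = Cod K f'" "t \<cdot> f' = zero_arr K (Dom K f') (Cod K t)"
    have "t \<cdot> g' \<cdot> f = zero_arr K (Dom K f) (Cod K t)"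
      using reassoc[OF t(3), of g] t(1,2) p by simp
    then obtain s where s: "s \<in> Ar K" "Dom K s = Cod K q" "Cod K s = Cod K t" "s \<cdot> q = t \<cdot> g'"
      using cokernel_factor[OF assms(2), of "t \<cdot> g'"] t p by auto
    have "s \<cdot> q' = t"
      by (rule pushout_unique[OF assms(1)]) (use s t q' q p in simp_all)
    then show "\<exists>h. h \<in> Ar K \<and> Dom K h = Cod K q' \<and> Cod K h = Cod K t \<and> h \<cdot> q' = t"
      using s q' by auto
  qed
  then show ?thesis using q' by blast
qed

lemma short_exact_arr:
  assumes "short_exact K f g"
  shows "f \<in> Ar K" "g \<in> Ar K" "Cod K f = Dom K g" "g \<cdot> f = zero_arr K (Dom K f) (Cod K g)"
    "monic K f" "epic K g" "is_kernel K g f" "is_cokernel K f g"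
  using assms kernel_arr[of g f] kernel_monic cokernel_epic by (auto simp: short_exact_def)

lemma short_exact_monicI: "monic K f \<Longrightarrow> is_cokernel K f g \<Longrightarrow> short_exact K f g"
  by (simp add: short_exact_def monic_kernel_of_cokernel)

lemma short_exact_epicI: "epic K g \<Longrightarrow> is_kernel K g f \<Longrightarrow> short_exact K f g"
  by (simp add: short_exact_def epic_cokernel_of_kernel)

lemma short_five:
  assumes 1: "short_exact K f g" and 2: "short_exact K f' g'"
    and \<phi>: "\<phi> \<in> Ar K" "Dom K \<phi> = Cod K f" "Cod K \<phi> = Cod K f'" "\<phi> \<cdot> f = f'" "g' \<cdot> \<phi> = g"
  shows "iso_arr K \<phi>"
proof (rule monic_epic_iso)
  note a = short_exact_arr[OF 1] and b = short_exact_arr[OF 2]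
  have d: "Dom K f = Dom K f'" "Cod K g = Cod K g'" using \<phi> a b comp_arr by metis+
  show "monic K \<phi>"
  proof (rule monicI[OF \<phi>(1)])
    fix u assume u: "u \<in> Ar K" "Cod K u = Dom K \<phi>" "\<phi> \<cdot> u = zero_arr K (Dom K u) (Cod K \<phi>)"
    have "g \<cdot> u = zero_arr K (Dom K u) (Cod K g)" using reassoc[OF \<phi>(5), of u] u a b d \<phi>(1-3) by simp
    then obtain v where v: "v \<in> Ar K" "Dom K v = Dom K u" "Cod K v = Dom K f" "f \<cdot> v = u"
      using kernel_factor[OF a(7), of u] u a \<phi> by auto
    have "f' \<cdot> v = zero_arr K (Dom K v) (Cod K f')"
      using reassoc[OF \<phi>(4), of v] u v a \<phi>(1-3) by simp
    then have "v = zero_arr K (Dom K u) (Dom K f)" using monic_zeroD[OF b(5), of v] v d by simp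
    then show "u = zero_arr K (Dom K u) (Dom K \<phi>)" using v u a \<phi>(1-3) by simp
  qed
  show "epic K \<phi>"
  proof (rule epicI[OF \<phi>(1)])
    fix u assume u: "u \<in> Ar K" "Dom K u = Cod K \<phi>" "u \<cdot> \<phi> = zero_arr K (Dom K \<phi>) (Cod K u)"
    have "u \<cdot> f' = zero_arr K (Dom K f') (Cod K u)" using reassoc[OF u(3), of f] u(1,2) a b d \<phi> by simp
    then obtain v where v: "v \<in> Ar K" "Dom K v = Cod K g'" "Cod K v = Cod K u" "v \<cdot> g' = u"
      using cokernel_factor[OF b(8), of u] u b \<phi> by auto
    have "v \<cdot> g = zero_arr K (Dom K g) (Cod K v)"
      using reassoc[OF v(4), of \<phi>] u v(1-3) a b \<phi> by simp
    then have "v = zero_arr K (Cod K g) (Cod K u)" using epic_zeroD[OF a(6), of v] v d by simp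
    then show "u = zero_arr K (Cod K \<phi>) (Cod K u)" using v u b d \<phi>(1-3) by auto
  qed
qed

text \<open>The pushout of the left end is an extension mapping to the second one by a morphism that is
  the identity on both ends, hence an isomorphism.\<close>

lemma short_exact_pushout:
  assumes 1: "short_exact K f g" and 2: "short_exact K f' g'"
    and a: "a \<in> Ar K" "Dom K a = Dom K f" "Cod K a = Dom K f'"
    and \<phi>: "\<phi> \<in> Ar K" "Dom K \<phi> = Cod K f" "Cod K \<phi> = Cod K f'" "\<phi> \<cdot> f = f' \<cdot> a" "g' \<cdot> \<phi> = g"
  shows "is_pushout K f a f' \<phi>"
proof -
  note f = short_exact_arr[OF 1] and f' = short_exact_arr[OF 2]
  have d: "Cod K g = Cod K g'" using \<phi> f f' comp_arr(3)[of \<phi> g'] by simp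
  obtain f1 \<phi>1 where po: "is_pushout K f a f1 \<phi>1" using ex_pushout[of f a] f a by auto
  note p = pushout_arr[OF po]
  obtain q where q: "is_cokernel K f1 q" "q \<cdot> \<phi>1 = g" using pushout_cokernel[OF po f(8)] by blast
  have s: "short_exact K f1 q" using short_exact_monicI[OF pushout_of_monic[OF po f(5)] q(1)] .
  note s' = short_exact_arr[OF s]
  have dq: "Cod K q = Cod K g" using q(2) s' p comp_arr(3)[of \<phi>1 q] by simp
  obtain \<theta> where \<theta>: "\<theta> \<in> Ar K" "Dom K \<theta> = Cod K f1" "Cod K \<theta> = Cod K f'" "\<theta> \<cdot> f1 = f'" "\<theta> \<cdot> \<phi>1 = \<phi>"
    using pushout_factor[OF po, of f' \<phi>] f' a \<phi> p by auto
  have "g' \<cdot> \<theta> = q"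
    by (rule pushout_unique[OF po]) (use \<theta> f' s' p dq d q(2) \<phi> a(3) in simp_all)
  then have "iso_arr K \<theta>" using short_five[OF s 2] \<theta> by simp
  then obtain \<theta>' where \<theta>': "\<theta>' \<in> Ar K" "Dom K \<theta>' = Cod K \<theta>" "Cod K \<theta>' = Dom K \<theta>"
    "\<theta>' \<cdot> \<theta> = ident K (Dom K \<theta>)" "\<theta> \<cdot> \<theta>' = ident K (Cod K \<theta>)"
    by (rule iso_arrE)
  have \<theta>f: "\<theta>' \<cdot> f' = f1" "\<theta>' \<cdot> \<phi> = \<phi>1"
    using reassoc[OF \<theta>'(4), of f1] reassoc[OF \<theta>'(4), of \<phi>1] \<theta> \<theta>' p by simp_all
  show ?thesis unfolding is_pushout_def
  proof (intro conjI allI impI)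
    fix u v assume uv: "u \<in> Ar K \<and> v \<in> Ar K \<and> Dom K u = Cod K a \<and> Dom K v = Cod K f \<and> Cod K u = Cod K v \<and> u \<cdot> a = v \<cdot> f"
    show "\<exists>!h. h \<in> Hom K (Cod K f') (Cod K u) \<and> h \<cdot> f' = u \<and> h \<cdot> \<phi> = v"
    proof (rule ex_ex1I)
      obtain h where h: "h \<in> Ar K" "Cod K h = Cod K v" "Dom K h = Cod K f1" "h \<cdot> f1 = u" "h \<cdot> \<phi>1 = v"
        using pushout_factor[OF po, of u v] uv by auto
      then show "\<exists>h. h \<in> Hom K (Cod K f') (Cod K u) \<and> h \<cdot> f' = u \<and> h \<cdot> \<phi> = v"
        using uv \<theta> \<theta>' \<theta>f f' \<phi> by (intro exI[of _ "h \<cdot> \<theta>'"]) simp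
    next
      fix h h' assume hh: "h \<in> Hom K (Cod K f') (Cod K u) \<and> h \<cdot> f' = u \<and> h \<cdot> \<phi> = v"
        "h' \<in> Hom K (Cod K f') (Cod K u) \<and> h' \<cdot> f' = u \<and> h' \<cdot> \<phi> = v"
      have "h \<cdot> \<theta> = h' \<cdot> \<theta>"
        by (rule pushout_unique[OF po]) (use hh \<theta> p in simp_all)
      then have "(h \<cdot> \<theta>) \<cdot> \<theta>' = (h' \<cdot> \<theta>) \<cdot> \<theta>'" by simp
      then show "h = h'" using hh \<theta>(1-3) \<theta>' by simp
    qed
  qed (use f f' a \<phi> in simp_all)
qed

end

lemma (in abelian_category) biproduct_short_exact:
  assumes "biproduct K X Y P i1 i2 p1 p2" "X \<in> Ob K" "Y \<in> Ob K"
  shows "short_exact K i1 p2"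
proof (rule short_exact_epicI)
  note b = biproduct_arr[OF assms]
  show "epic K p2"
  proof (rule epicI[OF b(5)])
    fix f assume f: "f \<in> Ar K" "Dom K f = Cod K p2" "f \<cdot> p2 = zero_arr K (Dom K p2) (Cod K f)"
    then show "f = zero_arr K (Cod K p2) (Cod K f)" using reassoc[OF f(3), of i2] b assms(2,3) by simp
  qed
  show "is_kernel K p2 i1"
  proof (rule kernelI)
    show "monic K i1"
    proof (rule monicI[OF b(2)])
      fix f assume f: "f \<in> Ar K" "Cod K f = Dom K i1" "i1 \<cdot> f = zero_arr K (Dom K f) (Cod K i1)"
      have "p1 \<cdot> i1 \<cdot> f = zero_arr K (Dom K f) X" using f b by simp
      then show "f = zero_arr K (Dom K f) (Dom K i1)" using f(1,2) b by (simp add: reassoc[OF b(14)])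
    qed
    fix g assume g: "g \<in> Ar K" "Cod K g = Dom K p2" "p2 \<cdot> g = zero_arr K (Dom K g) (Cod K p2)"
    have "(i1 \<cdot> p1 \<boxplus> i2 \<cdot> p2) \<cdot> g = g" using g(1,2) b by simp
    then have "i1 \<cdot> p1 \<cdot> g = g" using g b(1-13) by simp
    then show "\<exists>h. h \<in> Ar K \<and> Dom K h = Dom K g \<and> Cod K h = Dom K i1 \<and> i1 \<cdot> h = g"
      using g b by (intro exI[of _ "p1 \<cdot> g"]) simp
  qed (use b in simp_all)
qed

section \<open>Quotients and direct limits\<close>

context category
begin

lemma coproduct_arr:
  assumes "is_coproduct K I X C \<iota>" "i \<in> I"
  shows "\<iota> i \<in> Ar K" "Dom K (\<iota> i) = X i" "Cod K (\<iota> i) = C"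
  using assms by (auto simp: is_coproduct_def)

lemma coproduct_hom:
  assumes "is_coproduct K I X C \<iota>" "Y \<in> Ob K" "\<And>i. i \<in> I \<Longrightarrow> t i \<in> Hom K (X i) Y"
  shows "\<exists>h. h \<in> Ar K \<and> Dom K h = C \<and> Cod K h = Y \<and> (\<forall>i \<in> I. h \<cdot> \<iota> i = t i)"
proof -
  have "\<forall>i \<in> I. t i \<in> Hom K (X i) Y" using assms(3) by blast
  then have "\<exists>!h. h \<in> Hom K C Y \<and> (\<forall>i \<in> I. h \<cdot> \<iota> i = t i)"
    using assms(1,2) unfolding is_coproduct_def by blast
  then show ?thesis by auto
qed

lemma coproduct_unique:
  assumes "is_coproduct K I X C \<iota>" "h \<in> Ar K" "h' \<in> Ar K" "Dom K h = C" "Dom K h' = C" "Cod K h = Cod K h'"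
    "\<And>i. i \<in> I \<Longrightarrow> h \<cdot> \<iota> i = h' \<cdot> \<iota> i"
  shows "h = h'"
proof -
  have "Cod K h \<in> Ob K" "\<forall>i\<in>I. h \<cdot> \<iota> i \<in> Hom K (X i) (Cod K h)"
    using assms coproduct_arr[OF assms(1)] by simp_all
  then have "\<exists>!k. k \<in> Hom K C (Cod K h) \<and> (\<forall>i\<in>I. k \<cdot> \<iota> i = h \<cdot> \<iota> i)"
    using assms(1)[unfolded is_coproduct_def, THEN conjunct2, THEN conjunct2, THEN bspec, of "Cod K h",
      THEN spec, of "\<lambda>i. h \<cdot> \<iota> i"] by blast
  moreover have "h \<in> Hom K C (Cod K h) \<and> (\<forall>i\<in>I. h \<cdot> \<iota> i = h \<cdot> \<iota> i)"
    "h' \<in> Hom K C (Cod K h) \<and> (\<forall>i\<in>I. h' \<cdot> \<iota> i = h \<cdot> \<iota> i)"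
    using assms by simp_all
  ultimately show ?thesis by blast
qed

lemma direct_systemD:
  assumes "direct_system K I R X x"
  shows "directed_poset I R" "\<And>i. i \<in> I \<Longrightarrow> X i \<in> Ob K"
    "\<And>i j. (i, j) \<in> R \<Longrightarrow> x i j \<in> Ar K" "\<And>i j. (i, j) \<in> R \<Longrightarrow> Dom K (x i j) = X i"
    "\<And>i j. (i, j) \<in> R \<Longrightarrow> Cod K (x i j) = X j"
    "\<And>i. i \<in> I \<Longrightarrow> x i i = ident K (X i)"
    "\<And>i j k. (i, j) \<in> R \<Longrightarrow> (j, k) \<in> R \<Longrightarrow> x j k \<cdot> x i j = x i k"
proof -
  have a: "directed_poset I R \<and> (\<forall>i \<in> I. X i \<in> Ob K)"
    and b: "\<forall>i j. (i, j) \<in> R \<longrightarrow> x i j \<in> Hom K (X i) (X j)" and c: "\<forall>i \<in> I. x i i = ident K (X i)"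
    and d: "\<forall>i j k. (i, j) \<in> R \<and> (j, k) \<in> R \<longrightarrow> x j k \<cdot> x i j = x i k"
    using assms unfolding direct_system_def by simp_all
  show "directed_poset I R" "\<And>i. i \<in> I \<Longrightarrow> X i \<in> Ob K" using a by simp_all
  show "\<And>i j. (i, j) \<in> R \<Longrightarrow> x i j \<in> Ar K" "\<And>i j. (i, j) \<in> R \<Longrightarrow> Dom K (x i j) = X i"
    "\<And>i j. (i, j) \<in> R \<Longrightarrow> Cod K (x i j) = X j" using b by simp_all
  show "\<And>i. i \<in> I \<Longrightarrow> x i i = ident K (X i)" using c by simp
  show "\<And>i j k. (i, j) \<in> R \<Longrightarrow> (j, k) \<in> R \<Longrightarrow> x j k \<cdot> x i j = x i k" using d by blast
qed

lemma coconeD: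
  assumes "is_cocone K I R X x L l"
  shows "L \<in> Ob K" "\<And>i. i \<in> I \<Longrightarrow> l i \<in> Ar K" "\<And>i. i \<in> I \<Longrightarrow> Dom K (l i) = X i"
    "\<And>i. i \<in> I \<Longrightarrow> Cod K (l i) = L" "\<And>i j. (i, j) \<in> R \<Longrightarrow> l j \<cdot> x i j = l i"
  using assms by (simp_all add: is_cocone_def)

lemma coconeI:
  assumes "L \<in> Ob K" "\<And>i. i \<in> I \<Longrightarrow> l i \<in> Ar K \<and> Dom K (l i) = X i \<and> Cod K (l i) = L"
    "\<And>i j. (i, j) \<in> R \<Longrightarrow> l j \<cdot> x i j = l i"
  shows "is_cocone K I R X x L l"
  using assms by (simp add: is_cocone_def)

lemma direct_limitD:
  assumes "is_direct_limit K I R X x L l"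
  shows "direct_system K I R X x" "is_cocone K I R X x L l"
  using assms by (simp_all add: is_direct_limit_def)

lemma direct_limit_hom:
  assumes "is_direct_limit K I R X x L l" "is_cocone K I R X x Y t"
  shows "\<exists>h. h \<in> Ar K \<and> Dom K h = L \<and> Cod K h = Y \<and> (\<forall>i \<in> I. h \<cdot> l i = t i)"
proof -
  have "\<exists>!h. h \<in> Hom K L Y \<and> (\<forall>i \<in> I. h \<cdot> l i = t i)"
    using assms unfolding is_direct_limit_def by blast
  then show ?thesis by auto
qed

lemma direct_limit_unique:
  assumes lim: "is_direct_limit K I R X x L l" and h: "h \<in> Ar K" "h' \<in> Ar K" "Dom K h = L" "Dom K h' = L"
    "Cod K h = Cod K h'" "\<And>i. i \<in> I \<Longrightarrow> h \<cdot> l i = h' \<cdot> l i"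
  shows "h = h'"
proof -
  note s = direct_systemD[OF direct_limitD(1)[OF lim]] and c = coconeD[OF direct_limitD(2)[OF lim]]
  have "is_cocone K I R X x (Cod K h) (\<lambda>i. h \<cdot> l i)"
  proof (rule coconeI)
    fix i j assume ij: "(i, j) \<in> R"
    then have "i \<in> I" "j \<in> I" using directed_poset_Field[OF s(1)] by auto
    then show "(h \<cdot> l j) \<cdot> x i j = h \<cdot> l i" using s c h(1,3) ij by simp
  qed (use c h in simp_all)
  then have "\<exists>!k. k \<in> Hom K L (Cod K h) \<and> (\<forall>i \<in> I. k \<cdot> l i = h \<cdot> l i)"
    using lim unfolding is_direct_limit_def by blast
  moreover have "h \<in> Hom K L (Cod K h) \<and> (\<forall>i \<in> I. h \<cdot> l i = h \<cdot> l i)"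
    "h' \<in> Hom K L (Cod K h) \<and> (\<forall>i \<in> I. h' \<cdot> l i = h \<cdot> l i)" using h by simp_all
  ultimately show ?thesis by blast
qed

lemma direct_limitI:
  assumes "direct_system K I R X x" "is_cocone K I R X x L l"
    and ex: "\<And>Y t. is_cocone K I R X x Y t \<Longrightarrow>
      \<exists>h. h \<in> Ar K \<and> Dom K h = L \<and> Cod K h = Y \<and> (\<forall>i \<in> I. h \<cdot> l i = t i)"
    and un: "\<And>h h'. h \<in> Ar K \<Longrightarrow> h' \<in> Ar K \<Longrightarrow> Dom K h = L \<Longrightarrow> Dom K h' = L \<Longrightarrow>
      Cod K h = Cod K h' \<Longrightarrow> (\<And>i. i \<in> I \<Longrightarrow> h \<cdot> l i = h' \<cdot> l i) \<Longrightarrow> h = h'"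
  shows "is_direct_limit K I R X x L l"
  unfolding is_direct_limit_def
proof (intro conjI allI impI assms(1,2))
  fix Y t assume "is_cocone K I R X x Y t"
  then obtain h where h: "h \<in> Ar K" "Dom K h = L" "Cod K h = Y" "\<forall>i \<in> I. h \<cdot> l i = t i" using ex by blast
  show "\<exists>!h. h \<in> Hom K L Y \<and> (\<forall>i \<in> I. h \<cdot> l i = t i)"
  proof (rule ex1I[of _ h])
    fix h' assume "h' \<in> Hom K L Y \<and> (\<forall>i \<in> I. h' \<cdot> l i = t i)"
    then show "h' = h" by (intro un[of h' h]) (use h in simp_all)
  qed (use h in simp)
qed

lemma direct_limit_iso:
  assumes lim: "is_direct_limit K I R X x L l" and \<theta>: "iso_arr K \<theta>" "Dom K \<theta> = L"
  shows "is_direct_limit K I R X x (Cod K \<theta>) (\<lambda>i. \<theta> \<cdot> l i)"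
proof -
  note s = direct_systemD[OF direct_limitD(1)[OF lim]] and c = coconeD[OF direct_limitD(2)[OF lim]]
  obtain \<eta> where \<eta>: "\<theta> \<in> Ar K" "\<eta> \<in> Ar K" "Dom K \<eta> = Cod K \<theta>" "Cod K \<eta> = Dom K \<theta>"
    "\<eta> \<cdot> \<theta> = ident K (Dom K \<theta>)" "\<theta> \<cdot> \<eta> = ident K (Cod K \<theta>)" using iso_arrE[OF \<theta>(1)] by metis
  show ?thesis
  proof (rule direct_limitI[OF direct_limitD(1)[OF lim]])
    show "is_cocone K I R X x (Cod K \<theta>) (\<lambda>i. \<theta> \<cdot> l i)"
    proof (rule coconeI)
      fix i j assume ij: "(i, j) \<in> R"
      then have "i \<in> I" "j \<in> I" using directed_poset_Field[OF s(1)] by auto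
      then show "(\<theta> \<cdot> l j) \<cdot> x i j = \<theta> \<cdot> l i" using s c \<theta>(2) \<eta>(1) ij by simp
    qed (use c \<eta>(1) \<theta>(2) in simp_all)
  next
    fix Y t assume "is_cocone K I R X x Y t"
    then obtain h where h: "h \<in> Ar K" "Dom K h = L" "Cod K h = Y" "\<And>i. i \<in> I \<Longrightarrow> h \<cdot> l i = t i"
      using direct_limit_hom[OF lim] by blast
    show "\<exists>h. h \<in> Ar K \<and> Dom K h = Cod K \<theta> \<and> Cod K h = Y \<and> (\<forall>i\<in>I. h \<cdot> \<theta> \<cdot> l i = t i)"
      by (rule exI[of _ "h \<cdot> \<eta>"]) (use h \<eta> \<theta>(2) c in \<open>simp add: reassoc[OF \<eta>(5)]\<close>)
  next
    fix h h' assume h: "h \<in> Ar K" "h' \<in> Ar K" "Dom K h = Cod K \<theta>" "Dom K h' = Cod K \<theta>" "Cod K h = Cod K h'"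
      "\<And>i. i \<in> I \<Longrightarrow> h \<cdot> \<theta> \<cdot> l i = h' \<cdot> \<theta> \<cdot> l i"
    have "h \<cdot> \<theta> = h' \<cdot> \<theta>"
      by (rule direct_limit_unique[OF lim]) (use h \<eta> \<theta>(2) c in simp_all)
    then have "(h \<cdot> \<theta>) \<cdot> \<eta> = (h' \<cdot> \<theta>) \<cdot> \<eta>" by simp
    then show "h = h'" using h(1-5) \<eta> by simp
  qed
qed

text \<open>Direct limits over small index sets in arbitrary types are reduced to index subsets of \<open>'u\<close> by
  transport along an injection.\<close>

lemma direct_limit_reindex:
  assumes lim: "is_direct_limit K I R X x L l" and g: "inj_on g I"
  defines "d \<equiv> inv_into I g"
  shows "is_direct_limit K (g ` I) {(g i, g j) |i j. (i, j) \<in> R} (\<lambda>a. X (d a)) (\<lambda>a b. x (d a) (d b)) L (\<lambda>a. l (d a))"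
proof -
  note s = direct_systemD[OF direct_limitD(1)[OF lim]] and c = coconeD[OF direct_limitD(2)[OF lim]]
  have d: "d (g i) = i" if "i \<in> I" for i using g that by (simp add: d_def)
  note F = directed_poset_Field[OF s(1)]
  define R' where "R' = {(g i, g j) |i j. (i, j) \<in> R}"
  have R'D: "\<exists>i j. (i, j) \<in> R \<and> i \<in> I \<and> j \<in> I \<and> a = g i \<and> b = g j" if "(a, b) \<in> R'" for a b
    using that F by (auto simp: R'_def)
  have R'I: "(g i, g j) \<in> R'" if "(i, j) \<in> R" for i j using that by (auto simp: R'_def)
  have R'iff: "(g i, g j) \<in> R' \<longleftrightarrow> (i, j) \<in> R" if "i \<in> I" "j \<in> I" for i j
    using R'D[of "g i" "g j"] R'I d that by metis
  have anti: "antisym R" using s(1) by (simp add: directed_poset_def partial_order_on_def)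
  have dp: "directed_poset (g ` I) R'"
    unfolding directed_poset_def partial_order_on_def preorder_on_def
  proof (intro conjI ballI)
    show "R' \<subseteq> g ` I \<times> g ` I" by (auto dest!: R'D)
    show "refl_on (g ` I) R'" using directed_poset_refl[OF s(1)] R'I by (auto simp: refl_on_def)
    show "trans R'"
    proof (rule transI)
      fix a b e assume "(a, b) \<in> R'" "(b, e) \<in> R'"
      then obtain i j k where "(i, j) \<in> R" "(j, k) \<in> R" "a = g i" "e = g k" using R'D d by metis
      then show "(a, e) \<in> R'" using directed_poset_trans[OF s(1)] R'I by blast
    qed
    show "antisym R'"
    proof (rule antisymI)
      fix a b assume "(a, b) \<in> R'" "(b, a) \<in> R'"
      then obtain i j where "(i, j) \<in> R" "(j, i) \<in> R" "a = g i" "b = g j" using R'D d by metis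
      then show "a = b" using antisymD[OF anti] by blast
    qed
    show "g ` I \<noteq> {}" using directed_poset_nonempty[OF s(1)] by simp
    fix a b assume "a \<in> g ` I" "b \<in> g ` I"
    then obtain i j where "i \<in> I" "j \<in> I" "a = g i" "b = g j" by blast
    then show "\<exists>k \<in> g ` I. (a, k) \<in> R' \<and> (b, k) \<in> R'"
      using directed_poset_bound[OF s(1)] R'I by blast
  qed
  have co: "is_cocone K (g ` I) R' (\<lambda>a. X (d a)) (\<lambda>a b. x (d a) (d b)) Y t \<longleftrightarrow>
      is_cocone K I R X x Y (\<lambda>i. t (g i))" for Y t
  proof -
    have "(\<forall>a b. (a, b) \<in> R' \<longrightarrow> t b \<cdot> x (d a) (d b) = t a) \<longleftrightarrow> (\<forall>i j. (i, j) \<in> R \<longrightarrow> t (g j) \<cdot> x i j = t (g i))"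
    proof (intro iffI allI impI)
      fix a b assume h: "\<forall>i j. (i, j) \<in> R \<longrightarrow> t (g j) \<cdot> x i j = t (g i)" and "(a, b) \<in> R'"
      then obtain i j where "(i, j) \<in> R" "i \<in> I" "j \<in> I" "a = g i" "b = g j" using R'D by blast
      then show "t b \<cdot> x (d a) (d b) = t a" using h d by simp
    next
      fix i j assume h: "\<forall>a b. (a, b) \<in> R' \<longrightarrow> t b \<cdot> x (d a) (d b) = t a" and ij: "(i, j) \<in> R"
      show "t (g j) \<cdot> x i j = t (g i)" using h[THEN spec, THEN spec, THEN mp, OF R'I[OF ij]] d F[OF ij] by simp
    qed
    then show ?thesis unfolding is_cocone_def using d by simp
  qed
  have "is_direct_limit K (g ` I) R' (\<lambda>a. X (d a)) (\<lambda>a b. x (d a) (d b)) L (\<lambda>a. l (d a))"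
  proof (rule direct_limitI)
    show "direct_system K (g ` I) R' (\<lambda>a. X (d a)) (\<lambda>a b. x (d a) (d b))"
      unfolding direct_system_def
    proof (intro conjI allI impI ballI)
      fix a b assume "(a, b) \<in> R'"
      then show "x (d a) (d b) \<in> Hom K (X (d a)) (X (d b))" using R'D[of a b] d s by auto
    next
      fix a b e assume "(a, b) \<in> R' \<and> (b, e) \<in> R'"
      then obtain i j k where "(i, j) \<in> R" "(j, k) \<in> R" "a = g i" "b = g j" "e = g k" using R'D d by metis
      then show "x (d b) (d e) \<cdot> x (d a) (d b) = x (d a) (d e)" using s(7) d F by simp
    qed (use dp d s in auto)
    show "is_cocone K (g ` I) R' (\<lambda>a. X (d a)) (\<lambda>a b. x (d a) (d b)) L (\<lambda>a. l (d a))"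
      unfolding co using direct_limitD(2)[OF lim] d F by (simp add: is_cocone_def)
  next
    fix Y t assume "is_cocone K (g ` I) R' (\<lambda>a. X (d a)) (\<lambda>a b. x (d a) (d b)) Y t"
    then show "\<exists>h. h \<in> Ar K \<and> Dom K h = L \<and> Cod K h = Y \<and> (\<forall>a\<in>g ` I. h \<cdot> l (d a) = t a)"
      unfolding co using direct_limit_hom[OF lim, of Y "\<lambda>i. t (g i)"] d by auto
  next
    fix h h' assume "h \<in> Ar K" "h' \<in> Ar K" "Dom K h = L" "Dom K h' = L" "Cod K h = Cod K h'"
      "\<And>i. i \<in> g ` I \<Longrightarrow> h \<cdot> l (d i) = h' \<cdot> l (d i)"
    then show "h = h'" using direct_limit_unique[OF lim, of h h'] d by force
  qed
  then show ?thesis by (simp add: R'_def)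
qed

end

context abelian_category
begin

lemma quotientD:
  assumes "is_quotient K M F q"
  shows "q \<in> Ar K" "Dom K q = M" "epic K q"
  using assms epic_arr by (auto simp: is_quotient_def)

lemma quotient_kills:
  assumes "is_quotient K M F q" "f \<in> F"
  shows "f \<in> Ar K" "Cod K f = M" "q \<cdot> f = zero_arr K (Dom K f) (Cod K q)"
  using assms by (auto simp: is_quotient_def)

lemma quotient_factor:
  assumes "is_quotient K M F q" "g \<in> Ar K" "Dom K g = M"
    "\<And>f. f \<in> F \<Longrightarrow> f \<in> Ar K \<Longrightarrow> Cod K f = M \<Longrightarrow> g \<cdot> f = zero_arr K (Dom K f) (Cod K g)"
  shows "\<exists>h. h \<in> Ar K \<and> Dom K h = Cod K q \<and> Cod K h = Cod K g \<and> h \<cdot> q = g"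
  using assms by (auto simp: is_quotient_def)

lemma is_quotientI:
  assumes "epic K q" "Dom K q = M" "\<And>f. f \<in> F \<Longrightarrow> f \<in> Ar K \<and> Cod K f = M \<and> q \<cdot> f = zero_arr K (Dom K f) (Cod K q)"
    "\<And>g. g \<in> Ar K \<Longrightarrow> Dom K g = M \<Longrightarrow> (\<And>f. f \<in> F \<Longrightarrow> g \<cdot> f = zero_arr K (Dom K f) (Cod K g)) \<Longrightarrow>
      \<exists>h. h \<in> Ar K \<and> Dom K h = Cod K q \<and> Cod K h = Cod K g \<and> h \<cdot> q = g"
  shows "is_quotient K M F q"
  using assms by (auto simp: is_quotient_def)

lemma quotient_iso:
  assumes "is_quotient K M F q" "is_quotient K M F q'"
  shows "\<exists>\<theta>. iso_arr K \<theta> \<and> Dom K \<theta> = Cod K q \<and> Cod K \<theta> = Cod K q' \<and> \<theta> \<cdot> q = q'"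
proof -
  note q = quotientD[OF assms(1)] and q' = quotientD[OF assms(2)]
  obtain h where h: "h \<in> Ar K" "Dom K h = Cod K q" "Cod K h = Cod K q'" "h \<cdot> q = q'"
    using quotient_factor[OF assms(1), of q'] q' quotient_kills[OF assms(2)] by auto
  obtain h' where h': "h' \<in> Ar K" "Dom K h' = Cod K q'" "Cod K h' = Cod K q" "h' \<cdot> q' = q"
    using quotient_factor[OF assms(2), of q] q quotient_kills[OF assms(1)] by auto
  have "h' \<cdot> h = ident K (Cod K q)"
    by (rule epicD[OF q(3)]) (use h h' q q' in simp_all)
  moreover have "h \<cdot> h' = ident K (Cod K q')"
    by (rule epicD[OF q'(3)]) (use h h' q q' in simp_all)
  ultimately show ?thesis using h h' by (intro exI[of _ h] conjI iso_arrI[of h h']) auto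
qed

text \<open>A directed union of families of arrows to \<open>M\<close> gives the direct limit of the quotients: both
  universal properties concern arrows from \<open>M\<close> killing all the families.\<close>

lemma direct_limit_of_quotients:
  fixes I :: "'i set"
  assumes dir: "directed_poset I R" and mono: "\<And>i j. (i, j) \<in> R \<Longrightarrow> F i \<subseteq> F j"
    and q: "\<And>i. i \<in> I \<Longrightarrow> is_quotient K M (F i) (q i)" and p: "is_quotient K M (\<Union>i\<in>I. F i) p"
  shows "\<exists>x l. is_direct_limit K I R (\<lambda>i. Cod K (q i)) x (Cod K p) l \<and>
    (\<forall>i\<in>I. l i \<cdot> q i = p) \<and> (\<forall>i j. (i, j) \<in> R \<longrightarrow> x i j \<cdot> q i = q j)"
proof -
  note F = directed_poset_Field[OF dir]
  note q' = quotientD[OF q] and p' = quotientD[OF p]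
  have "\<exists>h. h \<in> Ar K \<and> Dom K h = Cod K (q i) \<and> Cod K h = Cod K (q j) \<and> h \<cdot> q i = q j" if ij: "(i, j) \<in> R" for i j
    using quotient_factor[OF q, of i "q j"] q'[of j] F[OF ij] mono[OF ij] quotient_kills[OF q, of j] by blast
  then obtain x where x: "\<And>i j. (i, j) \<in> R \<Longrightarrow> x i j \<in> Ar K \<and> Dom K (x i j) = Cod K (q i) \<and>
      Cod K (x i j) = Cod K (q j) \<and> x i j \<cdot> q i = q j" by metis
  have "\<exists>h. h \<in> Ar K \<and> Dom K h = Cod K (q i) \<and> Cod K h = Cod K p \<and> h \<cdot> q i = p" if i: "i \<in> I" for i
    using quotient_factor[OF q[OF i], of p] p' i quotient_kills[OF p] by blast
  then obtain l where l: "\<And>i. i \<in> I \<Longrightarrow> l i \<in> Ar K \<and> Dom K (l i) = Cod K (q i) \<and>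
      Cod K (l i) = Cod K p \<and> l i \<cdot> q i = p" by metis
  obtain i0 where i0: "i0 \<in> I" using directed_poset_nonempty[OF dir] by blast
  have "is_direct_limit K I R (\<lambda>i. Cod K (q i)) x (Cod K p) l"
  proof (rule direct_limitI)
    show "direct_system K I R (\<lambda>i. Cod K (q i)) x"
      unfolding direct_system_def
    proof (intro conjI allI impI ballI)
      fix i assume i: "i \<in> I"
      show "Cod K (q i) \<in> Ob K" using q'[OF i] by simp
      show "x i i = ident K (Cod K (q i))"
        by (rule epicD[OF q'(3)[OF i]]) (use x[OF directed_poset_refl[OF dir i]] q'[OF i] in simp_all)
    next
      fix i j assume "(i, j) \<in> R"
      then show "x i j \<in> Hom K (Cod K (q i)) (Cod K (q j))" using x by simp
    next
      fix i j k assume ijk: "(i, j) \<in> R \<and> (j, k) \<in> R"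
      then have ik: "(i, k) \<in> R" using directed_poset_trans[OF dir] by blast
      show "x j k \<cdot> x i j = x i k"
        by (rule epicD[of "q i"]) (use ijk x[OF ik] x[of i j] x[of j k] F[OF ik] q'[of i] in simp_all)
    qed fact
    show "is_cocone K I R (\<lambda>i. Cod K (q i)) x (Cod K p) l"
    proof (rule coconeI)
      fix i j assume ij: "(i, j) \<in> R"
      show "l j \<cdot> x i j = l i"
        by (rule epicD[of "q i"]) (use x[OF ij] l[of i] l[of j] F[OF ij] q'[of i] in simp_all)
    qed (use l p' in simp_all)
  next
    fix Y t assume co: "is_cocone K I R (\<lambda>i. Cod K (q i)) x Y t"
    note c = coconeD[OF co]
    have tq: "t j \<cdot> q j = t i \<cdot> q i" if ij: "(i, j) \<in> R" for i j
      using reassoc[OF c(5)[OF ij], of "q i"] x[OF ij] F[OF ij] c(2-4)[of i] c(2-4)[of j] q'[of i] by simp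
    have t0: "t i \<cdot> q i = t i0 \<cdot> q i0" if i: "i \<in> I" for i
      using directed_poset_bound[OF dir i i0] tq by metis
    have ti0: "t i0 \<cdot> q i0 \<in> Ar K" "Dom K (t i0 \<cdot> q i0) = M" "Cod K (t i0 \<cdot> q i0) = Y"
      using c(2-4)[of i0] q'[OF i0] i0 by simp_all
    have "(t i0 \<cdot> q i0) \<cdot> f = zero_arr K (Dom K f) Y" if f: "f \<in> (\<Union>i\<in>I. F i)" for f
    proof -
      obtain i where i: "i \<in> I" "f \<in> F i" using f by blast
      have "(t i \<cdot> q i) \<cdot> f = zero_arr K (Dom K f) Y"
        using q'[OF i(1)] quotient_kills[OF q[OF i(1)] i(2)] i(1) c(2-4)[of i] by simp
      then show ?thesis using t0[OF i(1)] by simp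
    qed
    then obtain h where h: "h \<in> Ar K" "Dom K h = Cod K p" "Cod K h = Y" "h \<cdot> p = t i0 \<cdot> q i0"
      using quotient_factor[OF p, of "t i0 \<cdot> q i0"] ti0 by auto
    have "h \<cdot> l i = t i" if i: "i \<in> I" for i
      by (rule epicD[OF q'(3)[OF i]]) (use h l[OF i] t0[OF i] q'[OF i] c(2-4)[of i] i in simp_all)
    then show "\<exists>h. h \<in> Ar K \<and> Dom K h = Cod K p \<and> Cod K h = Y \<and> (\<forall>i\<in>I. h \<cdot> l i = t i)"
      using h by blast
  next
    fix h h' assume h: "h \<in> Ar K" "h' \<in> Ar K" "Dom K h = Cod K p" "Dom K h' = Cod K p" "Cod K h = Cod K h'"
      "\<And>i. i \<in> I \<Longrightarrow> h \<cdot> l i = h' \<cdot> l i"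
    have "(h \<cdot> l i0) \<cdot> q i0 = (h' \<cdot> l i0) \<cdot> q i0" using h(6)[OF i0] by simp
    then have "h \<cdot> p = h' \<cdot> p" using h(1-4) l[OF i0] q'[OF i0] by simp
    then show "h = h'" using epicD[OF p'(3), of h h'] h by simp
  qed
  then show ?thesis using x l by blast
qed

text \<open>Arrows from either object are pairs of a cocone on \<open>X\<close> and an arrow out of \<open>Cod h\<close> that agree on \<open>X i\<close>.\<close>

lemma direct_limit_of_pushouts:
  assumes lim: "is_direct_limit K J R X x L l" and i: "i \<in> J" "\<And>k. k \<in> J \<Longrightarrow> (i, k) \<in> R"
    and po: "\<And>k. k \<in> J \<Longrightarrow> is_pushout K h (x i k) (f k) (\<phi> k)" and poL: "is_pushout K h (l i) fL \<phi>L"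
  shows "\<exists>y m. is_direct_limit K J R (\<lambda>k. Cod K (f k)) y (Cod K fL) m \<and>
    (\<forall>k\<in>J. m k \<cdot> f k = fL \<cdot> l k \<and> m k \<cdot> \<phi> k = \<phi>L)"
proof -
  note s = direct_systemD[OF direct_limitD(1)[OF lim]] and c = coconeD[OF direct_limitD(2)[OF lim]]
  note F = directed_poset_Field[OF s(1)]
  note p = pushout_arr[OF po] and pL = pushout_arr[OF poL]
  have xi: "x i k \<in> Ar K" "Dom K (x i k) = X i" "Cod K (x i k) = X k" if "k \<in> J" for k
    using s(3-5)[OF i(2)[OF that]] by simp_all
  have h: "h \<in> Ar K" "Dom K h = X i" using pL c i by simp_all
  have fk: "f k \<in> Ar K" "\<phi> k \<in> Ar K" "Dom K (f k) = X k" "Dom K (\<phi> k) = Cod K h" "Cod K (\<phi> k) = Cod K (f k)"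
    "f k \<cdot> x i k = \<phi> k \<cdot> h" if "k \<in> J" for k
    using p[OF that] xi[OF that] by simp_all
  have fL: "fL \<in> Ar K" "\<phi>L \<in> Ar K" "Dom K fL = L" "Dom K \<phi>L = Cod K h" "Cod K \<phi>L = Cod K fL" "fL \<cdot> l i = \<phi>L \<cdot> h"
    using pL c(2-4)[OF i(1)] by simp_all
  have "\<exists>y. y \<in> Ar K \<and> Dom K y = Cod K (f k) \<and> Cod K y = Cod K (f j) \<and> y \<cdot> f k = f j \<cdot> x k j \<and> y \<cdot> \<phi> k = \<phi> j"
    if kj: "(k, j) \<in> R" for k j
  proof -
    have k: "k \<in> J" and j: "j \<in> J" using F kj by auto
    have "(f j \<cdot> x k j) \<cdot> x i k = \<phi> j \<cdot> h"
      using fk[OF j] s(3-5)[OF kj] s(7)[OF i(2)[OF k] kj] xi[OF k] by simp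
    then show ?thesis
      using pushout_factor[OF po[OF k], of "f j \<cdot> x k j" "\<phi> j"] fk[OF j] fk[OF k] s(3-5)[OF kj] xi[OF k] by auto
  qed
  then obtain y where y: "\<And>k j. (k, j) \<in> R \<Longrightarrow> y k j \<in> Ar K \<and> Dom K (y k j) = Cod K (f k) \<and>
      Cod K (y k j) = Cod K (f j) \<and> y k j \<cdot> f k = f j \<cdot> x k j \<and> y k j \<cdot> \<phi> k = \<phi> j" by metis
  have "\<exists>m. m \<in> Ar K \<and> Dom K m = Cod K (f k) \<and> Cod K m = Cod K fL \<and> m \<cdot> f k = fL \<cdot> l k \<and> m \<cdot> \<phi> k = \<phi>L"
    if k: "k \<in> J" for k
  proof -
    have "(fL \<cdot> l k) \<cdot> x i k = \<phi>L \<cdot> h"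
      using fL c(2-4)[OF k] c(5)[OF i(2)[OF k]] xi[OF k] by simp
    then show ?thesis
      using pushout_factor[OF po[OF k], of "fL \<cdot> l k" \<phi>L] fL fk[OF k] c(2-4)[OF k] xi[OF k] by auto
  qed
  then obtain m where m: "\<And>k. k \<in> J \<Longrightarrow> m k \<in> Ar K \<and> Dom K (m k) = Cod K (f k) \<and> Cod K (m k) = Cod K fL \<and>
      m k \<cdot> f k = fL \<cdot> l k \<and> m k \<cdot> \<phi> k = \<phi>L" by metis
  have "is_direct_limit K J R (\<lambda>k. Cod K (f k)) y (Cod K fL) m"
  proof (rule direct_limitI)
    show "direct_system K J R (\<lambda>k. Cod K (f k)) y"
      unfolding direct_system_def
    proof (intro conjI allI impI ballI)
      show "directed_poset J R" by (rule s(1))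
      fix k assume k: "k \<in> J"
      show "Cod K (f k) \<in> Ob K" using fk[OF k] by simp
      have kk: "(k, k) \<in> R" by (rule directed_poset_refl[OF s(1) k])
      show "y k k = ident K (Cod K (f k))"
        by (rule pushout_unique[OF po[OF k]]) (use y[OF kk] fk[OF k] s(6)[OF k] in simp_all)
    next
      fix k j assume "(k, j) \<in> R"
      then show "y k j \<in> Hom K (Cod K (f k)) (Cod K (f j))" using y by simp
    next
      fix k j r assume a: "(k, j) \<in> R \<and> (j, r) \<in> R"
      then have kj: "(k, j) \<in> R" and jr: "(j, r) \<in> R" and kr: "(k, r) \<in> R"
        using directed_poset_trans[OF s(1), of k j r] by auto
      have k: "k \<in> J" and j: "j \<in> J" and r: "r \<in> J" using F[OF kj] F[OF jr] by simp_all
      have "y j r \<cdot> f j \<cdot> x k j = f r \<cdot> x k r"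
        using reassoc[of "y j r" "f j" _ "x k j"] y[OF jr] fk[OF j] fk[OF r] s(3-5)[OF kj] s(3-5)[OF jr] s(7)[OF kj jr] by simp
      then show "y j r \<cdot> y k j = y k r"
        by (intro pushout_unique[OF po[OF k], of "y j r \<cdot> y k j" "y k r"])
          (use y[OF kj] y[OF jr] y[OF kr] fk[OF k] in simp_all)
    qed
    show "is_cocone K J R (\<lambda>k. Cod K (f k)) y (Cod K fL) m"
    proof (rule coconeI)
      fix k j assume kj: "(k, j) \<in> R"
      then have k: "k \<in> J" and j: "j \<in> J" using F by auto
      have "m j \<cdot> f j \<cdot> x k j = fL \<cdot> l k"
        using reassoc[of "m j" "f j" _ "x k j"] m[OF j] fk[OF j] fL c(2-4)[OF j] c(5)[OF kj] s(3-5)[OF kj] by simp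
      then show "m j \<cdot> y k j = m k"
        by (intro pushout_unique[OF po[OF k], of "m j \<cdot> y k j" "m k"])
          (use y[OF kj] m[OF j] m[OF k] fk[OF k] in simp_all)
    qed (use m fL in simp_all)
  next
    fix Y t assume "is_cocone K J R (\<lambda>k. Cod K (f k)) y Y t"
    note t = coconeD[OF this]
    have "is_cocone K J R X x Y (\<lambda>k. t k \<cdot> f k)"
    proof (rule coconeI)
      fix k j assume kj: "(k, j) \<in> R"
      then have k: "k \<in> J" and j: "j \<in> J" using F by auto
      have "t k \<cdot> f k = t j \<cdot> y k j \<cdot> f k"
        using reassoc[OF t(5)[OF kj], of "f k"] t(2-4)[OF j] y[OF kj] fk[OF k] by simp
      then show "(t j \<cdot> f j) \<cdot> x k j = t k \<cdot> f k" using y[OF kj] t(2-4)[OF j] fk[OF j] s(3-5)[OF kj] by simp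
    qed (use t fk in simp_all)
    then obtain \<alpha> where \<alpha>: "\<alpha> \<in> Ar K" "Dom K \<alpha> = L" "Cod K \<alpha> = Y" "\<And>k. k \<in> J \<Longrightarrow> \<alpha> \<cdot> l k = t k \<cdot> f k"
      using direct_limit_hom[OF lim] by blast
    have \<beta>: "t k \<cdot> \<phi> k = t i \<cdot> \<phi> i" if k: "k \<in> J" for k
      using reassoc[OF t(5)[OF i(2)[OF k]], of "\<phi> i"] t(2-4)[OF k] y[OF i(2)[OF k]] fk[OF i(1)] by simp
    have "\<alpha> \<cdot> l i = (t i \<cdot> \<phi> i) \<cdot> h"
      using \<alpha>(4)[OF i(1)] fk(1-5)[OF i(1)] fk(6)[OF i(1), symmetric] s(6)[OF i(1)] t(2-4)[OF i(1)] h by simp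
    then obtain H where H: "H \<in> Ar K" "Dom K H = Cod K fL" "Cod K H = Y" "H \<cdot> fL = \<alpha>" "H \<cdot> \<phi>L = t i \<cdot> \<phi> i"
      using pushout_factor[OF poL, of \<alpha> "t i \<cdot> \<phi> i"] \<alpha> t(2-4)[OF i(1)] fk[OF i(1)] c(2-4)[OF i(1)] by auto
    have "H \<cdot> m k = t k" if k: "k \<in> J" for k
    proof (rule pushout_unique[OF po[OF k]])
      show "(H \<cdot> m k) \<cdot> f k = t k \<cdot> f k"
        using reassoc[OF H(4), of "l k"] m[OF k] fk[OF k] H fL c(2-4)[OF k] \<alpha>(4)[OF k] by simp
      show "(H \<cdot> m k) \<cdot> \<phi> k = t k \<cdot> \<phi> k" using m[OF k] fk[OF k] H fL \<beta>[OF k] by simp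
    qed (use m[OF k] fk[OF k] H t(2-4)[OF k] in simp_all)
    then show "\<exists>h. h \<in> Ar K \<and> Dom K h = Cod K fL \<and> Cod K h = Y \<and> (\<forall>i\<in>J. h \<cdot> m i = t i)"
      using H by blast
  next
    fix H H' assume H: "H \<in> Ar K" "H' \<in> Ar K" "Dom K H = Cod K fL" "Dom K H' = Cod K fL" "Cod K H = Cod K H'"
      "\<And>k. k \<in> J \<Longrightarrow> H \<cdot> m k = H' \<cdot> m k"
    have e: "T \<cdot> fL \<cdot> l k = (T \<cdot> m k) \<cdot> f k" "T \<cdot> \<phi>L = (T \<cdot> m k) \<cdot> \<phi> k" if "T \<in> Ar K" "Dom K T = Cod K fL" "k \<in> J" for T k
      using that m[OF that(3)] fk[OF that(3)] by simp_all
    have "H \<cdot> fL = H' \<cdot> fL"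
    proof (rule direct_limit_unique[OF lim])
      fix k assume k: "k \<in> J"
      show "(H \<cdot> fL) \<cdot> l k = (H' \<cdot> fL) \<cdot> l k"
        using e(1)[of H k] e(1)[of H' k] H(6)[OF k] H(1-4) k fL c(2-4)[OF k] by simp
    qed (use H fL in simp_all)
    moreover have "H \<cdot> \<phi>L = H' \<cdot> \<phi>L"
      using e(2)[of H i] e(2)[of H' i] H(6)[OF i(1)] H(1-4) i(1) by simp
    ultimately show "H = H'" using pushout_unique[OF poL, of H H'] H by simp
  qed
  then show ?thesis using m by blast
qed

end

section \<open>Locally finitely presentable categories\<close>

text \<open>The elementwise form of finite presentability: maps from \<open>E\<close> to a direct limit come from some
  stage, and maps to some stage that vanish in the limit vanish at a later stage.\<close>

definition fp :: "'u rel \<Rightarrow> ('o, 'm, 'x) abcat_scheme \<Rightarrow> 'o \<Rightarrow> bool" where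
  "fp \<kappa> K E \<longleftrightarrow> E \<in> Ob K \<and>
     (\<forall>(I :: 'u set) R X x L l. small \<kappa> I \<and> is_direct_limit K I R X x L l \<longrightarrow>
        (\<forall>f \<in> Hom K E L. \<exists>i \<in> I. \<exists>g \<in> Hom K E (X i). l i \<cdot>\<^bsub>K\<^esub> g = f) \<and>
        (\<forall>i \<in> I. \<forall>g \<in> Hom K E (X i). l i \<cdot>\<^bsub>K\<^esub> g = zero_arr K E L \<longrightarrow>
           (\<exists>j. (i, j) \<in> R \<and> x i j \<cdot>\<^bsub>K\<^esub> g = zero_arr K E (X j))))"

lemma (in abelian_category) finitely_presentable_fp:
  assumes "finitely_presentable \<kappa> K E"
  shows "fp \<kappa> K E"
  unfolding fp_def
proof (intro conjI allI impI ballI)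
  show E: "E \<in> Ob K" using assms by (simp add: finitely_presentable_def)
  fix I :: "'a set" and R X x L l assume a: "small \<kappa> I \<and> is_direct_limit K I R X x L l"
  then have lim: "is_group_direct_limit I R (\<lambda>i. hom_group K E (X i)) (\<lambda>i j g. x i j \<cdot> g) (hom_group K E L) (\<lambda>i g. l i \<cdot> g)"
    using assms unfolding finitely_presentable_def preserves_direct_limits_def by blast
  note s = direct_systemD[OF direct_limitD(1)] and c = coconeD[OF direct_limitD(2)]
  have dl: "is_direct_limit K I R X x L l" using a by simp
  note F = directed_poset_Field[OF s(1)[OF dl]]
  {
    fix f assume "f \<in> Hom K E L"
    then show "\<exists>i\<in>I. \<exists>g\<in>Hom K E (X i). l i \<cdot> g = f"
      using group_direct_limit_surj[OF lim s(1)[OF dl], of f] by (simp add: eq_commute)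
  next
    fix i g assume i: "i \<in> I" and g: "g \<in> Hom K E (X i)" and 0: "l i \<cdot> g = zero_arr K E L"
    have "x j k \<cdot> x i j \<cdot> h = x i k \<cdot> h" if "(i, j) \<in> R" "(j, k) \<in> R" "h \<in> Hom K E (X i)" for i j k h
      using reassoc[OF s(7)[OF dl that(1,2)], of h] that s[OF dl] F by simp
    then show "\<exists>j. (i, j) \<in> R \<and> x i j \<cdot> g = zero_arr K E (X j)"
      using group_direct_limit_kernel[OF lim s(1)[OF dl] _ i, of g] g 0 by simp
  }
qed

locale lfp_category = abelian_category K
  for K :: "('o, 'm, 'x) abcat_scheme" (structure) +
  fixes \<kappa> :: "'u rel" and \<G> :: "'o set"
  assumes inaccessible: "inaccessible \<kappa>"
    and small_Hom: "locally_small \<kappa> K"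
    and small_coproducts: "has_small_coproducts \<kappa> K"
    and small_\<G>: "small \<kappa> \<G>"
    and generating: "generating K \<G>"
    and \<G>_fp: "G \<in> \<G> \<Longrightarrow> fp \<kappa> K G"
begin

definition elems :: "'o \<Rightarrow> 'm set" where
  "elems X = (\<Union>G\<in>\<G>. Hom K G X)"

lemma elemsD: "u \<in> elems X \<Longrightarrow> u \<in> Ar K \<and> Dom K u \<in> \<G> \<and> Cod K u = X"
  by (auto simp: elems_def)

lemma elemsI: "u \<in> Ar K \<Longrightarrow> Dom K u \<in> \<G> \<Longrightarrow> Cod K u = X \<Longrightarrow> u \<in> elems X"
  by (auto simp: elems_def)

lemma \<G>_Ob: "G \<in> \<G> \<Longrightarrow> G \<in> Ob K"
  using generating by (auto simp: generating_def)

lemma small_elems: "X \<in> Ob K \<Longrightarrow> small \<kappa> (elems X)"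
  unfolding elems_def using small_Hom \<G>_Ob
  by (intro small_UN[OF inaccessible small_\<G>]) (auto simp: locally_small_def simp del: Hom_iff)

lemma elems_zero:
  assumes f: "f \<in> Ar K" and 0: "\<And>u. u \<in> elems (Dom K f) \<Longrightarrow> f \<cdot> u = zero_arr K (Dom K u) (Cod K f)"
  shows "f = zero_arr K (Dom K f) (Cod K f)"
proof (rule ccontr)
  assume "f \<noteq> zero_arr K (Dom K f) (Cod K f)"
  moreover have "f \<in> Hom K (Dom K f) (Cod K f)" "zero_arr K (Dom K f) (Cod K f) \<in> Hom K (Dom K f) (Cod K f)"
    using f by simp_all
  ultimately obtain G u where u: "G \<in> \<G>" "u \<in> Hom K G (Dom K f)" "f \<cdot> u \<noteq> zero_arr K (Dom K f) (Cod K f) \<cdot> u"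
    using generating f arr_Ob[OF f] unfolding generating_def by blast
  then show False using 0[OF elemsI[of u "Dom K f"]] f by simp
qed

lemma fp_Ob: "fp \<kappa> K E \<Longrightarrow> E \<in> Ob K"
  by (simp add: fp_def)

text \<open>Coproducts and finite presentability, stated for index subsets of \<open>'u\<close>, extend to small index
  sets in arbitrary types.\<close>

lemma ex_coproduct:
  fixes I :: "'i set"
  assumes "small \<kappa> I" "\<And>i. i \<in> I \<Longrightarrow> X i \<in> Ob K"
  shows "\<exists>C \<iota>. is_coproduct K I X C \<iota>"
proof -
  obtain g :: "'i \<Rightarrow> 'u" where g: "inj_on g I" using small_inj_image[OF inaccessible assms(1)] by blast
  define d where "d = inv_into I g"
  have d: "d (g i) = i" if "i \<in> I" for i using g that by (simp add: d_def)
  have "small \<kappa> (g ` I)" using assms(1) by (rule small_image)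
  moreover have "\<forall>a \<in> g ` I. X (d a) \<in> Ob K" using assms(2) d by simp
  ultimately obtain C \<iota> where c: "is_coproduct K (g ` I) (\<lambda>a. X (d a)) C \<iota>"
    using small_coproducts unfolding has_small_coproducts_def by metis
  have "is_coproduct K I X C (\<lambda>i. \<iota> (g i))"
    unfolding is_coproduct_def
  proof (intro conjI ballI allI impI)
    show "C \<in> Ob K" using c by (simp add: is_coproduct_def)
    show "\<iota> (g i) \<in> Hom K (X i) C" if "i \<in> I" for i using coproduct_arr[OF c, of "g i"] d that by simp
    fix Y t assume Y: "Y \<in> Ob K" and t: "\<forall>i \<in> I. t i \<in> Hom K (X i) Y"
    obtain h where h: "h \<in> Ar K" "Dom K h = C" "Cod K h = Y" "\<forall>a \<in> g ` I. h \<cdot> \<iota> a = t (d a)"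
      using coproduct_hom[OF c Y, of "\<lambda>a. t (d a)"] t d by fastforce
    show "\<exists>!h. h \<in> Hom K C Y \<and> (\<forall>i\<in>I. h \<cdot> \<iota> (g i) = t i)"
    proof (rule ex1I[of _ h])
      show "h \<in> Hom K C Y \<and> (\<forall>i\<in>I. h \<cdot> \<iota> (g i) = t i)" using h d by simp
      fix h' assume "h' \<in> Hom K C Y \<and> (\<forall>i\<in>I. h' \<cdot> \<iota> (g i) = t i)"
      then show "h' = h" by (intro coproduct_unique[OF c, of h' h]) (use h d in auto)
    qed
  qed
  then show ?thesis by blast
qed

lemma fp_factor:
  fixes I :: "'i set"
  assumes E: "fp \<kappa> K E" and I: "small \<kappa> I" and lim: "is_direct_limit K I R X x L l"
    and f: "f \<in> Ar K" "Dom K f = E" "Cod K f = L"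
  shows "\<exists>i\<in>I. \<exists>g. g \<in> Ar K \<and> Dom K g = E \<and> Cod K g = X i \<and> l i \<cdot> g = f"
proof -
  obtain \<gamma> :: "'i \<Rightarrow> 'u" where \<gamma>: "inj_on \<gamma> I" using small_inj_image[OF inaccessible I] by blast
  have "\<exists>i\<in>\<gamma> ` I. \<exists>g \<in> Hom K E (X (inv_into I \<gamma> i)). l (inv_into I \<gamma> i) \<cdot> g = f"
    using E[unfolded fp_def] direct_limit_reindex[OF lim \<gamma>] small_image[OF I, of \<gamma>] f by fastforce
  then obtain a g where a: "a \<in> \<gamma> ` I" and g: "g \<in> Hom K E (X (inv_into I \<gamma> a))" "l (inv_into I \<gamma> a) \<cdot> g = f"
    by blast
  have "inv_into I \<gamma> a \<in> I" using a by (rule inv_into_into)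
  then show ?thesis using g by auto
qed

lemma fp_kill:
  fixes I :: "'i set"
  assumes E: "fp \<kappa> K E" and I: "small \<kappa> I" and lim: "is_direct_limit K I R X x L l"
    and g: "i \<in> I" "g \<in> Ar K" "Dom K g = E" "Cod K g = X i" "l i \<cdot> g = zero_arr K E L"
  shows "\<exists>j. j \<in> I \<and> (i, j) \<in> R \<and> x i j \<cdot> g = zero_arr K E (X j)"
proof -
  obtain \<gamma> :: "'i \<Rightarrow> 'u" where \<gamma>: "inj_on \<gamma> I" using small_inj_image[OF inaccessible I] by blast
  note F = directed_poset_Field[OF direct_systemD(1)[OF direct_limitD(1)[OF lim]]]
  have "\<forall>i\<in>\<gamma> ` I. \<forall>g \<in> Hom K E (X (inv_into I \<gamma> i)). l (inv_into I \<gamma> i) \<cdot> g = zero_arr K E L \<longrightarrow>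
      (\<exists>j. (i, j) \<in> {(\<gamma> i, \<gamma> j) |i j. (i, j) \<in> R} \<and>
        x (inv_into I \<gamma> i) (inv_into I \<gamma> j) \<cdot> g = zero_arr K E (X (inv_into I \<gamma> j)))"
    using E[unfolded fp_def, THEN conjunct2, THEN spec, THEN spec, THEN spec, THEN spec, THEN spec, THEN spec,
        THEN mp, OF conjI, OF small_image[OF I, of \<gamma>] direct_limit_reindex[OF lim \<gamma>]] by blast
  from this[THEN bspec, of "\<gamma> i", THEN bspec, of g] obtain j where
    "(\<gamma> i, j) \<in> {(\<gamma> i, \<gamma> j) |i j. (i, j) \<in> R}" "x i (inv_into I \<gamma> j) \<cdot> g = zero_arr K E (X (inv_into I \<gamma> j))"
    using g \<gamma> by auto
  then obtain i' j' where ij: "\<gamma> i = \<gamma> i'" "j = \<gamma> j'" "(i', j') \<in> R" "x i (inv_into I \<gamma> (\<gamma> j')) \<cdot> g = zero_arr K E (X (inv_into I \<gamma> (\<gamma> j')))"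
    by auto
  have "i' = i" using ij(1) \<gamma> g(1) F[OF ij(3)] by (auto dest: inj_onD)
  then show ?thesis using ij F[OF ij(3)] \<gamma> by (intro exI[of _ j']) simp
qed

lemma direct_limits_arbitrary_index:
  fixes I :: "'i set"
  assumes "small \<kappa> I" "is_direct_limit K I R X x L l" "\<And>i. i \<in> I \<Longrightarrow> X i \<in> \<S>"
  shows "L \<in> direct_limits \<kappa> K \<S>"
proof -
  obtain \<gamma> :: "'i \<Rightarrow> 'u" where \<gamma>: "inj_on \<gamma> I" using small_inj_image[OF inaccessible assms(1)] by blast
  have "\<forall>a\<in>\<gamma> ` I. X (inv_into I \<gamma> a) \<in> \<S>" using assms(3) \<gamma> by auto
  then have "small \<kappa> (\<gamma> ` I) \<and> (\<forall>a\<in>\<gamma> ` I. X (inv_into I \<gamma> a) \<in> \<S>) \<and>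
      is_direct_limit K (\<gamma> ` I) {(\<gamma> i, \<gamma> j) |i j. (i, j) \<in> R} (\<lambda>a. X (inv_into I \<gamma> a))
        (\<lambda>a b. x (inv_into I \<gamma> a) (inv_into I \<gamma> b)) L (\<lambda>a. l (inv_into I \<gamma> a))"
    using direct_limit_reindex[OF assms(2) \<gamma>] small_image[OF assms(1), of \<gamma>] by simp
  then show ?thesis unfolding direct_limits_def by (intro CollectI exI)
qed

lemma ex_quotient:
  assumes F: "small \<kappa> F" "\<And>f. f \<in> F \<Longrightarrow> f \<in> Ar K \<and> Cod K f = M" and M: "M \<in> Ob K"
  shows "\<exists>q. is_quotient K M F q"
proof -
  obtain C \<iota> where c: "is_coproduct K F (\<lambda>f. Dom K f) C \<iota>" using ex_coproduct[OF F(1), of "\<lambda>f. Dom K f"] F(2) by auto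
  note c' = coproduct_arr[OF c]
  obtain h where h: "h \<in> Ar K" "Dom K h = C" "Cod K h = M" "\<And>f. f \<in> F \<Longrightarrow> h \<cdot> \<iota> f = f"
    using coproduct_hom[OF c M, of "\<lambda>f. f"] F(2) by auto
  obtain q where q: "is_cokernel K h q" using obtain_cokernel[OF h(1)] .
  note q' = cokernel_arr[OF q]
  have "is_quotient K M F q"
  proof (rule is_quotientI)
    show "epic K q" by (rule cokernel_epic[OF q])
    show "Dom K q = M" using q' h by simp
    fix f assume f: "f \<in> F"
    show "f \<in> Ar K \<and> Cod K f = M \<and> q \<cdot> f = zero_arr K (Dom K f) (Cod K q)"
      using reassoc[OF q'(4), of "\<iota> f"] q'(1-3) c'[OF f] h F(2)[OF f] f by simp
  next
    fix g assume g: "g \<in> Ar K" "Dom K g = M" "\<And>f. f \<in> F \<Longrightarrow> g \<cdot> f = zero_arr K (Dom K f) (Cod K g)"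
    have "g \<cdot> h = zero_arr K C (Cod K g)"
      by (rule coproduct_unique[OF c]) (use g h c' F(2) arr_Ob[OF h(1)] in simp_all)
    then show "\<exists>h. h \<in> Ar K \<and> Dom K h = Cod K q \<and> Cod K h = Cod K g \<and> h \<cdot> q = g"
      using cokernel_factor[OF q, of g] g h by simp
  qed
  then show ?thesis by blast
qed

text \<open>The direct limit is the quotient of the coproduct by the differences \<open>\<iota> j \<cdot> x i j \<boxminus> \<iota> i\<close>.\<close>

lemma ex_direct_limit:
  fixes I :: "'i set"
  assumes I: "small \<kappa> I" and sys: "direct_system K I R X x"
  shows "\<exists>L l. is_direct_limit K I R X x L l"
proof -
  note s = direct_systemD[OF sys]
  note F = directed_poset_Field[OF s(1)]
  obtain C \<iota> where c: "is_coproduct K I X C \<iota>" using ex_coproduct[OF I, of X] s(2) by blast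
  note c' = coproduct_arr[OF c]
  have C: "C \<in> Ob K" using c by (simp add: is_coproduct_def)
  define D where "D = (\<lambda>(i, j). \<iota> j \<cdot> x i j \<boxminus> \<iota> i) ` R"
  have "R \<subseteq> I \<times> I" using F by auto
  then have sD: "small \<kappa> D" unfolding D_def
    by (intro small_image small_subset[OF small_Times[OF inaccessible I I]])
  have D: "f \<in> Ar K \<and> Cod K f = C" if "f \<in> D" for f
    using that s F c' by (auto simp: D_def)
  obtain q where q: "is_quotient K C D q" using ex_quotient[OF sD D C] by blast
  note q' = quotientD[OF q]
  have ql: "q \<cdot> \<iota> j \<cdot> x i j = q \<cdot> \<iota> i" if ij: "(i, j) \<in> R" for i j
  proof -
    have "q \<cdot> (\<iota> j \<cdot> x i j \<boxminus> \<iota> i) = zero_arr K (X i) (Cod K q)"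
      using quotient_kills(3)[OF q, of "\<iota> j \<cdot> x i j \<boxminus> \<iota> i"] ij s c' F[OF ij] by (force simp: D_def)
    then show ?thesis using q' s(3-5)[OF ij] c' F[OF ij] by simp
  qed
  have "is_direct_limit K I R X x (Cod K q) (\<lambda>i. q \<cdot> \<iota> i)"
  proof (rule direct_limitI[OF sys])
    show "is_cocone K I R X x (Cod K q) (\<lambda>i. q \<cdot> \<iota> i)"
    proof (rule coconeI)
      fix i j assume ij: "(i, j) \<in> R"
      show "(q \<cdot> \<iota> j) \<cdot> x i j = q \<cdot> \<iota> i" using ql[OF ij] q' s(3-5)[OF ij] c' F[OF ij] by simp
    qed (use q' c' in simp_all)
  next
    fix Y t assume "is_cocone K I R X x Y t"
    note t = coconeD[OF this]
    obtain h where h: "h \<in> Ar K" "Dom K h = C" "Cod K h = Y" "\<And>i. i \<in> I \<Longrightarrow> h \<cdot> \<iota> i = t i"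
      using coproduct_hom[OF c t(1), of t] t by auto
    have "h \<cdot> f = zero_arr K (Dom K f) (Cod K h)" if "f \<in> D" for f
    proof -
      obtain i j where ij: "(i, j) \<in> R" "f = \<iota> j \<cdot> x i j \<boxminus> \<iota> i" using \<open>f \<in> D\<close> by (auto simp: D_def)
      note ii = F[OF ij(1)]
      have "h \<cdot> \<iota> j \<cdot> x i j = h \<cdot> \<iota> i"
        using reassoc[OF h(4), of j "x i j"] ii h s(3-5)[OF ij(1)] t(2-4) t(5)[OF ij(1)] c' by simp
      then show ?thesis using ij ii h c' s(3-5)[OF ij(1)] s(2) t(2-4) by simp
    qed
    then obtain h' where "h' \<in> Ar K" "Dom K h' = Cod K q" "Cod K h' = Y" "h' \<cdot> q = h"
      using quotient_factor[OF q, of h] h by auto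
    then show "\<exists>h. h \<in> Ar K \<and> Dom K h = Cod K q \<and> Cod K h = Y \<and> (\<forall>i\<in>I. h \<cdot> q \<cdot> \<iota> i = t i)"
      using h(4) c' q' by (intro exI[of _ h']) (auto simp: reassoc[of h' q h])
  next
    fix h h' assume h: "h \<in> Ar K" "h' \<in> Ar K" "Dom K h = Cod K q" "Dom K h' = Cod K q" "Cod K h = Cod K h'"
      "\<And>i. i \<in> I \<Longrightarrow> h \<cdot> q \<cdot> \<iota> i = h' \<cdot> q \<cdot> \<iota> i"
    have "h \<cdot> q = h' \<cdot> q"
      by (rule coproduct_unique[OF c]) (use h q' c' in simp_all)
    then show "h = h'" using epicD[OF q'(3)] h by blast
  qed
  then show ?thesis by blast
qed

text \<open>An arrow out of a direct limit is monic as soon as it kills no element of any stage that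
  survives to the limit, because every element of the limit comes from some stage.\<close>

lemma direct_limit_monicI:
  fixes I :: "'i set"
  assumes I: "small \<kappa> I" and lim: "is_direct_limit K I R X x L l" and p: "p \<in> Ar K" "Dom K p = L"
    and 0: "\<And>i u. i \<in> I \<Longrightarrow> u \<in> elems (X i) \<Longrightarrow> p \<cdot> l i \<cdot> u = zero_arr K (Dom K u) (Cod K p) \<Longrightarrow>
      l i \<cdot> u = zero_arr K (Dom K u) L"
  shows "monic K p"
proof (rule monicI[OF p(1)])
  fix f assume f: "f \<in> Ar K" "Cod K f = Dom K p" "p \<cdot> f = zero_arr K (Dom K f) (Cod K p)"
  note c = coconeD[OF direct_limitD(2)[OF lim]]
  show "f = zero_arr K (Dom K f) (Dom K p)"
  proof (rule elems_zero[of f, unfolded f(2)])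
    fix u assume "u \<in> elems (Dom K f)"
    note u = elemsD[OF this]
    obtain i v where v: "i \<in> I" "v \<in> Ar K" "Dom K v = Dom K u" "Cod K v = X i" "l i \<cdot> v = f \<cdot> u"
      using fp_factor[OF \<G>_fp I lim, of "Dom K u" "f \<cdot> u"] u f p by auto
    have "p \<cdot> l i \<cdot> v = zero_arr K (Dom K v) (Cod K p)"
      using reassoc[OF f(3), of u] f(1,2) u p v by simp
    then have "l i \<cdot> v = zero_arr K (Dom K v) L" using 0[of i v] v u by (simp add: elemsI)
    then show "f \<cdot> u = zero_arr K (Dom K u) (Dom K p)" using v p by simp
  qed (use f in simp)
qed

text \<open>The comparison map to \<open>N\<close> from the direct limit is epic, because all elements of \<open>N\<close> come from some stage,
  and it is monic by the previous lemma.\<close>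

lemma direct_limit_by_elements:
  fixes I :: "'i set"
  assumes I: "small \<kappa> I" and sys: "direct_system K I R X x" and co: "is_cocone K I R X x N n"
    and surj: "\<And>u. u \<in> elems N \<Longrightarrow> \<exists>i\<in>I. \<exists>v. v \<in> Ar K \<and> Dom K v = Dom K u \<and> Cod K v = X i \<and> n i \<cdot> v = u"
    and inj: "\<And>i u. i \<in> I \<Longrightarrow> u \<in> elems (X i) \<Longrightarrow> n i \<cdot> u = zero_arr K (Dom K u) N \<Longrightarrow>
      \<exists>j. (i, j) \<in> R \<and> x i j \<cdot> u = zero_arr K (Dom K u) (X j)"
  shows "is_direct_limit K I R X x N n"
proof -
  note s = direct_systemD[OF sys] and c = coconeD[OF co]
  note F = directed_poset_Field[OF s(1)]
  obtain L l where lim: "is_direct_limit K I R X x L l" using ex_direct_limit[OF I sys] by blast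
  note l = coconeD[OF direct_limitD(2)[OF lim]]
  obtain h where h: "h \<in> Ar K" "Dom K h = L" "Cod K h = N" "\<And>i. i \<in> I \<Longrightarrow> h \<cdot> l i = n i"
    using direct_limit_hom[OF lim co] by blast
  have "monic K h"
  proof (rule direct_limit_monicI[OF I lim h(1,2)])
    fix i u assume i: "i \<in> I" and u: "u \<in> elems (X i)" and 0: "h \<cdot> l i \<cdot> u = zero_arr K (Dom K u) (Cod K h)"
    note u' = elemsD[OF u]
    have "n i \<cdot> u = zero_arr K (Dom K u) N"
      using reassoc[OF h(4)[OF i], of u] 0 i u' h(1-3) l(2-4) by simp
    then obtain j where j: "(i, j) \<in> R" "x i j \<cdot> u = zero_arr K (Dom K u) (X j)" using inj[OF i u] by blast
    then show "l i \<cdot> u = zero_arr K (Dom K u) L"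
      using reassoc[OF l(5)[OF j(1)], of u] F[OF j(1)] l(2-4) s(3-5) u' by simp
  qed
  moreover have "epic K h"
  proof (rule epicI[OF h(1)])
    fix f assume f: "f \<in> Ar K" "Dom K f = Cod K h" "f \<cdot> h = zero_arr K (Dom K h) (Cod K f)"
    show "f = zero_arr K (Cod K h) (Cod K f)"
    proof (rule elems_zero[of f, unfolded f(2)])
      fix u assume u: "u \<in> elems (Cod K h)"
      note u' = elemsD[OF u]
      obtain i v where v: "i \<in> I" "v \<in> Ar K" "Dom K v = Dom K u" "Cod K v = X i" "n i \<cdot> v = u"
        using surj[of u] u unfolding h(3) by blast
      have "h \<cdot> l i \<cdot> v = u" using reassoc[OF h(4)[OF v(1)], of v] v h(1-3) l(2-4) by simp
      then have "f \<cdot> u = f \<cdot> h \<cdot> l i \<cdot> v" by simp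
      also have "\<dots> = zero_arr K (Dom K u) (Cod K f)"
        using reassoc[OF f(3), of "l i \<cdot> v"] f(1,2) h(1-3) v(1-4) l(1) l(2-4) by simp
      finally show "f \<cdot> u = zero_arr K (Dom K u) (Cod K f)" .
    qed (use f in simp)
  qed
  ultimately have "iso_arr K h" by (rule monic_epic_iso)
  from direct_limit_iso[OF lim this h(2)] have "is_direct_limit K I R X x N (\<lambda>i. h \<cdot> l i)" by (simp add: h(3))
  then show ?thesis using h(4) co F
    unfolding is_direct_limit_def by (simp cong: conj_cong)
qed

text \<open>Every element of the limit comes from a stage in the final segment, by directedness.\<close>

lemma direct_limit_final_segment:
  fixes I :: "'i set"
  assumes I: "small \<kappa> I" and lim: "is_direct_limit K I R X x L l" and i: "i \<in> I"
  defines "J \<equiv> {k. (i, k) \<in> R}"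
  shows "is_direct_limit K J (R \<inter> J \<times> J) X x L l" "small \<kappa> J" "J \<subseteq> I"
proof -
  note s = direct_systemD[OF direct_limitD(1)[OF lim]] and c = coconeD[OF direct_limitD(2)[OF lim]]
  note F = directed_poset_Field[OF s(1)] and rt = directed_poset_trans[OF s(1)]
  show J: "J \<subseteq> I" using F by (auto simp: J_def)
  show sJ: "small \<kappa> J" by (rule small_subset[OF I J])
  have up: "k \<in> J \<and> j \<in> J" if "(k, j) \<in> R" "k \<in> J" for j k using rt[OF _ that(1), of i] that(2) by (simp add: J_def)
  show "is_direct_limit K J (R \<inter> J \<times> J) X x L l"
  proof (rule direct_limit_by_elements[OF sJ])
    have "directed_poset J (R \<inter> J \<times> J)"
      unfolding directed_poset_def partial_order_on_def preorder_on_def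
    proof (intro conjI ballI)
      show "R \<inter> J \<times> J \<subseteq> J \<times> J" by blast
      show "refl_on J (R \<inter> J \<times> J)" using directed_poset_refl[OF s(1)] J by (auto simp: refl_on_def)
      show "trans (R \<inter> J \<times> J)" by (rule transI) (use rt in blast)
      show "antisym (R \<inter> J \<times> J)"
        using s(1) unfolding directed_poset_def partial_order_on_def antisym_def by blast
      show "J \<noteq> {}" using directed_poset_refl[OF s(1) i] by (auto simp: J_def)
      fix a b assume ab: "a \<in> J" "b \<in> J"
      then obtain k where "k \<in> I" "(a, k) \<in> R" "(b, k) \<in> R" using directed_poset_bound[OF s(1), of a b] J by blast
      then show "\<exists>k\<in>J. (a, k) \<in> R \<inter> J \<times> J \<and> (b, k) \<in> R \<inter> J \<times> J" using up ab by blast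
    qed
    then show "direct_system K J (R \<inter> J \<times> J) X x"
      using direct_limitD(1)[OF lim] J unfolding direct_system_def by blast
    show "is_cocone K J (R \<inter> J \<times> J) X x L l"
      using direct_limitD(2)[OF lim] J unfolding is_cocone_def by blast
  next
    fix u assume "u \<in> elems L"
    note u = elemsD[OF this]
    obtain j v where v: "j \<in> I" "v \<in> Ar K" "Dom K v = Dom K u" "Cod K v = X j" "l j \<cdot> v = u"
      using fp_factor[OF \<G>_fp I lim, of "Dom K u" u] u by auto
    obtain k where k: "k \<in> I" "(i, k) \<in> R" "(j, k) \<in> R" using directed_poset_bound[OF s(1) i v(1)] by blast
    have "l k \<cdot> x j k \<cdot> v = u" using reassoc[OF c(5)[OF k(3)], of v] v k c(2-4) s(3-5)[OF k(3)] by simp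
    then show "\<exists>i\<in>J. \<exists>v. v \<in> Ar K \<and> Dom K v = Dom K u \<and> Cod K v = X i \<and> l i \<cdot> v = u"
      using k v s(3-5)[OF k(3)] by (intro bexI[of _ k] exI[of _ "x j k \<cdot> v"]) (auto simp: J_def)
  next
    fix k u assume k: "k \<in> J" and u: "u \<in> elems (X k)" and 0: "l k \<cdot> u = zero_arr K (Dom K u) L"
    obtain j where "(k, j) \<in> R" "x k j \<cdot> u = zero_arr K (Dom K u) (X j)"
      using fp_kill[OF \<G>_fp I lim, of "Dom K u" k u] elemsD[OF u] k J 0 by auto
    then show "\<exists>j. (k, j) \<in> R \<inter> J \<times> J \<and> x k j \<cdot> u = zero_arr K (Dom K u) (X j)" using up[OF _ k] by blast
  qed
qed

section \<open>Small sets of representatives\<close>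

definition quot :: "'o \<Rightarrow> 'm set \<Rightarrow> 'm" where
  "quot M D = (SOME q. is_quotient K M D q)"

lemma quot:
  assumes "M \<in> Ob K" "D \<subseteq> elems M"
  shows "is_quotient K M D (quot M D)"
proof -
  have "\<exists>q. is_quotient K M D q"
    using assms elemsD by (intro ex_quotient small_subset[OF small_elems[OF assms(1)]]) blast+
  then show ?thesis unfolding quot_def by (rule someI_ex)
qed

text \<open>An arrow killing all elements of the kernel of \<open>e\<close> kills the kernel, as the generators generate; so it
  factors through \<open>e\<close>, the cokernel of its kernel.\<close>

lemma epic_is_quotient:
  assumes e: "epic K e" "Dom K e = M"
  shows "is_quotient K M {u \<in> elems M. e \<cdot> u = zero_arr K (Dom K u) (Cod K e)} e"
proof (rule is_quotientI[OF e])
  have e': "e \<in> Ar K" using e epic_arr by blast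
  obtain k where k: "is_kernel K e k" using obtain_kernel[OF e'] .
  note k' = kernel_arr[OF k]
  fix g assume g: "g \<in> Ar K" "Dom K g = M"
    "\<And>f. f \<in> {u \<in> elems M. e \<cdot> u = zero_arr K (Dom K u) (Cod K e)} \<Longrightarrow> g \<cdot> f = zero_arr K (Dom K f) (Cod K g)"
  have t: "g \<cdot> k \<in> Ar K" "Dom K (g \<cdot> k) = Dom K k" "Cod K (g \<cdot> k) = Cod K g" using g k' e by simp_all
  have "g \<cdot> k = zero_arr K (Dom K k) (Cod K g)"
  proof (rule elems_zero[OF t(1), unfolded t(2,3)])
    fix u assume u: "u \<in> elems (Dom K k)"
    note u' = elemsD[OF u]
    have "e \<cdot> k \<cdot> u = zero_arr K (Dom K u) (Cod K e)" using reassoc[OF k'(4), of u] u' k' by simp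
    then have "g \<cdot> k \<cdot> u = zero_arr K (Dom K (k \<cdot> u)) (Cod K g)"
      using g(3)[of "k \<cdot> u"] u' k' e by (simp add: elemsI)
    then show "(g \<cdot> k) \<cdot> u = zero_arr K (Dom K u) (Cod K g)" using u' k' g e by simp
  qed
  then show "\<exists>h. h \<in> Ar K \<and> Dom K h = Cod K e \<and> Cod K h = Cod K g \<and> h \<cdot> e = g"
    using cokernel_factor[OF epic_cokernel_of_kernel[OF e(1) k], of g] g k' e by simp
qed (auto dest: elemsD)

text \<open>Up to isomorphism, a quotient of \<open>C\<close> is determined by the set of elements of \<open>C\<close> that it kills.\<close>

lemma small_quotient_reps:
  assumes C: "C \<in> Ob K"
  shows "\<exists>T. small \<kappa> T \<and> T \<subseteq> Ob K \<and> (\<forall>e. epic K e \<and> Dom K e = C \<longrightarrow> (\<exists>t\<in>T. isomorphic K (Cod K e) t))"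
proof -
  define T where "T = (\<lambda>D. Cod K (quot C D)) ` Pow (elems C)"
  have "small \<kappa> T" unfolding T_def
    by (intro small_image small_Pow[OF inaccessible] small_elems C)
  moreover have "T \<subseteq> Ob K" using quotientD(1)[OF quot[OF C]] by (auto simp: T_def)
  moreover have "\<exists>t\<in>T. isomorphic K (Cod K e) t" if e: "epic K e" "Dom K e = C" for e
  proof -
    define D where "D = {u \<in> elems C. e \<cdot> u = zero_arr K (Dom K u) (Cod K e)}"
    have D: "D \<subseteq> elems C" by (auto simp: D_def)
    obtain \<theta> where \<theta>: "iso_arr K \<theta>" "Dom K \<theta> = Cod K e" "Cod K \<theta> = Cod K (quot C D)"
      using quotient_iso[OF epic_is_quotient[OF e, folded D_def] quot[OF C D]] by blast
    then have "isomorphic K (Cod K e) (Cod K (quot C D))" using iso_arr_isomorphic[OF \<theta>(1)] by simp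
    then show ?thesis using D by (auto simp: T_def)
  qed
  ultimately show ?thesis by blast
qed

text \<open>\<open>P\<close> is generated by a family of maps from objects in \<open>A\<close>, indexed by a subset of \<open>B\<close>; the set \<open>B\<close>
  bounds the number of maps.\<close>

definition generated_by :: "'b set \<Rightarrow> 'o set \<Rightarrow> 'o \<Rightarrow> bool" where
  "generated_by B A P \<longleftrightarrow> P \<in> Ob K \<and> (\<exists>J e. J \<subseteq> B \<and>
    (\<forall>b\<in>J. e b \<in> Ar K \<and> Dom K (e b) \<in> A \<and> Cod K (e b) = P) \<and>
    (\<forall>f\<in>Ar K. Dom K f = P \<and> (\<forall>b\<in>J. f \<cdot> e b = zero_arr K (Dom K (e b)) (Cod K f)) \<longrightarrow> f = zero_arr K P (Cod K f)))"

text \<open>The objects generated by at most \<open>|B|\<close> maps from objects in \<open>A\<close> are quotients of the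
  coproduct of \<open>|B|\<close> copies of each object in \<open>A\<close>.\<close>

lemma small_generated_reps:
  fixes B :: "'b set"
  assumes A: "small \<kappa> A" "A \<subseteq> Ob K" and B: "small \<kappa> B"
  shows "\<exists>T. small \<kappa> T \<and> T \<subseteq> Ob K \<and> (\<forall>P. generated_by B A P \<longrightarrow> (\<exists>t\<in>T. isomorphic K P t))"
proof -
  obtain C \<iota> where c: "is_coproduct K (B \<times> A) snd C \<iota>"
    using ex_coproduct[OF small_Times[OF inaccessible B A(1)], of snd] A(2) by fastforce
  note c' = coproduct_arr[OF c]
  have C: "C \<in> Ob K" using c by (simp add: is_coproduct_def)
  obtain T where T: "small \<kappa> T" "T \<subseteq> Ob K" "\<And>e. epic K e \<Longrightarrow> Dom K e = C \<Longrightarrow> \<exists>t\<in>T. isomorphic K (Cod K e) t"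
    using small_quotient_reps[OF C] by blast
  have "\<exists>t\<in>T. isomorphic K P t" if gen: "generated_by B A P" for P
  proof -
    obtain J e where P: "P \<in> Ob K" and J: "J \<subseteq> B"
      and e: "\<forall>b\<in>J. e b \<in> Ar K \<and> Dom K (e b) \<in> A \<and> Cod K (e b) = P"
      and ep: "\<forall>f\<in>Ar K. Dom K f = P \<and> (\<forall>b\<in>J. f \<cdot> e b = zero_arr K (Dom K (e b)) (Cod K f)) \<longrightarrow> f = zero_arr K P (Cod K f)"
      using gen unfolding generated_by_def by (elim conjE exE)
    define t where "t = (\<lambda>(b, a). if b \<in> J \<and> Dom K (e b) = a then e b else zero_arr K a P)"
    have "t ba \<in> Hom K (snd ba) P" if "ba \<in> B \<times> A" for ba
      using that e P A(2) by (auto simp: t_def split: prod.splits)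
    then obtain h where h: "h \<in> Ar K" "Dom K h = C" "Cod K h = P" "\<And>ba. ba \<in> B \<times> A \<Longrightarrow> h \<cdot> \<iota> ba = t ba"
      using coproduct_hom[OF c P, of t] by blast
    have "epic K h"
    proof (rule epicI[OF h(1)])
      fix f assume f: "f \<in> Ar K" "Dom K f = Cod K h" "f \<cdot> h = zero_arr K (Dom K h) (Cod K f)"
      have "f \<cdot> e b = zero_arr K (Dom K (e b)) (Cod K f)" if b: "b \<in> J" for b
      proof -
        have m: "(b, Dom K (e b)) \<in> B \<times> A" using b J e by auto
        have "h \<cdot> \<iota> (b, Dom K (e b)) = e b" using h(4)[OF m] b by (simp add: t_def)
        then show ?thesis using reassoc[OF f(3), of "\<iota> (b, Dom K (e b))"] f(1,2) h(1-3) c'[OF m] by simp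
      qed
      then show "f = zero_arr K (Cod K h) (Cod K f)" using ep f h by auto
    qed
    then show ?thesis using T(3)[of h] h by simp
  qed
  then show ?thesis using T(1,2) by blast
qed

text \<open>The quotients of \<open>S\<close> by finitely many elements form a direct system with limit \<open>0\<close>. Since the
  projection from \<open>S\<close> vanishes in the limit, it vanishes at some stage.\<close>

lemma fp_finitely_generated:
  assumes S: "fp \<kappa> K S"
  shows "\<exists>U. finite U \<and> U \<subseteq> elems S \<and>
    (\<forall>f\<in>Ar K. Dom K f = S \<and> (\<forall>u\<in>U. f \<cdot> u = zero_arr K (Dom K u) (Cod K f)) \<longrightarrow> f = zero_arr K S (Cod K f))"
proof -
  note SO = fp_Ob[OF S]
  define I where "I = {U. finite U \<and> U \<subseteq> elems S}"
  define R where "R = {(U, V). U \<in> I \<and> V \<in> I \<and> U \<subseteq> V}"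
  have I: "small \<kappa> I"
    by (rule small_subset[OF small_Pow[OF inaccessible small_elems[OF SO]]]) (auto simp: I_def)
  have dir: "directed_poset I R"
    unfolding directed_poset_def partial_order_on_def preorder_on_def
  proof (intro conjI ballI)
    show "R \<subseteq> I \<times> I" "refl_on I R" "trans R" "antisym R"
      by (auto simp: R_def refl_on_def trans_def antisym_def)
    show "I \<noteq> {}" by (auto simp: I_def)
    fix U V assume "U \<in> I" "V \<in> I"
    then show "\<exists>W\<in>I. (U, W) \<in> R \<and> (V, W) \<in> R" by (intro bexI[of _ "U \<union> V"]) (auto simp: R_def I_def)
  qed
  have q: "is_quotient K S U (quot S U)" if "U \<in> I" for U using that quot[OF SO] by (simp add: I_def)
  have UI: "(\<Union>U\<in>I. U) = elems S" by (auto simp: I_def)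
  obtain Z where Z: "zero_object K Z" using ex_zero_object by blast
  have ZO: "Z \<in> Ob K" using Z by (simp add: zero_object_iff)
  have z: "is_quotient K S (\<Union>U\<in>I. U) (zero_arr K S Z)"
    unfolding UI
  proof (rule is_quotientI)
    show "epic K (zero_arr K S Z)"
      by (rule epicI) (use zero_object_from[OF Z] SO ZO in simp_all)
    fix g assume g: "g \<in> Ar K" "Dom K g = S" "\<And>f. f \<in> elems S \<Longrightarrow> g \<cdot> f = zero_arr K (Dom K f) (Cod K g)"
    have "g = zero_arr K S (Cod K g)" using elems_zero[OF g(1)] g by simp
    then show "\<exists>h. h \<in> Ar K \<and> Dom K h = Cod K (zero_arr K S Z) \<and> Cod K h = Cod K g \<and> h \<cdot> zero_arr K S Z = g"
      using g(1) SO ZO by (intro exI[of _ "zero_arr K Z (Cod K g)"]) simp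
  qed (use SO ZO elemsD in auto)
  obtain x l where lim: "is_direct_limit K I R (\<lambda>U. Cod K (quot S U)) x (Cod K (zero_arr K S Z)) l"
    and l: "\<And>U. U \<in> I \<Longrightarrow> l U \<cdot> quot S U = zero_arr K S Z" and x: "\<And>U V. (U, V) \<in> R \<Longrightarrow> x U V \<cdot> quot S U = quot S V"
    using direct_limit_of_quotients[OF dir _ q z] by (force simp: R_def)
  have e: "{} \<in> I" by (simp add: I_def)
  note q0 = quotientD[OF q[OF e]]
  obtain U where U: "U \<in> I" "({}, U) \<in> R" "x {} U \<cdot> quot S {} = zero_arr K S (Cod K (quot S U))"
    using fp_kill[OF S I lim e, of "quot S {}"] q0 l[OF e] SO ZO by auto
  then have q0: "quot S U = zero_arr K S (Cod K (quot S U))" using x by simp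
  have "f = zero_arr K S (Cod K f)" if f: "f \<in> Ar K" "Dom K f = S" "\<forall>u\<in>U. f \<cdot> u = zero_arr K (Dom K u) (Cod K f)" for f
  proof -
    obtain h where h: "h \<in> Ar K" "Dom K h = Cod K (quot S U)" "Cod K h = Cod K f" "h \<cdot> quot S U = f"
      using quotient_factor[OF q[OF U(1)], of f] f by auto
    have "f = h \<cdot> zero_arr K S (Cod K (quot S U))" using h(4) q0 by simp
    then show ?thesis using h SO by simp
  qed
  then show ?thesis using U(1) by (auto simp: I_def)
qed

lemma small_fp_reps: "\<exists>T. small \<kappa> T \<and> (\<forall>S. fp \<kappa> K S \<longrightarrow> (\<exists>t\<in>T. isomorphic K S t))"
proof -
  have "\<G> \<subseteq> Ob K" using \<G>_Ob by blast
  then obtain T where T: "small \<kappa> T" "\<forall>P. generated_by (UNIV :: nat set) \<G> P \<longrightarrow> (\<exists>t\<in>T. isomorphic K P t)"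
    using small_generated_reps[OF small_\<G> _ small_countable[OF inaccessible, of UNIV]] by blast
  have "\<exists>t\<in>T. isomorphic K S t" if S: "fp \<kappa> K S" for S
  proof -
    obtain U where U: "finite U" "U \<subseteq> elems S"
      "\<forall>f\<in>Ar K. Dom K f = S \<and> (\<forall>u\<in>U. f \<cdot> u = zero_arr K (Dom K u) (Cod K f)) \<longrightarrow> f = zero_arr K S (Cod K f)"
      using fp_finitely_generated[OF S] by blast
    obtain e n where e: "U = e ` {i :: nat. i < n}"
      using finite_imp_nat_seg_image_inj_on[OF U(1)] by blast
    have "generated_by (UNIV :: nat set) \<G> S"
      unfolding generated_by_def
      by (intro conjI exI[of _ "{i. i < n}"] exI[of _ e]) (use fp_Ob[OF S] U(2,3) elemsD e in auto)
    then show ?thesis using T(2) by blast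
  qed
  then show ?thesis using T(1) by blast
qed

section \<open>Direct limits of a class of finitely presentable objects\<close>

text \<open>If \<open>E\<close> is the cokernel of the map \<open>a\<close> between finitely presentable objects, then a map \<open>E \<rightarrow> N\<close> is the same
  as a map \<open>f\<close> to \<open>N\<close> that kills \<open>a\<close>. So the condition is that each map \<open>E \<rightarrow> N\<close> factors through an object in
  \<open>S\<close>; in this form it does not mention \<open>E\<close>.\<close>

definition approximable :: "'o set \<Rightarrow> 'o \<Rightarrow> bool" where
  "approximable S N \<longleftrightarrow> N \<in> Ob K \<and>
    (\<forall>a f. a \<in> Ar K \<and> f \<in> Ar K \<and> Cod K a = Dom K f \<and> Cod K f = N \<and> fp \<kappa> K (Dom K a) \<and> fp \<kappa> K (Dom K f) \<and>
       f \<cdot> a = zero_arr K (Dom K a) N \<longrightarrow>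
       (\<exists>s g. s \<in> Ar K \<and> g \<in> Ar K \<and> Dom K s = Dom K f \<and> Cod K s = Dom K g \<and> Cod K g = N \<and> Cod K s \<in> S \<and>
          g \<cdot> s = f \<and> s \<cdot> a = zero_arr K (Dom K a) (Cod K s)))"

lemma approximableD:
  assumes "approximable S N" "a \<in> Ar K" "f \<in> Ar K" "Cod K a = Dom K f" "Cod K f = N" "fp \<kappa> K (Dom K a)"
    "fp \<kappa> K (Dom K f)" "f \<cdot> a = zero_arr K (Dom K a) N"
  shows "\<exists>s g. s \<in> Ar K \<and> g \<in> Ar K \<and> Dom K s = Dom K f \<and> Cod K s = Dom K g \<and> Cod K g = N \<and> Dom K g \<in> S \<and>
          g \<cdot> s = f \<and> s \<cdot> a = zero_arr K (Dom K a) (Dom K g)"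
  using assms unfolding approximable_def by metis

lemma approximable_Ob: "approximable S N \<Longrightarrow> N \<in> Ob K"
  by (simp add: approximable_def)

lemma approximableI:
  assumes "N \<in> Ob K" "\<And>a f. a \<in> Ar K \<Longrightarrow> f \<in> Ar K \<Longrightarrow> Cod K a = Dom K f \<Longrightarrow> Cod K f = N \<Longrightarrow> fp \<kappa> K (Dom K a) \<Longrightarrow>
    fp \<kappa> K (Dom K f) \<Longrightarrow> f \<cdot> a = zero_arr K (Dom K a) N \<Longrightarrow>
    \<exists>s g. s \<in> Ar K \<and> g \<in> Ar K \<and> Dom K s = Dom K f \<and> Cod K s = Dom K g \<and> Cod K g = N \<and> Dom K g \<in> S \<and>
          g \<cdot> s = f \<and> s \<cdot> a = zero_arr K (Dom K a) (Dom K g)"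
  shows "approximable S N"
  unfolding approximable_def
proof (intro conjI allI impI assms(1))
  fix a f assume "a \<in> Ar K \<and> f \<in> Ar K \<and> Cod K a = Dom K f \<and> Cod K f = N \<and> fp \<kappa> K (Dom K a) \<and> fp \<kappa> K (Dom K f) \<and>
       f \<cdot> a = zero_arr K (Dom K a) N"
  then have "\<exists>s g. s \<in> Ar K \<and> g \<in> Ar K \<and> Dom K s = Dom K f \<and> Cod K s = Dom K g \<and> Cod K g = N \<and> Dom K g \<in> S \<and>
          g \<cdot> s = f \<and> s \<cdot> a = zero_arr K (Dom K a) (Dom K g)"
    using assms(2) by blast
  then show "\<exists>s g. s \<in> Ar K \<and> g \<in> Ar K \<and> Dom K s = Dom K f \<and> Cod K s = Dom K g \<and> Cod K g = N \<and> Cod K s \<in> S \<and>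
          g \<cdot> s = f \<and> s \<cdot> a = zero_arr K (Dom K a) (Cod K s)" by metis
qed

text \<open>The map \<open>f\<close> comes from some stage, and there it kills \<open>a\<close> after passing to a later stage.\<close>

lemma fp_factor_kill:
  fixes I :: "'i set"
  assumes I: "small \<kappa> I" and lim: "is_direct_limit K I R X x N l"
    and a: "a \<in> Ar K" "Cod K a = Dom K f" "fp \<kappa> K (Dom K a)" and f: "f \<in> Ar K" "Cod K f = N" "fp \<kappa> K (Dom K f)"
    and 0: "f \<cdot> a = zero_arr K (Dom K a) N"
  shows "\<exists>i\<in>I. \<exists>s. s \<in> Ar K \<and> Dom K s = Dom K f \<and> Cod K s = X i \<and> l i \<cdot> s = f \<and> s \<cdot> a = zero_arr K (Dom K a) (X i)"
proof -
  note s = direct_systemD[OF direct_limitD(1)[OF lim]] and c = coconeD[OF direct_limitD(2)[OF lim]]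
  note F = directed_poset_Field[OF s(1)]
  obtain i g where i: "i \<in> I" and g: "g \<in> Ar K" "Dom K g = Dom K f" "Cod K g = X i" "l i \<cdot> g = f"
    using fp_factor[OF f(3) I lim f(1) refl f(2)] by blast
  have "l i \<cdot> g \<cdot> a = zero_arr K (Dom K a) N" using reassoc[OF g(4), of a] g(1-3) a 0 c(2-4)[OF i] by simp
  then obtain j where j: "j \<in> I" "(i, j) \<in> R" "x i j \<cdot> g \<cdot> a = zero_arr K (Dom K a) (X j)"
    using fp_kill[OF a(3) I lim i, of "g \<cdot> a"] g a by auto
  have "l j \<cdot> x i j \<cdot> g = f" using reassoc[OF c(5)[OF j(2)], of g] g s(3-5)[OF j(2)] c(2-4)[OF j(1)] by simp
  then show ?thesis using j g a s(3-5)[OF j(2)] by (intro bexI[of _ j] exI[of _ "x i j \<cdot> g"]) simp_all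
qed

lemma direct_limit_approximable:
  fixes I :: "'i set"
  assumes I: "small \<kappa> I" and lim: "is_direct_limit K I R X x N l" and S: "\<And>i. i \<in> I \<Longrightarrow> approximable S (X i)"
  shows "approximable S N"
proof (rule approximableI)
  note c = coconeD[OF direct_limitD(2)[OF lim]]
  show "N \<in> Ob K" by (rule c(1))
  fix a f assume a: "a \<in> Ar K" and f: "f \<in> Ar K" "Cod K a = Dom K f" "Cod K f = N" "fp \<kappa> K (Dom K a)" "fp \<kappa> K (Dom K f)"
    "f \<cdot> a = zero_arr K (Dom K a) N"
  obtain i s where i: "i \<in> I" and s: "s \<in> Ar K" "Dom K s = Dom K f" "Cod K s = X i" "l i \<cdot> s = f"
    "s \<cdot> a = zero_arr K (Dom K a) (X i)"
    using fp_factor_kill[OF I lim a f(2,4,1,3,5,6)] by blast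
  obtain s' g where g: "s' \<in> Ar K" "g \<in> Ar K" "Dom K s' = Dom K s" "Cod K s' = Dom K g" "Cod K g = X i" "Dom K g \<in> S"
    "g \<cdot> s' = s" "s' \<cdot> a = zero_arr K (Dom K a) (Dom K g)"
    using approximableD[OF S[OF i] a s(1)] s f by auto
  show "\<exists>s g. s \<in> Ar K \<and> g \<in> Ar K \<and> Dom K s = Dom K f \<and> Cod K s = Dom K g \<and> Cod K g = N \<and> Dom K g \<in> S \<and>
          g \<cdot> s = f \<and> s \<cdot> a = zero_arr K (Dom K a) (Dom K g)"
    by (rule exI[of _ s'], rule exI[of _ "l i \<cdot> g"]) (use g s c(2-4)[OF i] in simp)
qed

lemma approximable_self: "X \<in> S \<Longrightarrow> X \<in> Ob K \<Longrightarrow> approximable S X"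
proof (rule approximableI, assumption)
  fix a f assume "X \<in> S" "X \<in> Ob K" "a \<in> Ar K" "f \<in> Ar K" "Cod K a = Dom K f" "Cod K f = X" "f \<cdot> a = zero_arr K (Dom K a) X"
  then show "\<exists>s g. s \<in> Ar K \<and> g \<in> Ar K \<and> Dom K s = Dom K f \<and> Cod K s = Dom K g \<and> Cod K g = X \<and> Dom K g \<in> S \<and>
          g \<cdot> s = f \<and> s \<cdot> a = zero_arr K (Dom K a) (Dom K g)"
    by (intro exI[of _ f] exI[of _ "ident K X"]) simp
qed

text \<open>The maps from objects in \<open>S\<close> to an approximable object \<open>N\<close> form a filtered category. Cocones
  over finite diagrams are found by merging two maps to \<open>N\<close> into one and then coequalising finitely
  many pairs of parallel arrows, one at a time.\<close>

lemma approximable_merge: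
  assumes N: "approximable S N" and fpS: "\<And>A. A \<in> S \<Longrightarrow> fp \<kappa> K A"
    and sums: "\<And>A B. A \<in> S \<Longrightarrow> B \<in> S \<Longrightarrow> \<exists>P\<in>S. \<exists>i1 i2 p1 p2. biproduct K A B P i1 i2 p1 p2"
    and f: "f1 \<in> Ar K" "Dom K f1 \<in> S" "Cod K f1 = N" "f2 \<in> Ar K" "Dom K f2 \<in> S" "Cod K f2 = N"
    and V: "finite V" "\<And>v. v \<in> V \<Longrightarrow> h1 v \<in> Ar K \<and> h2 v \<in> Ar K \<and> Cod K (h1 v) = Dom K f1 \<and> Cod K (h2 v) = Dom K f2 \<and>
      Dom K (h1 v) = Dom K (h2 v) \<and> Dom K (h1 v) \<in> S \<and> f1 \<cdot> h1 v = f2 \<cdot> h2 v"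
  shows "\<exists>g u1 u2. g \<in> Ar K \<and> u1 \<in> Ar K \<and> u2 \<in> Ar K \<and> Dom K g \<in> S \<and> Cod K g = N \<and> Cod K u1 = Dom K g \<and>
    Cod K u2 = Dom K g \<and> Dom K u1 = Dom K f1 \<and> Dom K u2 = Dom K f2 \<and> g \<cdot> u1 = f1 \<and> g \<cdot> u2 = f2 \<and>
    (\<forall>v\<in>V. u1 \<cdot> h1 v = u2 \<cdot> h2 v)"
  using V
proof (induction V rule: finite_induct)
  case empty
  obtain P i1 i2 p1 p2 where P: "P \<in> S" and b: "biproduct K (Dom K f1) (Dom K f2) P i1 i2 p1 p2"
    using sums[OF f(2,5)] by blast
  note b = biproduct_arr[OF b arr_Ob(1)[OF f(1)] arr_Ob(1)[OF f(4)]]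
  show ?case
    by (rule exI[of _ "f1 \<cdot> p1 \<boxplus> f2 \<cdot> p2"], rule exI[of _ i1], rule exI[of _ i2]) (use b f P arr_Ob in simp)
next
  case (insert v V)
  then obtain g u1 u2 where g: "g \<in> Ar K" "u1 \<in> Ar K" "u2 \<in> Ar K" "Dom K g \<in> S" "Cod K g = N" "Cod K u1 = Dom K g"
    "Cod K u2 = Dom K g" "Dom K u1 = Dom K f1" "Dom K u2 = Dom K f2" "g \<cdot> u1 = f1" "g \<cdot> u2 = f2"
    "\<forall>v\<in>V. u1 \<cdot> h1 v = u2 \<cdot> h2 v" by blast
  have h: "h1 v \<in> Ar K" "h2 v \<in> Ar K" "Cod K (h1 v) = Dom K f1" "Cod K (h2 v) = Dom K f2"
      "Dom K (h1 v) = Dom K (h2 v)" "Dom K (h1 v) \<in> S" "f1 \<cdot> h1 v = f2 \<cdot> h2 v"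
    using insert.prems[OF insertI1] by blast+
  define a where "a = u1 \<cdot> h1 v \<boxminus> u2 \<cdot> h2 v"
  have a: "a \<in> Ar K" "Dom K a = Dom K (h2 v)" "Cod K a = Dom K g" using h g by (simp_all add: a_def)
  have "g \<cdot> a = zero_arr K (Dom K a) N"
    using h g a reassoc[OF g(10), of "h1 v"] reassoc[OF g(11), of "h2 v"] f by (simp add: a_def)
  then obtain s g' where s: "s \<in> Ar K" "g' \<in> Ar K" "Dom K s = Dom K g" "Cod K s = Dom K g'" "Cod K g' = N" "Dom K g' \<in> S"
    "g' \<cdot> s = g" "s \<cdot> a = zero_arr K (Dom K a) (Dom K g')"
    using approximableD[OF N a(1) g(1) a(3) g(5)] fpS g(4) h(5,6) a(2) by metis
  have "s \<cdot> u1 \<cdot> h1 v = s \<cdot> u2 \<cdot> h2 v" using s h g a by (simp add: a_def)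
  moreover have "s \<cdot> u1 \<cdot> h1 w = s \<cdot> u2 \<cdot> h2 w" if "w \<in> V" for w using g(12) that by simp
  ultimately have "\<forall>w\<in>insert v V. (s \<cdot> u1) \<cdot> h1 w = (s \<cdot> u2) \<cdot> h2 w"
    using s g insert.prems by simp
  then show ?case
    using reassoc[OF s(7), of u1] reassoc[OF s(7), of u2] s g
    by (intro exI[of _ g'] exI[of _ "s \<cdot> u1"] exI[of _ "s \<cdot> u2"]) simp
qed

text \<open>A filtered category is replaced by a directed poset as follows. A vertex is a map from an object
  in \<open>S\<close> to \<open>N\<close>, tagged with a natural number. An element \<open>(w, \<iota>)\<close> of the poset is a finite set
  \<open>dom \<iota>\<close> of vertices together with arrows \<open>\<iota> v\<close> over \<open>N\<close> from each of them to the top vertex \<open>w\<close>. A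
  larger element contains strictly more vertices and its arrows restrict to the given ones through the
  transition arrow \<open>\<iota>' w\<close>. The tags ensure that there is always a fresh vertex, so that any cocone
  yields a strictly larger element.\<close>

lemma approximable_is_direct_limit:
  assumes N: "approximable S N" and fpS: "\<And>A. A \<in> S \<Longrightarrow> fp \<kappa> K A" and S: "small \<kappa> S" "S \<noteq> {}"
    and sums: "\<And>A B. A \<in> S \<Longrightarrow> B \<in> S \<Longrightarrow> \<exists>P\<in>S. \<exists>i1 i2 p1 p2. biproduct K A B P i1 i2 p1 p2"
  shows "\<exists>(I :: (('m \<times> nat) \<times> ('m \<times> nat \<Rightarrow> 'm option)) set) R X x n.
    small \<kappa> I \<and> (\<forall>i\<in>I. X i \<in> S) \<and> is_direct_limit K I R X x N n"
proof -
  have NO: "N \<in> Ob K" by (rule approximable_Ob[OF N])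
  have SO: "A \<in> Ob K" if "A \<in> S" for A by (rule fp_Ob[OF fpS[OF that]])
  \<comment> \<open>The vertices are the elements of \<open>F \<times> UNIV\<close>; \<open>n p\<close> is the map to \<open>N\<close> from the object \<open>X p\<close> at the top
    vertex of \<open>p\<close>.\<close>
  define F where "F = (\<Union>A\<in>S. Hom K A N)"
  have F: "f \<in> F \<longleftrightarrow> f \<in> Ar K \<and> Dom K f \<in> S \<and> Cod K f = N" for f by (auto simp: F_def)
  have sF: "small \<kappa> F" unfolding F_def
    using small_Hom SO NO by (intro small_UN[OF inaccessible S(1)]) (simp add: locally_small_def del: Hom_iff)
  define H where "H = (\<Union>(A, B)\<in>S \<times> S. Hom K A B)"
  have sH: "small \<kappa> H" unfolding H_def
    using small_Hom SO by (intro small_UN[OF inaccessible small_Times[OF inaccessible S(1) S(1)]])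
      (auto simp add: locally_small_def simp del: Hom_iff)
  define n where "n p = fst (fst p)" for p :: "('m \<times> nat) \<times> ('m \<times> nat \<Rightarrow> 'm option)"
  define X where "X p = Dom K (n p)" for p
  define I where "I = {p. n p \<in> F \<and> finite (dom (snd p)) \<and> snd p (fst p) = Some (ident K (X p)) \<and>
    (\<forall>v h. snd p v = Some h \<longrightarrow> fst v \<in> F \<and> h \<in> Hom K (Dom K (fst v)) (X p) \<and> n p \<cdot> h = fst v)}"
  define R where "R = {(p, q). p \<in> I \<and> q \<in> I \<and> (p = q \<or> dom (snd p) \<subset> dom (snd q) \<and>
    (\<forall>v h. snd p v = Some h \<longrightarrow> (\<exists>k. snd q (fst p) = Some k \<and> snd q v = Some (k \<cdot> h))))}"
  define x where "x p q = the (snd q (fst p))" for p q :: "('m \<times> nat) \<times> ('m \<times> nat \<Rightarrow> 'm option)"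
  have ID: "n p \<in> Ar K" "X p \<in> S" "Cod K (n p) = N" "finite (dom (snd p))" "snd p (fst p) = Some (ident K (X p))"
    if "p \<in> I" for p using that by (simp_all add: I_def F X_def)
  have IV: "fst v \<in> Ar K" "Dom K (fst v) \<in> S" "Cod K (fst v) = N" "h \<in> Ar K" "Dom K h = Dom K (fst v)"
    "Cod K h = X p" "n p \<cdot> h = fst v" if "p \<in> I" "snd p v = Some h" for p v h
  proof -
    have "fst v \<in> F \<and> h \<in> Hom K (Dom K (fst v)) (X p) \<and> n p \<cdot> h = fst v" using that unfolding I_def by blast
    then show "fst v \<in> Ar K" "Dom K (fst v) \<in> S" "Cod K (fst v) = N" "h \<in> Ar K" "Dom K h = Dom K (fst v)"
      "Cod K h = X p" "n p \<cdot> h = fst v" by (simp_all add: F)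
  qed
  have sI: "small \<kappa> I"
  proof (rule small_inj)
    show "small \<kappa> ((F \<times> (UNIV :: nat set)) \<times> Pow ((F \<times> (UNIV :: nat set)) \<times> H))"
      by (intro small_Times small_Pow inaccessible sF sH small_countable)
    show "inj_on (\<lambda>p. (fst p, {(v, h). snd p v = Some h})) I"
    proof (rule inj_onI)
      fix p q assume "(fst p, {(v, h). snd p v = Some h}) = (fst q, {(v, h). snd q v = Some h})"
      then have "fst p = fst q" and *: "snd p v = Some h \<longleftrightarrow> snd q v = Some h" for v h by auto
      moreover have "snd p v = snd q v" for v using * by (metis not_Some_eq)
      ultimately show "p = q" by (simp add: prod_eq_iff fun_eq_iff)
    qed
    show "(\<lambda>p. (fst p, {(v, h). snd p v = Some h})) ` I \<subseteq> (F \<times> UNIV) \<times> Pow ((F \<times> UNIV) \<times> H)"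
    proof (rule image_subsetI)
      fix p assume p: "p \<in> I"
      have "(v, h) \<in> (F \<times> UNIV) \<times> H" if "snd p v = Some h" for v h
        using IV[OF p that] ID(2)[OF p] F[of "fst v"] by (auto simp: H_def mem_Times_iff)
      then have "{(v, h). snd p v = Some h} \<subseteq> (F \<times> UNIV) \<times> H" by blast
      moreover have "fst p \<in> F \<times> UNIV" using p by (simp add: I_def n_def mem_Times_iff)
      ultimately show "(fst p, {(v, h). snd p v = Some h}) \<in> (F \<times> UNIV) \<times> Pow ((F \<times> UNIV) \<times> H)"
        by simp
    qed
  qed
  have RI: "p \<in> I" "q \<in> I" if "(p, q) \<in> R" for p q using that by (auto simp: R_def)
  have Rsub: "dom (snd p) \<subset> dom (snd q)" if "(p, q) \<in> R" "p \<noteq> q" for p q using that by (auto simp: R_def)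
  have Rx: "snd q (fst p) = Some (x p q)" if "(p, q) \<in> R" for p q
  proof (cases "p = q")
    case True then show ?thesis using ID(5)[OF RI(1)[OF that]] by (simp add: x_def)
  next
    case False then show ?thesis using that ID(5)[OF RI(1)[OF that]] by (force simp: R_def x_def)
  qed
  have x: "x p q \<in> Ar K" "Dom K (x p q) = X p" "Cod K (x p q) = X q" "n q \<cdot> x p q = n p" if "(p, q) \<in> R" for p q
    using IV[OF RI(2)[OF that] Rx[OF that]] by (simp_all add: n_def X_def)
  have Rv: "snd q v = Some (x p q \<cdot> h)" if "(p, q) \<in> R" "snd p v = Some h" for p q v h
  proof (cases "p = q")
    case True
    then have "x p q = ident K (X p)" using ID(5)[OF RI(1)[OF that(1)]] by (simp add: x_def)
    then show ?thesis using True that IV[OF RI(1)[OF that(1)] that(2)] by simp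
  next
    case False
    then have "\<exists>k. snd q (fst p) = Some k \<and> snd q v = Some (k \<cdot> h)" using that unfolding R_def by blast
    then show ?thesis by (auto simp: x_def)
  qed
  have Rintro: "(p, q) \<in> R" if "p \<in> I" "q \<in> I" "dom (snd p) \<subset> dom (snd q)" "snd q (fst p) = Some k"
    "\<And>v h. snd p v = Some h \<Longrightarrow> snd q v = Some (k \<cdot> h)" for p q k
    using that by (auto simp: R_def)
  have Rtrans: "(p, r) \<in> R" if "(p, q) \<in> R" "(q, r) \<in> R" for p q r
  proof (cases "p = q \<or> q = r")
    case False
    show ?thesis
    proof (rule Rintro)
      show "p \<in> I" "r \<in> I" using RI that by blast+
      show "dom (snd p) \<subset> dom (snd r)" using Rsub[OF that(1)] Rsub[OF that(2)] False by blast
      show "snd r (fst p) = Some (x q r \<cdot> x p q)" by (rule Rv[OF that(2) Rx[OF that(1)]])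
      fix v h assume v: "snd p v = Some h"
      show "snd r v = Some ((x q r \<cdot> x p q) \<cdot> h)"
        using Rv[OF that(2) Rv[OF that(1) v]] x[OF that(1)] x[OF that(2)] IV[OF RI(1)[OF that(1)] v] by simp
    qed
  qed (use that in auto)
  have xcomp: "x q r \<cdot> x p q = x p r" if "(p, q) \<in> R" "(q, r) \<in> R" for p q r
    using Rv[OF that(2) Rx[OF that(1)]] Rx[OF Rtrans[OF that]] by simp
  \<comment> \<open>Two elements of the poset have an upper bound with top object \<open>Dom K g\<close> if the arrows \<open>u1\<close> and \<open>u2\<close> agree
    on the vertices that they have in common.\<close>
  have step: "\<exists>r. (p, r) \<in> R \<and> (q, r) \<in> R \<and> x p r = u1 \<and> x q r = u2"
    if pq: "p \<in> I" "q \<in> I" and g: "g \<in> Ar K" "Dom K g \<in> S" "Cod K g = N"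
      and u: "u1 \<in> Ar K" "u2 \<in> Ar K" "Dom K u1 = X p" "Dom K u2 = X q" "Cod K u1 = Dom K g" "Cod K u2 = Dom K g"
        "g \<cdot> u1 = n p" "g \<cdot> u2 = n q"
      and co: "\<And>v h k. snd p v = Some h \<Longrightarrow> snd q v = Some k \<Longrightarrow> u1 \<cdot> h = u2 \<cdot> k" for p q g u1 u2
  proof -
    have "finite (dom (snd p) \<union> dom (snd q))" using ID(4) pq by simp
    then have "finite {k. (g, k) \<in> dom (snd p) \<union> dom (snd q)}"
      using finite_vimageI[of "dom (snd p) \<union> dom (snd q)" "Pair g"] by (simp add: inj_on_def vimage_def)
    then obtain k where k: "k \<notin> {k. (g, k) \<in> dom (snd p) \<union> dom (snd q)}"
      using ex_new_if_finite[OF infinite_UNIV_nat] by blast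
    define w where "w = (g, k)"
    have w: "fst w = g" "snd p w = None" "snd q w = None" using k by (auto simp: w_def)
    define \<iota> where "\<iota> v = (if v = w then Some (ident K (Dom K g)) else
      (case snd p v of Some h \<Rightarrow> Some (u1 \<cdot> h) | None \<Rightarrow> map_option (\<lambda>h. u2 \<cdot> h) (snd q v)))" for v
    have \<iota>p: "\<iota> v = Some (u1 \<cdot> h)" if "snd p v = Some h" for v h using that w by (auto simp: \<iota>_def)
    have \<iota>q: "\<iota> v = Some (u2 \<cdot> h)" if "snd q v = Some h" for v h
      using that w co by (auto simp: \<iota>_def split: option.splits)
    have \<iota>w: "\<iota> w = Some (ident K (Dom K g))" by (simp add: \<iota>_def)
    have d: "dom \<iota> = insert w (dom (snd p) \<union> dom (snd q))"
      by (auto simp: \<iota>_def split: option.splits if_splits)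
    have "(w, \<iota>) \<in> I"
      unfolding I_def
    proof (intro CollectI conjI allI impI)
      have nX: "n (w, \<iota>) = g" "X (w, \<iota>) = Dom K g" using w by (simp_all add: n_def X_def)
      show "n (w, \<iota>) \<in> F" using nX g F by simp
      show "finite (dom (snd (w, \<iota>)))" using ID(4) pq by (simp add: d)
      show "snd (w, \<iota>) (fst (w, \<iota>)) = Some (ident K (X (w, \<iota>)))" using \<iota>w nX by simp
      fix v h assume "snd (w, \<iota>) v = Some h"
      then have v: "\<iota> v = Some h" by simp
      then consider "v = w" "h = ident K (Dom K g)" | k where "snd p v = Some k" "h = u1 \<cdot> k"
        | k where "snd q v = Some k" "h = u2 \<cdot> k"
        by (auto simp: \<iota>_def split: if_splits option.splits)
      then have "fst v \<in> F \<and> h \<in> Hom K (Dom K (fst v)) (Dom K g) \<and> g \<cdot> h = fst v"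
      proof cases
        case 1 then show ?thesis using w g F by simp
      next
        case 2 then show ?thesis using IV[OF pq(1) 2(1)] u g(1) F reassoc[OF u(7), of k] by simp
      next
        case 3 then show ?thesis using IV[OF pq(2) 3(1)] u g(1) F reassoc[OF u(8), of k] by simp
      qed
      then show "fst v \<in> F" "h \<in> Hom K (Dom K (fst v)) (X (w, \<iota>))" "n (w, \<iota>) \<cdot> h = fst v"
        using nX by simp_all
    qed
    moreover have "dom (snd p) \<subset> dom \<iota>" "dom (snd q) \<subset> dom \<iota>" unfolding d using w by auto
    moreover have "\<iota> (fst p) = Some u1" "\<iota> (fst q) = Some u2"
      using \<iota>p[OF ID(5)[OF pq(1)]] \<iota>q[OF ID(5)[OF pq(2)]] u by simp_all
    ultimately have "(p, (w, \<iota>)) \<in> R" "(q, (w, \<iota>)) \<in> R"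
      using \<iota>p \<iota>q pq by (auto intro!: Rintro)
    then show ?thesis using \<open>\<iota> (fst p) = Some u1\<close> \<open>\<iota> (fst q) = Some u2\<close>
      by (intro exI[of _ "(w, \<iota>)"]) (simp add: x_def)
  qed
  have node: "((f, 0), [(f, 0) \<mapsto> ident K (Dom K f)]) \<in> I" if "f \<in> F" for f
    using that F by (auto simp: I_def n_def X_def split: if_splits)
  have dir: "directed_poset I R"
    unfolding directed_poset_def partial_order_on_def preorder_on_def
  proof (intro conjI ballI)
    show "R \<subseteq> I \<times> I" "refl_on I R" by (auto simp: R_def refl_on_def)
    show "trans R" by (rule transI) (rule Rtrans)
    show "antisym R" by (rule antisymI) (metis Rsub psubset_eq psubset_subset_trans)
    obtain A where A: "A \<in> S" using S(2) by blast
    then have "zero_arr K A N \<in> F" using F SO NO by simp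
    then show "I \<noteq> {}" using node by blast
    fix p q assume p: "p \<in> I" and q: "q \<in> I"
    define V where "V = dom (snd p) \<inter> dom (snd q)"
    have "finite V" using ID(4)[OF p] by (simp add: V_def)
    moreover have "the (snd p v) \<in> Ar K \<and> the (snd q v) \<in> Ar K \<and> Cod K (the (snd p v)) = Dom K (n p) \<and>
        Cod K (the (snd q v)) = Dom K (n q) \<and> Dom K (the (snd p v)) = Dom K (the (snd q v)) \<and>
        Dom K (the (snd p v)) \<in> S \<and> n p \<cdot> the (snd p v) = n q \<cdot> the (snd q v)" if "v \<in> V" for v
      using that IV[OF p, of v] IV[OF q, of v] by (auto simp: V_def X_def)
    ultimately obtain g u1 u2 where "g \<in> Ar K" "u1 \<in> Ar K" "u2 \<in> Ar K" "Dom K g \<in> S" "Cod K g = N" "Cod K u1 = Dom K g"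
      "Cod K u2 = Dom K g" "Dom K u1 = Dom K (n p)" "Dom K u2 = Dom K (n q)" "g \<cdot> u1 = n p" "g \<cdot> u2 = n q"
      and V: "\<forall>v\<in>V. u1 \<cdot> the (snd p v) = u2 \<cdot> the (snd q v)"
      using approximable_merge[OF N fpS sums ID(1)[OF p] ID(2)[OF p, unfolded X_def] ID(3)[OF p] ID(1)[OF q]
          ID(2)[OF q, unfolded X_def] ID(3)[OF q], of V "\<lambda>v. the (snd p v)" "\<lambda>v. the (snd q v)"] by blast
    moreover have "u1 \<cdot> h = u2 \<cdot> k" if "snd p v = Some h" "snd q v = Some k" for v h k
      using V[THEN bspec, of v] that by (auto simp: V_def)
    ultimately obtain r where "(p, r) \<in> R" "(q, r) \<in> R"
      using step[OF p q, of g u1 u2] by (auto simp: X_def)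
    then show "\<exists>r\<in>I. (p, r) \<in> R \<and> (q, r) \<in> R" using RI by blast
  qed
  have "is_direct_limit K I R X x N n"
  proof (rule direct_limit_by_elements[OF sI])
    show "direct_system K I R X x"
      unfolding direct_system_def
    proof (intro conjI allI impI ballI)
      fix p assume p: "p \<in> I"
      show "X p \<in> Ob K" using ID(2)[OF p] SO by simp
      show "x p p = ident K (X p)" using ID(5)[OF p] by (simp add: x_def)
    qed (use dir x xcomp in auto)
    show "is_cocone K I R X x N n"
      by (rule coconeI) (use NO ID x X_def in auto)
  next
    fix u assume "u \<in> elems N"
    note u = elemsD[OF this]
    have fpu: "fp \<kappa> K (Dom K u)" using u \<G>_fp by blast
    obtain s g where s: "s \<in> Ar K" "g \<in> Ar K" "Dom K s = Dom K u" "Cod K s = Dom K g" "Cod K g = N" "Dom K g \<in> S" "g \<cdot> s = u"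
      using approximableD[OF N, of "zero_arr K (Dom K u) (Dom K u)" u] u fpu by auto
    have "g \<in> F" using s F by simp
    from node[OF this] show "\<exists>i\<in>I. \<exists>v. v \<in> Ar K \<and> Dom K v = Dom K u \<and> Cod K v = X i \<and> n i \<cdot> v = u"
      by (rule bexI[rotated]) (use s in \<open>auto simp: n_def X_def\<close>)
  next
    fix p u assume p: "p \<in> I" and u: "u \<in> elems (X p)" and 0: "n p \<cdot> u = zero_arr K (Dom K u) N"
    note u' = elemsD[OF u]
    have fpu: "fp \<kappa> K (Dom K u)" using u' \<G>_fp by blast
    obtain s g where s: "s \<in> Ar K" "g \<in> Ar K" "Dom K s = X p" "Cod K s = Dom K g" "Cod K g = N" "Dom K g \<in> S" "g \<cdot> s = n p"
      "s \<cdot> u = zero_arr K (Dom K u) (Dom K g)"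
      using approximableD[OF N, of u "n p"] u' fpu fpS ID(1-3)[OF p] 0 by (auto simp: X_def)
    obtain r where "(p, r) \<in> R" "x p r = s"
      using step[OF p p s(2,6,5) s(1,1,3,3,4,4,7,7)] by auto
    then show "\<exists>j. (p, j) \<in> R \<and> x p j \<cdot> u = zero_arr K (Dom K u) (X j)"
      using s(8) x[of p r] s(4) by (intro exI[of _ r]) auto
  qed
  moreover have "\<forall>i\<in>I. X i \<in> S" using ID(2) by blast
  ultimately show ?thesis using sI by blast
qed

end

section \<open>Yoneda extensions of length one\<close>

context abelian_category
begin

text \<open>In an exact sequence \<open>0 \<rightarrow> A \<rightarrow> E \<rightarrow> S \<rightarrow> 0\<close> the epimorphism from \<open>A\<close> to the kernel of \<open>E \<rightarrow> S\<close> is monic, hence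
  an isomorphism.\<close>

lemma n_extensions_1:
  "\<xi> \<in> n_extensions K 1 S A \<longleftrightarrow> (\<exists>f g. \<xi> = [f, g] \<and> short_exact K f g \<and> Dom K f = A \<and> Cod K g = S)"
proof
  assume \<xi>: "\<xi> \<in> n_extensions K 1 S A"
  then have "length \<xi> = 2" by (simp add: n_extensions_def)
  then obtain f g where fg: "\<xi> = [f, g]" by (auto simp: numeral_2_eq_2 length_Suc_conv)
  have a: "f \<in> Ar K" "g \<in> Ar K" "Dom K f = A" "Cod K g = S" "monic K f" "epic K g" "exact_at K f g"
    using \<xi> by (simp_all add: n_extensions_def fg)
  then obtain e k where e: "epic K e" "is_kernel K g k" "Cod K e = Dom K k" "k \<cdot> e = f" and fg': "Cod K f = Dom K g"
    by (auto simp: exact_at_def)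
  note k = kernel_arr[OF e(2)]
  have ear: "e \<in> Ar K" using e(1) by (rule epic_arr)
  have gf: "g \<cdot> f = zero_arr K (Dom K f) (Cod K g)"
    using reassoc[OF k(4), of e] e(3,4) k ear a by auto
  have em: "monic K e"
  proof (rule monicI[OF ear])
    fix u assume u: "u \<in> Ar K" "Cod K u = Dom K e" "e \<cdot> u = zero_arr K (Dom K u) (Cod K e)"
    have "f \<cdot> u = zero_arr K (Dom K u) (Cod K f)" using reassoc[OF e(4), of u] u e(3) k ear fg' by simp
    then show "u = zero_arr K (Dom K u) (Dom K e)" using monic_zeroD[OF a(5), of u] u e(3,4) k ear by auto
  qed
  obtain e' where e': "e' \<in> Ar K" "Dom K e' = Cod K e" "Cod K e' = Dom K e" "e \<cdot> e' = ident K (Cod K e)"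
    using iso_arrE[OF monic_epic_iso[OF em e(1)]] by metis
  have d: "Dom K e = Dom K f" using e(3,4) k ear by auto
  have "is_kernel K g f"
  proof (rule kernelI)
    fix u assume u: "u \<in> Ar K" "Cod K u = Dom K g" "g \<cdot> u = zero_arr K (Dom K u) (Cod K g)"
    obtain v where v: "v \<in> Ar K" "Dom K v = Dom K u" "Cod K v = Dom K k" "k \<cdot> v = u"
      using kernel_factor[OF e(2), of u] u by auto
    have "f \<cdot> e' \<cdot> v = u"
      using reassoc[OF e(4), of "e' \<cdot> v"] reassoc[OF e'(4), of v] e' e(3) v k ear by simp
    then show "\<exists>h. h \<in> Ar K \<and> Dom K h = Dom K u \<and> Cod K h = Dom K f \<and> f \<cdot> h = u"
      using e' v e(3) d by (intro exI[of _ "e' \<cdot> v"]) simp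
  qed (use a gf fg' in simp_all)
  then show "\<exists>f g. \<xi> = [f, g] \<and> short_exact K f g \<and> Dom K f = A \<and> Cod K g = S"
    using fg a short_exact_epicI by blast
next
  assume "\<exists>f g. \<xi> = [f, g] \<and> short_exact K f g \<and> Dom K f = A \<and> Cod K g = S"
  then obtain f g where fg: "\<xi> = [f, g]" "short_exact K f g" "Dom K f = A" "Cod K g = S" by blast
  note a = short_exact_arr[OF fg(2)]
  have "epic K (ident K (Dom K f))"
    by (rule epicI) (use a in auto)
  then have "exact_at K f g"
    unfolding exact_at_def using a by (intro conjI exI[of _ "ident K (Dom K f)"] exI[of _ f]) simp_all
  then show "\<xi> \<in> n_extensions K 1 S A" using fg a by (simp add: n_extensions_def)
qed

lemma ext_morphism_1D:
  assumes "ext_morphism K 1 a s [f, g] [f', g']" "Cod K f = Dom K g" "Cod K f' = Dom K g'"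
  shows "\<exists>\<phi>. \<phi> \<in> Ar K \<and> Dom K \<phi> = Cod K f \<and> Cod K \<phi> = Cod K f' \<and> \<phi> \<cdot> f = f' \<cdot> a \<and> g' \<cdot> \<phi> = s \<cdot> g"
proof -
  obtain \<psi> where \<psi>: "\<psi> 0 = a" "\<psi> (Suc 1) = s"
    "\<forall>i\<le>Suc 1. \<psi> i \<in> Hom K (ext_obj K [f, g] i) (ext_obj K [f', g'] i)"
    "\<forall>i\<le>1. ([f', g'] ! i) \<cdot> \<psi> i = \<psi> (Suc i) \<cdot> ([f, g] ! i)"
    using assms(1) unfolding ext_morphism_def by blast
  have "\<psi> 1 \<in> Hom K (Cod K f) (Cod K f')" using \<psi>(3)[rule_format, of 1] assms by (simp add: ext_obj_def)
  moreover have "f' \<cdot> a = \<psi> 1 \<cdot> f" using \<psi>(4)[rule_format, of 0] \<psi>(1) by simp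
  moreover have "g' \<cdot> \<psi> 1 = s \<cdot> g" using \<psi>(4)[rule_format, of 1] \<psi>(2) by simp
  ultimately show ?thesis by auto
qed

text \<open>Equivalent extensions are isomorphic: by the short five lemma each morphism in a chain of
  morphisms that are the identity on both ends can be inverted.\<close>

lemma yoneda_equiv_1D:
  assumes "(\<xi>, \<xi>') \<in> yoneda_equiv K 1 S A"
  shows "\<exists>f g f' g' \<phi>. \<xi> = [f, g] \<and> \<xi>' = [f', g'] \<and> \<phi> \<in> Ar K \<and> Dom K \<phi> = Cod K f \<and> Cod K \<phi> = Cod K f' \<and>
    \<phi> \<cdot> f = f' \<and> g' \<cdot> \<phi> = g"
proof -
  define E where "E = n_extensions K 1 S A"
  define r where "r = {(\<xi>, \<xi>'). \<xi> \<in> E \<and> \<xi>' \<in> E \<and> ext_morphism K 1 (ident K A) (ident K S) \<xi> \<xi>'}"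
  define P where "P \<xi> \<xi>' \<longleftrightarrow> (\<exists>\<phi>. \<phi> \<in> Ar K \<and> Dom K \<phi> = Cod K (\<xi> ! 0) \<and> Cod K \<phi> = Cod K (\<xi>' ! 0) \<and>
    \<phi> \<cdot> (\<xi> ! 0) = (\<xi>' ! 0) \<and> (\<xi>' ! 1) \<cdot> \<phi> = (\<xi> ! 1))" for \<xi> \<xi>'
  have E: "\<exists>f g. \<xi> = [f, g] \<and> short_exact K f g \<and> Dom K f = A \<and> Cod K g = S" if "\<xi> \<in> E" for \<xi>
    using that by (simp only: E_def n_extensions_1)
  have rP: "P \<xi> \<xi>' \<and> P \<xi>' \<xi>" if "(\<xi>, \<xi>') \<in> r" for \<xi> \<xi>'
  proof -
    have m: "\<xi> \<in> E" "\<xi>' \<in> E" "ext_morphism K 1 (ident K A) (ident K S) \<xi> \<xi>'" using that by (auto simp: r_def)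
    obtain f g where fg: "\<xi> = [f, g]" "short_exact K f g" "Dom K f = A" "Cod K g = S" using E[OF m(1)] by blast
    obtain f' g' where fg': "\<xi>' = [f', g']" "short_exact K f' g'" "Dom K f' = A" "Cod K g' = S" using E[OF m(2)] by blast
    note a = short_exact_arr[OF fg(2)] and b = short_exact_arr[OF fg'(2)]
    obtain \<phi> where \<phi>: "\<phi> \<in> Ar K" "Dom K \<phi> = Cod K f" "Cod K \<phi> = Cod K f'" "\<phi> \<cdot> f = f'" "g' \<cdot> \<phi> = g"
      using ext_morphism_1D[of "ident K A" "ident K S" f g f' g'] m(3) fg fg' a b by auto
    have "iso_arr K \<phi>" by (rule short_five[OF fg(2) fg'(2) \<phi>])
    then obtain \<psi> where \<psi>: "\<psi> \<in> Ar K" "Dom K \<psi> = Cod K \<phi>" "Cod K \<psi> = Dom K \<phi>" "\<psi> \<cdot> \<phi> = ident K (Dom K \<phi>)"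
        "\<phi> \<cdot> \<psi> = ident K (Cod K \<phi>)" by (rule iso_arrE)
    have "\<psi> \<cdot> f' = f" using reassoc[OF \<psi>(4), of f] \<psi> \<phi> a by simp
    moreover have "g \<cdot> \<psi> = g'" using reassoc[OF \<phi>(5), of \<psi>] \<psi> \<phi> a b by simp
    ultimately show ?thesis using \<phi> \<psi> fg fg' by (auto simp: P_def)
  qed
  have "(\<xi>, \<xi>') \<in> (r \<union> r\<inverse>)\<^sup>* \<inter> E \<times> E"
    using assms by (simp add: yoneda_equiv_def Let_def E_def r_def)
  then have c: "(\<xi>, \<xi>') \<in> (r \<union> r\<inverse>)\<^sup>*" and e: "\<xi> \<in> E" "\<xi>' \<in> E" by auto
  from c have "\<xi>' \<in> E \<and> P \<xi> \<xi>'"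
  proof (induction rule: rtrancl_induct)
    case base
    obtain f g where fg: "\<xi> = [f, g]" "short_exact K f g" using E[OF e(1)] by blast
    then show ?case using e(1) short_exact_arr[OF fg(2)] by (auto simp: P_def intro!: exI[of _ "ident K (Cod K f)"])
  next
    case (step \<eta> \<zeta>)
    have \<eta>\<zeta>: "P \<eta> \<zeta>" "\<eta> \<in> E" "\<zeta> \<in> E" using step.hyps(2) rP by (auto simp: r_def)
    obtain f g where fg: "\<xi> = [f, g]" "short_exact K f g" using E[OF e(1)] by blast
    obtain f' g' where fg': "\<eta> = [f', g']" "short_exact K f' g'" using E[OF \<eta>\<zeta>(2)] by blast
    obtain f'' g'' where fg'': "\<zeta> = [f'', g'']" "short_exact K f'' g''" using E[OF \<eta>\<zeta>(3)] by blast
    obtain \<phi> where \<phi>: "\<phi> \<in> Ar K" "Dom K \<phi> = Cod K f" "Cod K \<phi> = Cod K f'" "\<phi> \<cdot> f = f'" "g' \<cdot> \<phi> = g"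
      using step.IH fg fg' by (auto simp: P_def)
    obtain \<psi> where \<psi>: "\<psi> \<in> Ar K" "Dom K \<psi> = Cod K f'" "Cod K \<psi> = Cod K f''" "\<psi> \<cdot> f' = f''" "g'' \<cdot> \<psi> = g'"
      using \<eta>\<zeta>(1) fg' fg'' by (auto simp: P_def)
    have "(\<psi> \<cdot> \<phi>) \<cdot> f = f''" "g'' \<cdot> \<psi> \<cdot> \<phi> = g"
      using \<phi> \<psi> short_exact_arr[OF fg(2)] short_exact_arr[OF fg''(2)] by (simp_all add: reassoc[OF \<psi>(5)])
    then show ?case using \<phi> \<psi> fg fg'' \<eta>\<zeta>(3) by (auto simp: P_def intro!: exI[of _ "\<psi> \<cdot> \<phi>"])
  qed
  then show ?thesis using E[OF e(1)] E[OF e(2)] by (auto simp: P_def)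
qed

text \<open>Since the groups \<open>Ext\<^sup>1(S, X i)\<close> together map onto \<open>Ext\<^sup>1(S, A)\<close>, there is a morphism to the given extension
  from an extension of \<open>S\<close> by some \<open>X i\<close>, and such a morphism is a pushout square.\<close>

lemma extension_from_stage:
  fixes I :: "'u set" and \<kappa> :: "'u rel"
  assumes S: "preserves_direct_limits \<kappa> K (Ext_group K 1 S) (Ext_map K 1 S)"
    and I: "small \<kappa> I" and lim: "is_direct_limit K I R X x A l"
    and fg: "short_exact K f g" "Dom K f = A" "Cod K g = S"
  shows "\<exists>i\<in>I. \<exists>f0 g0 \<phi>. short_exact K f0 g0 \<and> Dom K f0 = X i \<and> Cod K g0 = S \<and> is_pushout K f0 (l i) f \<phi> \<and> g \<cdot> \<phi> = g0"
proof -
  note s = direct_systemD[OF direct_limitD(1)[OF lim]] and c = coconeD[OF direct_limitD(2)[OF lim]]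
  have glim: "is_group_direct_limit I R (\<lambda>i. Ext_group K 1 S (X i)) (\<lambda>i j. Ext_map K 1 S (x i j)) (Ext_group K 1 S A)
    (\<lambda>i. Ext_map K 1 S (l i))"
    using S I lim unfolding preserves_direct_limits_def by blast
  have fgE: "[f, g] \<in> n_extensions K 1 S A" unfolding n_extensions_1 using fg by blast
  have refl: "([f, g], [f, g]) \<in> yoneda_equiv K 1 S A" using fgE by (simp add: yoneda_equiv_def Let_def)
  have "yoneda_equiv K 1 S A `` {[f, g]} \<in> carrier (Ext_group K 1 S A)"
    using fgE by (simp add: Ext_group_def quotientI)
  from group_direct_limit_surj[OF glim s(1) this] obtain i d where i: "i \<in> I"
    and d: "d \<in> carrier (Ext_group K 1 S (X i))" "yoneda_equiv K 1 S A `` {[f, g]} = Ext_map K 1 S (l i) d" by blast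
  have "[f, g] \<in> Ext_map K 1 S (l i) d" using d(2) refl by blast
  then obtain \<xi>' \<xi> where \<xi>: "(\<xi>', [f, g]) \<in> yoneda_equiv K 1 S A" "\<xi>' \<in> n_extensions K 1 S A" "\<xi> \<in> d"
    "ext_morphism K 1 (l i) (ident K S) \<xi> \<xi>'"
    unfolding Ext_map_def using c(4)[OF i] by auto
  have "d \<subseteq> n_extensions K 1 S (X i)"
    using d(1) by (auto simp: Ext_group_def quotient_def yoneda_equiv_def Let_def)
  then obtain f0 g0 where 0: "\<xi> = [f0, g0]" "short_exact K f0 g0" "Dom K f0 = X i" "Cod K g0 = S"
    using \<xi>(3) unfolding n_extensions_1[of _ S "X i"] subset_iff by blast
  obtain f1 g1 where 1: "\<xi>' = [f1, g1]" "short_exact K f1 g1" "Dom K f1 = A" "Cod K g1 = S"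
    using \<xi>(2) unfolding n_extensions_1 by blast
  note a0 = short_exact_arr[OF 0(2)] and a1 = short_exact_arr[OF 1(2)] and a = short_exact_arr[OF fg(1)]
  obtain \<phi> where \<phi>: "\<phi> \<in> Ar K" "Dom K \<phi> = Cod K f0" "Cod K \<phi> = Cod K f1" "\<phi> \<cdot> f0 = f1 \<cdot> l i" "g1 \<cdot> \<phi> = g0"
    using ext_morphism_1D[of "l i" "ident K S" f0 g0 f1 g1] \<xi>(4) 0 1 a0 a1 by auto
  obtain \<psi> where \<psi>: "\<psi> \<in> Ar K" "Dom K \<psi> = Cod K f1" "Cod K \<psi> = Cod K f" "\<psi> \<cdot> f1 = f" "g \<cdot> \<psi> = g1"
    using yoneda_equiv_1D[OF \<xi>(1)] 1(1) by auto
  have e: "(\<psi> \<cdot> \<phi>) \<cdot> f0 = f \<cdot> l i" "g \<cdot> \<psi> \<cdot> \<phi> = g0"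
    using reassoc[OF \<psi>(4), of "l i"] reassoc[OF \<psi>(5), of \<phi>] \<phi> \<psi> a0 a1 a c(2-4)[OF i] 1 by simp_all
  have "is_pushout K f0 (l i) f (\<psi> \<cdot> \<phi>)"
    by (rule short_exact_pushout[OF 0(2) fg(1)]) (use e \<phi>(1-3) \<psi>(1-3) c(2-4)[OF i] 0 fg in simp_all)
  then show ?thesis using i 0 e by blast
qed

text \<open>The arrow \<open>f\<close> and the zero arrow induce an arrow to the pullback, and this is a kernel of the projection
  \<open>g'\<close>.\<close>

lemma pullback_short_exact:
  assumes fg: "short_exact K f g" and pb: "is_pullback K g c g' c'"
  shows "\<exists>f'. short_exact K f' g' \<and> Dom K f' = Dom K f \<and> c' \<cdot> f' = f"
proof -
  note a = short_exact_arr[OF fg] and p = pullback_arr[OF pb]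
  obtain f' where f': "f' \<in> Ar K" "Dom K f' = Dom K f" "Cod K f' = Dom K g'" "g' \<cdot> f' = zero_arr K (Dom K f) (Dom K c)"
    "c' \<cdot> f' = f"
    using pullback_factor[OF pb, of "zero_arr K (Dom K f) (Dom K c)" f] a p by auto
  have "is_kernel K g' f'"
  proof (rule kernelI)
    show "monic K f'"
    proof (rule monicI[OF f'(1)])
      fix u assume u: "u \<in> Ar K" "Cod K u = Dom K f'" "f' \<cdot> u = zero_arr K (Dom K u) (Cod K f')"
      have "f \<cdot> u = zero_arr K (Dom K u) (Cod K f)" using reassoc[OF f'(5), of u] u f'(1-3) a p by simp
      then show "u = zero_arr K (Dom K u) (Dom K f')" using monic_zeroD[OF a(5), of u] u f' by simp
    qed
    fix u assume u: "u \<in> Ar K" "Cod K u = Dom K g'" "g' \<cdot> u = zero_arr K (Dom K u) (Cod K g')"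
    have "g \<cdot> c' \<cdot> u = zero_arr K (Dom K u) (Cod K g)"
      using reassoc[OF p(9)[symmetric], of u] u p(1-8) by simp
    then obtain v where v: "v \<in> Ar K" "Dom K v = Dom K u" "Cod K v = Dom K f" "f \<cdot> v = c' \<cdot> u"
      using kernel_factor[OF a(7), of "c' \<cdot> u"] u p by auto
    have "f' \<cdot> v = u"
      by (rule pullback_unique[OF pb])
        (use reassoc[OF f'(5), of v] reassoc[OF f'(4), of v] f'(1-3) v u p in simp_all)
    then show "\<exists>h. h \<in> Ar K \<and> Dom K h = Dom K u \<and> Cod K h = Dom K f' \<and> f' \<cdot> h = u" using v f' by auto
  qed (use f' p in simp_all)
  then show ?thesis using short_exact_epicI[OF pullback_of_epic[OF pb a(6)]] f' by blast
qed

end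

section \<open>Extension-closed classes of finitely presentable objects\<close>

locale fp_class = lfp_category K \<kappa> \<G>
  for K :: "('o, 'm, 'x) abcat_scheme" (structure) and \<kappa> :: "'u rel" and \<G> +
  fixes \<S> :: "'o set"
  assumes \<S>_fp: "A \<in> \<S> \<Longrightarrow> fp \<kappa> K A"
    and \<S>_ext: "closed_under_extensions K \<S>"
begin

lemma \<S>_Ob: "A \<in> \<S> \<Longrightarrow> A \<in> Ob K"
  by (rule fp_Ob[OF \<S>_fp])

lemma \<S>_iso: "A \<in> \<S> \<Longrightarrow> isomorphic K A B \<Longrightarrow> B \<in> \<S>"
  using \<S>_ext isomorphic_Ob(2) unfolding closed_under_extensions_def by blast

lemma \<S>_extension: "short_exact K f g \<Longrightarrow> Dom K f \<in> \<S> \<Longrightarrow> Cod K g \<in> \<S> \<Longrightarrow> Cod K f \<in> \<S>"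
  using \<S>_ext unfolding closed_under_extensions_def by blast

definition skeleton :: "'o set \<Rightarrow> bool" where
  "skeleton T \<longleftrightarrow> small \<kappa> T \<and> T \<subseteq> \<S> \<and> (\<forall>A\<in>\<S>. \<exists>B\<in>T. isomorphic K A B)"

lemma ex_skeleton: "\<exists>T. skeleton T"
proof -
  obtain T where T: "small \<kappa> T" "\<forall>S. fp \<kappa> K S \<longrightarrow> (\<exists>t\<in>T. isomorphic K S t)" using small_fp_reps by blast
  have "skeleton (T \<inter> \<S>)"
    unfolding skeleton_def using T small_subset[OF T(1), of "T \<inter> \<S>"] \<S>_fp \<S>_iso by blast
  then show ?thesis by blast
qed

lemma skeletonD:
  assumes "skeleton T"
  shows "small \<kappa> T" "T \<subseteq> \<S>" "\<And>A. A \<in> \<S> \<Longrightarrow> \<exists>B\<in>T. isomorphic K A B"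
  using assms by (auto simp: skeleton_def)

lemma skeleton_sums:
  assumes T: "skeleton T" and AB: "A \<in> T" "B \<in> T"
  shows "\<exists>P\<in>T. \<exists>i1 i2 p1 p2. biproduct K A B P i1 i2 p1 p2"
proof -
  have AB': "A \<in> \<S>" "B \<in> \<S>" using AB skeletonD(2)[OF T] by auto
  note O = \<S>_Ob[OF AB'(1)] \<S>_Ob[OF AB'(2)]
  obtain P i1 i2 p1 p2 where bp: "biproduct K A B P i1 i2 p1 p2" using ex_biproduct[OF O] by blast
  note b = biproduct_arr[OF bp O]
  have "P \<in> \<S>" using \<S>_extension[OF biproduct_short_exact[OF bp O]] b AB' by simp
  then obtain Q where Q: "Q \<in> T" "isomorphic K P Q" using skeletonD(3)[OF T] by blast
  obtain t t' where t: "t \<in> Ar K" "t' \<in> Ar K" "Dom K t = P" "Cod K t = Q" "Dom K t' = Q" "Cod K t' = P"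
    "t' \<cdot> t = ident K P" "t \<cdot> t' = ident K Q" using Q(2) by (rule isomorphicE)
  have "((t \<cdot> i1) \<cdot> (p1 \<cdot> t')) \<boxplus> ((t \<cdot> i2) \<cdot> (p2 \<cdot> t')) = t \<cdot> (i1 \<cdot> p1 \<boxplus> i2 \<cdot> p2) \<cdot> t'"
    using t(1-6) b(1-13) by simp
  also have "\<dots> = ident K Q" unfolding b(16) using t by simp
  finally have "biproduct K A B Q (t \<cdot> i1) (t \<cdot> i2) (p1 \<cdot> t') (p2 \<cdot> t')"
    unfolding biproduct_def using t b O arr_Ob(2)[OF t(1)] by (simp add: reassoc[OF t(7)])
  then show ?thesis using Q(1) by blast
qed

lemma skeleton_nonempty: "skeleton T \<Longrightarrow> T \<noteq> {}"
  using \<S>_ext skeletonD(3) unfolding closed_under_extensions_def by blast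

lemma approximable_skeleton:
  assumes T: "skeleton T" and N: "approximable \<S> N"
  shows "approximable T N"
proof (rule approximableI[OF approximable_Ob[OF N]])
  fix a f assume af: "a \<in> Ar K" "f \<in> Ar K" "Cod K a = Dom K f" "Cod K f = N" "fp \<kappa> K (Dom K a)"
    "fp \<kappa> K (Dom K f)" "f \<cdot> a = zero_arr K (Dom K a) N"
  obtain s g where s: "s \<in> Ar K" "g \<in> Ar K" "Dom K s = Dom K f" "Cod K s = Dom K g" "Cod K g = N" "Dom K g \<in> \<S>"
    "g \<cdot> s = f" "s \<cdot> a = zero_arr K (Dom K a) (Dom K g)" using approximableD[OF N af] by blast
  obtain B where B: "B \<in> T" "isomorphic K (Dom K g) B" using skeletonD(3)[OF T s(6)] by blast
  obtain t t' where t: "t \<in> Ar K" "t' \<in> Ar K" "Dom K t = Dom K g" "Cod K t = B" "Dom K t' = B" "Cod K t' = Dom K g"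
    "t' \<cdot> t = ident K (Dom K g)" "t \<cdot> t' = ident K B" using B(2) by (rule isomorphicE)
  show "\<exists>s g. s \<in> Ar K \<and> g \<in> Ar K \<and> Dom K s = Dom K f \<and> Cod K s = Dom K g \<and> Cod K g = N \<and> Dom K g \<in> T \<and>
          g \<cdot> s = f \<and> s \<cdot> a = zero_arr K (Dom K a) (Dom K g)"
    by (rule exI[of _ "t \<cdot> s"], rule exI[of _ "g \<cdot> t'"]) (use s t B(1) af in \<open>simp add: reassoc[OF t(7)]\<close>)
qed

text \<open>Lenzing's criterion for being a direct limit of objects in \<open>\<S>\<close>.\<close>

lemma direct_limits_iff: "N \<in> direct_limits \<kappa> K \<S> \<longleftrightarrow> approximable \<S> N"
proof
  assume "N \<in> direct_limits \<kappa> K \<S>"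
  then obtain I :: "'u set" and R X x l where "small \<kappa> I" "\<forall>i \<in> I. X i \<in> \<S>" "is_direct_limit K I R X x N l"
    unfolding direct_limits_def by blast
  then show "approximable \<S> N" using direct_limit_approximable approximable_self \<S>_Ob by blast
next
  assume N: "approximable \<S> N"
  obtain T where T: "skeleton T" using ex_skeleton by blast
  have fpT: "fp \<kappa> K A" if "A \<in> T" for A using that skeletonD(2)[OF T] \<S>_fp by blast
  show "N \<in> direct_limits \<kappa> K \<S>"
    using approximable_is_direct_limit[OF approximable_skeleton[OF T N] fpT skeletonD(1)[OF T] skeleton_nonempty[OF T]
        skeleton_sums[OF T]] direct_limits_arbitrary_index skeletonD(2)[OF T] by blast
qed

lemma direct_limits_skeleton:
  assumes T: "skeleton T" and N: "N \<in> direct_limits \<kappa> K \<S>"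
  shows "N \<in> direct_limits \<kappa> K T"
proof -
  have fpT: "fp \<kappa> K A" if "A \<in> T" for A using that skeletonD(2)[OF T] \<S>_fp by blast
  show ?thesis
    using approximable_is_direct_limit[OF approximable_skeleton[OF T] fpT skeletonD(1)[OF T] skeleton_nonempty[OF T]
        skeleton_sums[OF T]] direct_limits_arbitrary_index N unfolding direct_limits_iff by blast
qed

lemma direct_limits_Ob: "N \<in> direct_limits \<kappa> K \<S> \<Longrightarrow> N \<in> Ob K"
  unfolding direct_limits_iff by (rule approximable_Ob)

lemma direct_limits_limit:
  fixes I :: "'i set"
  assumes "small \<kappa> I" "is_direct_limit K I R X x N l" "\<And>i. i \<in> I \<Longrightarrow> X i \<in> direct_limits \<kappa> K \<S>"
  shows "N \<in> direct_limits \<kappa> K \<S>"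
  using direct_limit_approximable assms unfolding direct_limits_iff by blast

lemma approximable_iso:
  assumes N: "approximable \<S> N" and iso: "isomorphic K N M"
  shows "approximable \<S> M"
proof (rule approximableI[OF isomorphic_Ob(2)[OF iso]])
  fix a f assume af: "a \<in> Ar K" "f \<in> Ar K" "Cod K a = Dom K f" "Cod K f = M" "fp \<kappa> K (Dom K a)"
    "fp \<kappa> K (Dom K f)" "f \<cdot> a = zero_arr K (Dom K a) M"
  obtain t t' where t: "t \<in> Ar K" "t' \<in> Ar K" "Dom K t = N" "Cod K t = M" "Dom K t' = M" "Cod K t' = N"
    "t' \<cdot> t = ident K N" "t \<cdot> t' = ident K M" using iso by (rule isomorphicE)
  have a: "t' \<cdot> f \<in> Ar K" "Cod K a = Dom K (t' \<cdot> f)" "Cod K (t' \<cdot> f) = N" "fp \<kappa> K (Dom K (t' \<cdot> f))"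
    "(t' \<cdot> f) \<cdot> a = zero_arr K (Dom K a) N" using t af by simp_all
  obtain s g where s: "s \<in> Ar K" "g \<in> Ar K" "Dom K s = Dom K f" "Cod K s = Dom K g" "Cod K g = N" "Dom K g \<in> \<S>"
    "g \<cdot> s = t' \<cdot> f" "s \<cdot> a = zero_arr K (Dom K a) (Dom K g)"
    using approximableD[OF N af(1) a(1,2,3) af(5) a(4,5)] t af by auto
  have "t \<cdot> g \<cdot> s = f" using s(7) t af by (simp add: reassoc[OF t(8)])
  then show "\<exists>s g. s \<in> Ar K \<and> g \<in> Ar K \<and> Dom K s = Dom K f \<and> Cod K s = Dom K g \<and> Cod K g = M \<and> Dom K g \<in> \<S> \<and>
          g \<cdot> s = f \<and> s \<cdot> a = zero_arr K (Dom K a) (Dom K g)"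
    by (intro exI[of _ s] exI[of _ "t \<cdot> g"]) (use s t in simp)
qed

text \<open>An object \<open>E\<close> mapping to an extension of \<open>C\<close> by \<open>A\<close> first factors through the pullback of the
  extension to some \<open>S'\<close> in \<open>\<S>\<close>. This pullback is an extension of \<open>S'\<close> by \<open>A\<close>, hence comes from
  an extension of \<open>S'\<close> by some stage \<open>X i\<close> of \<open>A\<close>, and so it is the direct limit of its pushouts to
  the later stages, all of which are in \<open>\<S>\<close>.\<close>

lemma approximable_extension:
  assumes FP: "\<And>S. S \<in> \<S> \<Longrightarrow> preserves_direct_limits \<kappa> K (Ext_group K 1 S) (Ext_map K 1 S)"
    and fg: "short_exact K f g" and A: "Dom K f \<in> direct_limits \<kappa> K \<S>" and C: "approximable \<S> (Cod K g)"
  shows "approximable \<S> (Cod K f)"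
proof (rule approximableI)
  note a0 = short_exact_arr[OF fg]
  show "Cod K f \<in> Ob K" using a0 by simp
  fix a e assume ae: "a \<in> Ar K" "e \<in> Ar K" "Cod K a = Dom K e" "Cod K e = Cod K f" "fp \<kappa> K (Dom K a)"
    "fp \<kappa> K (Dom K e)" "e \<cdot> a = zero_arr K (Dom K a) (Cod K f)"
  have ge: "g \<cdot> e \<in> Ar K" "Cod K a = Dom K (g \<cdot> e)" "Cod K (g \<cdot> e) = Cod K g" "fp \<kappa> K (Dom K (g \<cdot> e))"
    "(g \<cdot> e) \<cdot> a = zero_arr K (Dom K a) (Cod K g)" using ae a0 by simp_all
  obtain s c where s: "s \<in> Ar K" "c \<in> Ar K" "Dom K s = Dom K e" "Cod K s = Dom K c" "Cod K c = Cod K g" "Dom K c \<in> \<S>"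
    "c \<cdot> s = g \<cdot> e" "s \<cdot> a = zero_arr K (Dom K a) (Dom K c)"
    using approximableD[OF C ae(1) ge(1-3) ae(5) ge(4,5)] ae a0 by auto
  obtain g' c' where pb: "is_pullback K g c g' c'" using ex_pullback_epic[OF a0(6) s(2,5)] by blast
  note p = pullback_arr[OF pb]
  obtain f' where f': "short_exact K f' g'" "Dom K f' = Dom K f" "c' \<cdot> f' = f" using pullback_short_exact[OF fg pb] by blast
  note a1 = short_exact_arr[OF f'(1)]
  obtain e' where e': "e' \<in> Ar K" "Dom K e' = Dom K e" "Cod K e' = Cod K f'" "g' \<cdot> e' = s" "c' \<cdot> e' = e"
    using pullback_factor[OF pb, of s e] s ae a0 a1 p by auto
  have e'a: "e' \<cdot> a = zero_arr K (Dom K a) (Cod K f')"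
    by (rule pullback_unique[OF pb])
      (use reassoc[OF e'(4), of a] reassoc[OF e'(5), of a] e'(1-3) ae s(8) a0 a1 p in simp_all)
  obtain I :: "'u set" and R X x l where I: "small \<kappa> I" and X: "\<forall>i \<in> I. X i \<in> \<S>"
    and lim: "is_direct_limit K I R X x (Dom K f') l"
    using A f'(2) unfolding direct_limits_def by auto
  have g'S: "Cod K g' \<in> \<S>" using p s by simp
  obtain i f0 g0 \<phi> where i: "i \<in> I" and 0: "short_exact K f0 g0" "Dom K f0 = X i" "Cod K g0 = Cod K g'"
      "is_pushout K f0 (l i) f' \<phi>" "g' \<cdot> \<phi> = g0"
    using extension_from_stage[OF FP[OF g'S] I lim f'(1) refl refl] by blast
  note b0 = short_exact_arr[OF 0(1)]
  define J where "J = {k. (i, k) \<in> R}"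
  define R' where "R' = R \<inter> J \<times> J"
  have limJ: "is_direct_limit K J R' X x (Dom K f') l" and J: "small \<kappa> J" "J \<subseteq> I"
    using direct_limit_final_segment[OF I lim i] unfolding J_def R'_def by auto
  have dir: "directed_poset I R" using lim by (simp add: is_direct_limit_def direct_system_def)
  have iJ: "i \<in> J" using directed_poset_refl[OF dir i] by (simp add: J_def)
  note sy = direct_systemD[OF direct_limitD(1)[OF limJ]]
  have ik: "(i, k) \<in> R'" if "k \<in> J" for k using that iJ by (auto simp: R'_def J_def)
  have "\<exists>f1 \<phi>1. is_pushout K f0 (x i k) f1 \<phi>1" if "k \<in> J" for k
    using ex_pushout[of f0 "x i k"] b0 0 sy(3-5)[OF ik[OF that]] by auto
  then obtain f1 \<phi>1 where po: "\<And>k. k \<in> J \<Longrightarrow> is_pushout K f0 (x i k) (f1 k) (\<phi>1 k)" by metis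
  have f1S: "Cod K (f1 k) \<in> \<S>" if k: "k \<in> J" for k
  proof -
    note q = pushout_arr[OF po[OF k]]
    obtain g1 where g1: "is_cokernel K (f1 k) g1" "g1 \<cdot> \<phi>1 k = g0"
      using pushout_cokernel[OF po[OF k] b0(8)] by blast
    have se: "short_exact K (f1 k) g1" by (rule short_exact_monicI[OF pushout_of_monic[OF po[OF k] b0(5)] g1(1)])
    have "Cod K g1 = Cod K g0" using g1(2) cokernel_arr[OF g1(1)] q comp_arr(3)[of "\<phi>1 k" g1] by simp
    then show ?thesis using \<S>_extension[OF se] q sy(5)[OF ik[OF k]] k J X 0 g'S by auto
  qed
  obtain y m where limB: "is_direct_limit K J R' (\<lambda>k. Cod K (f1 k)) y (Cod K f') m"
    using direct_limit_of_pushouts[OF limJ iJ ik po 0(4)] by blast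
  note cB = coconeD[OF direct_limitD(2)[OF limB]]
  obtain k t where k: "k \<in> J" and t: "t \<in> Ar K" "Dom K t = Dom K e'" "Cod K t = Cod K (f1 k)" "m k \<cdot> t = e'"
    "t \<cdot> a = zero_arr K (Dom K a) (Cod K (f1 k))"
    using fp_factor_kill[OF J(1) limB ae(1) _ ae(5) e'(1,3) _ e'a] e'(2) ae(3,6) by auto
  have "c' \<cdot> m k \<cdot> t = e" using t(4) e'(5) by simp
  then show "\<exists>s h. s \<in> Ar K \<and> h \<in> Ar K \<and> Dom K s = Dom K e \<and> Cod K s = Dom K h \<and> Cod K h = Cod K f \<and> Dom K h \<in> \<S> \<and>
          h \<cdot> s = e \<and> s \<cdot> a = zero_arr K (Dom K a) (Dom K h)"
    by (intro exI[of _ t] exI[of _ "c' \<cdot> m k"]) (use t cB(2-4)[OF k] p a0 a1 f1S[OF k] e' in simp)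
qed

theorem direct_limits_closed_under_extensions:
  assumes "\<And>S. S \<in> \<S> \<Longrightarrow> type_FP \<kappa> K 2 S"
  shows "closed_under_extensions K (direct_limits \<kappa> K \<S>)"
proof -
  have FP: "preserves_direct_limits \<kappa> K (Ext_group K 1 S) (Ext_map K 1 S)" if "S \<in> \<S>" for S
    using assms[OF that] unfolding type_FP_def by auto
  obtain Z where Z: "Z \<in> \<S>" "zero_object K Z" using \<S>_ext by (auto simp: closed_under_extensions_def)
  show ?thesis
    unfolding closed_under_extensions_def
  proof (intro conjI ballI allI impI)
    show "direct_limits \<kappa> K \<S> \<subseteq> Ob K" using direct_limits_Ob by blast
    show "\<exists>Z\<in>direct_limits \<kappa> K \<S>. zero_object K Z"
      using Z approximable_self[OF Z(1)] \<S>_Ob direct_limits_iff by blast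
    show "Y \<in> direct_limits \<kappa> K \<S>" if "X \<in> direct_limits \<kappa> K \<S>" "isomorphic K X Y" for X Y
      using that approximable_iso by (simp add: direct_limits_iff)
    fix f g assume "short_exact K f g \<and> Dom K f \<in> direct_limits \<kappa> K \<S> \<and> Cod K g \<in> direct_limits \<kappa> K \<S>"
    then show "Cod K f \<in> direct_limits \<kappa> K \<S>" using approximable_extension[OF FP] direct_limits_iff by blast
  qed
qed

end

section \<open>Small pure subobjects\<close>

text \<open>Inside a directed poset, the closure of an element under upper bounds and under an operation
  \<open>\<Phi>\<close> whose values have at most \<open>|A|\<close> elements is the union of countably many steps, hence has at most
  \<open>|A|\<close> elements.\<close>

lemma directed_closure:
  fixes A :: "'a set" and I :: "'i set"
  assumes dir: "directed_poset I R" and A: "infinite A" and \<Phi>: "\<forall>j\<in>I. \<Phi> j \<subseteq> I \<and> |\<Phi> j| \<le>o |A|" and i: "i \<in> I"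
  shows "\<exists>J. J \<subseteq> I \<and> i \<in> J \<and> |J| \<le>o |A| \<and> (\<forall>j\<in>J. \<Phi> j \<subseteq> J) \<and> (\<forall>j\<in>J. \<forall>k\<in>J. \<exists>m\<in>J. (j, m) \<in> R \<and> (k, m) \<in> R)"
proof -
  obtain ub where ub: "\<And>j k. j \<in> I \<Longrightarrow> k \<in> I \<Longrightarrow> ub j k \<in> I \<and> (j, ub j k) \<in> R \<and> (k, ub j k) \<in> R"
    using directed_poset_bound[OF dir] by metis
  define Js where "Js = rec_nat {i} (\<lambda>n J. J \<union> (\<Union>j\<in>J. \<Phi> j) \<union> (\<Union>j\<in>J. \<Union>k\<in>J. {ub j k}))"
  have Js0: "Js 0 = {i}" and JsS: "Js (Suc n) = Js n \<union> (\<Union>j\<in>Js n. \<Phi> j) \<union> (\<Union>j\<in>Js n. \<Union>k\<in>Js n. {ub j k})" for n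
    by (simp_all add: Js_def)
  have one: "|{x}| \<le>o |A|" for x :: 'i using A by (intro card_of_singl_ordLeq) auto
  have Js: "Js n \<subseteq> I \<and> |Js n| \<le>o |A|" for n
  proof (induction n)
    case 0 then show ?case using i one by (simp add: Js0)
  next
    case (Suc n)
    have "|\<Union>j\<in>Js n. \<Phi> j| \<le>o |A|"
      by (rule card_of_UNION_ordLeq_infinite[OF A]) (use Suc \<Phi> in auto)
    moreover have "|\<Union>j\<in>Js n. \<Union>k\<in>Js n. {ub j k}| \<le>o |A|"
      by (intro card_of_UNION_ordLeq_infinite[OF A] ballI one) (use Suc in auto)
    ultimately have "|Js (Suc n)| \<le>o |A|" unfolding JsS
      using Suc A card_of_Card_order by (intro card_of_Un_ordLeq_infinite_Field) (simp_all add: Field_card_of)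
    moreover have "Js (Suc n) \<subseteq> I" unfolding JsS using Suc ub \<Phi> by blast
    ultimately show ?case by blast
  qed
  have mono: "Js n \<subseteq> Js m" if "n \<le> m" for n m
    by (rule lift_Suc_mono_le[OF _ that]) (auto simp: JsS)
  define J where "J = (\<Union>n. Js n)"
  have "|J| \<le>o |A|" unfolding J_def
    by (rule card_of_UNION_ordLeq_infinite[OF A]) (use Js A in \<open>auto simp: infinite_iff_card_of_nat\<close>)
  moreover have "J \<subseteq> I" "i \<in> J" using Js Js0 by (auto simp: J_def)
  moreover have "\<Phi> j \<subseteq> J" if j: "j \<in> J" for j
  proof -
    obtain n where "j \<in> Js n" using j by (auto simp: J_def)
    then have "\<Phi> j \<subseteq> Js (Suc n)" by (auto simp: JsS)
    then show ?thesis by (auto simp: J_def)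
  qed
  moreover have "\<exists>m\<in>J. (j, m) \<in> R \<and> (k, m) \<in> R" if jk: "j \<in> J" "k \<in> J" for j k
  proof -
    obtain n n' where "j \<in> Js n" "k \<in> Js n'" using jk by (auto simp: J_def)
    then have "j \<in> Js (max n n')" "k \<in> Js (max n n')" using mono[of n "max n n'"] mono[of n' "max n n'"] by auto
    then have "ub j k \<in> Js (Suc (max n n'))" by (auto simp: JsS)
    then have "ub j k \<in> J" by (auto simp: J_def)
    then show ?thesis using ub[of j k] jk \<open>J \<subseteq> I\<close> by blast
  qed
  ultimately show ?thesis by (intro exI[of _ J]) simp
qed

context fp_class
begin

abbreviation arrows :: "'o set \<Rightarrow> 'm set" where
  "arrows T \<equiv> (\<Union>(A, B)\<in>T \<times> T. Hom K A B)"

lemma small_arrows: "skeleton T \<Longrightarrow> small \<kappa> (arrows T)"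
proof -
  assume T: "skeleton T"
  have "small \<kappa> (Hom K A B)" if "A \<in> T" "B \<in> T" for A B
    using small_Hom \<S>_Ob skeletonD(2)[OF T] that unfolding locally_small_def by blast
  then show ?thesis
    by (intro small_UN[OF inaccessible small_Times[OF inaccessible skeletonD(1)[OF T] skeletonD(1)[OF T]]]) auto
qed

text \<open>Let \<open>J\<close> be a subset of the index set such that every transition arrow out of \<open>X j\<close>, \<open>j \<in> J\<close>,
  occurs as a transition arrow within \<open>J\<close>. Then the limit over \<open>J\<close> is a subobject \<open>P\<close> of \<open>M\<close>. For the
  quotient \<open>M/P\<close> one uses that it is the direct limit of the quotients of \<open>M\<close> by the images of \<open>X j\<close>,
  which in turn are the direct limits over \<open>i\<close> of the cokernels of \<open>x j i\<close>. The projection from such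
  a cokernel to \<open>M/P\<close> lifts to \<open>M\<close>: if \<open>x j i = x j i'\<close> with \<open>i' \<in> J\<close>, then \<open>l i - l i'\<close> kills
  \<open>x j i\<close>, and \<open>l i'\<close> vanishes in \<open>M/P\<close>. So maps to \<open>M/P\<close> from finitely presentable objects
  lift to \<open>M\<close>.\<close>

lemma subsystem_pure:
  fixes I :: "'u set"
  assumes I: "small \<kappa> I" and lim: "is_direct_limit K I R X x M l" and X: "\<And>i. i \<in> I \<Longrightarrow> X i \<in> \<S>"
    and J: "J \<subseteq> I" "J \<noteq> {}" "\<And>j k. j \<in> J \<Longrightarrow> k \<in> J \<Longrightarrow> \<exists>m\<in>J. (j, m) \<in> R \<and> (k, m) \<in> R"
    and cl: "\<And>j i. j \<in> J \<Longrightarrow> (j, i) \<in> R \<Longrightarrow> \<exists>i'\<in>J. (j, i') \<in> R \<and> x j i' = x j i"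
  shows "\<exists>P t p c. is_direct_limit K J (R \<inter> J \<times> J) X x P t \<and> p \<in> Ar K \<and> Dom K p = P \<and> Cod K p = M \<and>
    (\<forall>j\<in>J. p \<cdot> t j = l j) \<and> monic K p \<and> is_cokernel K p c \<and> Cod K c \<in> direct_limits \<kappa> K \<S>"
proof -
  note s = direct_systemD[OF direct_limitD(1)[OF lim]] and c = coconeD[OF direct_limitD(2)[OF lim]]
  note F = directed_poset_Field[OF s(1)] and rt = directed_poset_trans[OF s(1)] and rr = directed_poset_refl[OF s(1)]
  define RJ where "RJ = R \<inter> J \<times> J"
  have sJ: "small \<kappa> J" by (rule small_subset[OF I J(1)])
  have dirJ: "directed_poset J RJ"
    unfolding directed_poset_def partial_order_on_def preorder_on_def
  proof (intro conjI ballI)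
    show "RJ \<subseteq> J \<times> J" by (auto simp: RJ_def)
    show "refl_on J RJ" using rr J(1) by (auto simp: refl_on_def RJ_def)
    show "trans RJ" unfolding RJ_def by (rule transI) (use rt in blast)
    show "antisym RJ"
      using s(1) unfolding directed_poset_def partial_order_on_def antisym_def RJ_def by blast
    show "J \<noteq> {}" by (rule J(2))
    show "\<exists>k\<in>J. (a, k) \<in> RJ \<and> (b, k) \<in> RJ" if "a \<in> J" "b \<in> J" for a b
      using J(3)[OF that] that by (auto simp: RJ_def)
  qed
  have "direct_system K J RJ X x"
    using direct_limitD(1)[OF lim] J(1) dirJ unfolding direct_system_def RJ_def by blast
  then obtain P t where P: "is_direct_limit K J RJ X x P t" using ex_direct_limit[OF sJ] by blast
  note t = coconeD[OF direct_limitD(2)[OF P]]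
  have "is_cocone K J RJ X x M l"
    using direct_limitD(2)[OF lim] J(1) unfolding is_cocone_def RJ_def by blast
  then obtain p where p: "p \<in> Ar K" "Dom K p = P" "Cod K p = M" "\<And>j. j \<in> J \<Longrightarrow> p \<cdot> t j = l j"
    using direct_limit_hom[OF P] by blast
  have pm: "monic K p"
  proof (rule direct_limit_monicI[OF sJ P p(1,2)])
    fix j u assume j: "j \<in> J" and u: "u \<in> elems (X j)" and 0: "p \<cdot> t j \<cdot> u = zero_arr K (Dom K u) (Cod K p)"
    note u' = elemsD[OF u]
    have jI: "j \<in> I" using j J by blast
    have "l j \<cdot> u = zero_arr K (Dom K u) M" using reassoc[OF p(4)[OF j], of u] 0 p(1-3) u' t(2-4)[OF j] by simp
    then obtain i where i: "(j, i) \<in> R" "x j i \<cdot> u = zero_arr K (Dom K u) (X i)"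
      using fp_kill[OF \<G>_fp I lim jI, of "Dom K u" u] u' by auto
    obtain i' where i': "i' \<in> J" "(j, i') \<in> R" "x j i' = x j i" using cl[OF j i(1)] by blast
    have ji': "(j, i') \<in> RJ" using i' j by (simp add: RJ_def)
    have "t j \<cdot> u = t i' \<cdot> x j i' \<cdot> u"
      using reassoc[OF t(5)[OF ji'], of u] t(2-4)[OF i'(1)] s(3-5)[OF i'(2)] u' by simp
    also have "x j i' \<cdot> u = zero_arr K (Dom K u) (X i')"
      using i(2) i'(3) s(5)[OF i'(2)] s(5)[OF i(1)] by simp
    finally show "t j \<cdot> u = zero_arr K (Dom K u) P" using t(2-4)[OF i'(1)] u' by simp
  qed
  obtain c where c0: "is_cokernel K p c" using obtain_cokernel[OF p(1)] .
  note cc = cokernel_arr[OF c0]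
  have cl0: "c \<cdot> l j = zero_arr K (X j) (Cod K c)" if j: "j \<in> J" for j
    using reassoc[OF cc(4), of "t j"] cc(1-3) t(2-4)[OF j] p(1-3) p(4)[OF j] by simp
  have "approximable \<S> (Cod K c)"
  proof (rule approximableI)
    show "Cod K c \<in> Ob K" using cc by simp
    fix a f assume af: "a \<in> Ar K" "f \<in> Ar K" "Cod K a = Dom K f" "Cod K f = Cod K c" "fp \<kappa> K (Dom K a)"
      "fp \<kappa> K (Dom K f)" "f \<cdot> a = zero_arr K (Dom K a) (Cod K c)"
    define D where "D j = {l k |k. (k, j) \<in> RJ}" for j
    have D: "g \<in> Ar K \<and> Cod K g = M" if "g \<in> D j" for g j
      using that c(2-4) F by (auto simp: D_def RJ_def)
    have "small \<kappa> (D j)" for j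
      by (rule small_subset[OF small_image[OF sJ, of l]]) (auto simp: D_def RJ_def)
    then have "\<exists>q. is_quotient K M (D j) q" for j by (rule ex_quotient[OF _ D c(1)])
    then obtain q where q: "\<And>j. is_quotient K M (D j) (q j)" by metis
    note q' = quotientD[OF q]
    have Dmono: "D j \<subseteq> D k" if "(j, k) \<in> RJ" for j k
      using directed_poset_trans[OF dirJ _ that] by (auto simp: D_def)
    have UD: "(\<Union>j\<in>J. D j) = l ` J"
      using directed_poset_refl[OF dirJ] directed_poset_Field[OF dirJ] by (auto simp: D_def)
    have cq: "is_quotient K M (\<Union>j\<in>J. D j) c"
      unfolding UD
    proof (rule is_quotientI)
      show "epic K c" by (rule cokernel_epic[OF c0])
      show "Dom K c = M" using cc p by simp
      show "f \<in> Ar K \<and> Cod K f = M \<and> c \<cdot> f = zero_arr K (Dom K f) (Cod K c)" if "f \<in> l ` J" for f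
        using that cl0 c(2-4) J(1) by auto
      fix g assume g: "g \<in> Ar K" "Dom K g = M" "\<And>f. f \<in> l ` J \<Longrightarrow> g \<cdot> f = zero_arr K (Dom K f) (Cod K g)"
      have "g \<cdot> p = zero_arr K P (Cod K g)"
      proof (rule direct_limit_unique[OF P])
        fix j assume j: "j \<in> J"
        show "(g \<cdot> p) \<cdot> t j = zero_arr K P (Cod K g) \<cdot> t j"
          using g(1,2) g(3)[of "l j"] j p(1-3) p(4)[OF j] t(2-4)[OF j] c(2-4)[of j] J(1) by auto
      qed (use g p t(1) in simp_all)
      then show "\<exists>h. h \<in> Ar K \<and> Dom K h = Cod K c \<and> Cod K h = Cod K g \<and> h \<cdot> c = g"
        using cokernel_factor[OF c0, of g] g p by simp
    qed
    obtain y n where limq: "is_direct_limit K J RJ (\<lambda>j. Cod K (q j)) y (Cod K c) n"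
      and n: "\<And>j. j \<in> J \<Longrightarrow> n j \<cdot> q j = c"
      using direct_limit_of_quotients[OF dirJ Dmono q cq] by blast
    note n' = coconeD[OF direct_limitD(2)[OF limq]]
    obtain j f1 where j: "j \<in> J" and f1: "f1 \<in> Ar K" "Dom K f1 = Dom K f" "Cod K f1 = Cod K (q j)" "n j \<cdot> f1 = f"
      "f1 \<cdot> a = zero_arr K (Dom K a) (Cod K (q j))"
      using fp_factor_kill[OF sJ limq af(1,3,5,2,4,6,7)] by blast
    have jI: "j \<in> I" using j J by blast
    obtain Z where Z: "zero_object K Z" using ex_zero_object by blast
    have ZO: "Z \<in> Ob K" using Z by (simp add: zero_object_iff)
    define h where "h = zero_arr K (X j) Z"
    have h: "h \<in> Ar K" "Dom K h = X j" "Cod K h = Z" using s(2)[OF jI] ZO by (simp_all add: h_def)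
    have jj: "(j, j) \<in> RJ" by (rule directed_poset_refl[OF dirJ j])
    \<comment> \<open>The quotient by the image of \<open>X j\<close> as the pushout of \<open>X j \<rightarrow> 0\<close>.\<close>
    have poL: "is_pushout K h (l j) (q j) (zero_arr K Z (Cod K (q j)))"
      unfolding is_pushout_def
    proof (intro conjI allI impI)
      have "q j \<cdot> l j = zero_arr K (X j) (Cod K (q j))"
        using quotient_kills(3)[OF q, of "l j" j] jj c(2-4)[OF jI] by (auto simp: D_def)
      then show "q j \<cdot> l j = zero_arr K Z (Cod K (q j)) \<cdot> h" using h q'[of j] ZO by simp
      fix u v assume uv: "u \<in> Ar K \<and> v \<in> Ar K \<and> Dom K u = Cod K (l j) \<and> Dom K v = Cod K h \<and> Cod K u = Cod K v \<and> u \<cdot> l j = v \<cdot> h"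
      have v0: "v = zero_arr K Z (Cod K u)" using zero_object_from[OF Z, of v] uv h by simp
      have u: "u \<in> Ar K" "Dom K u = M" "u \<cdot> l j = zero_arr K (X j) (Cod K u)"
        using uv v0 h c(2-4)[OF jI] ZO arr_Ob(2)[of u] by auto
      have "u \<cdot> g = zero_arr K (Dom K g) (Cod K u)" if g: "g \<in> D j" for g
      proof -
        obtain k where k: "g = l k" "(k, j) \<in> R" "k \<in> I" using g F unfolding D_def RJ_def by blast
        have "u \<cdot> l j \<cdot> x k j = zero_arr K (X k) (Cod K u)"
          using reassoc[OF u(3), of "x k j"] u(1,2) c(2-4)[OF jI] s(3-5)[OF k(2)] arr_Ob(2)[OF u(1)] by simp
        then show ?thesis using k c(5)[OF k(2)] c(2-4)[OF k(3)] by simp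
      qed
      then obtain w where w: "w \<in> Ar K" "Dom K w = Cod K (q j)" "Cod K w = Cod K u" "w \<cdot> q j = u"
        using quotient_factor[OF q u(1,2), of j] by blast
      show "\<exists>!h. h \<in> Hom K (Cod K (q j)) (Cod K u) \<and> h \<cdot> q j = u \<and> h \<cdot> zero_arr K Z (Cod K (q j)) = v"
      proof (rule ex1I[of _ w])
        show "w \<in> Hom K (Cod K (q j)) (Cod K u) \<and> w \<cdot> q j = u \<and> w \<cdot> zero_arr K Z (Cod K (q j)) = v"
          using w v0 ZO by simp
        fix w' assume "w' \<in> Hom K (Cod K (q j)) (Cod K u) \<and> w' \<cdot> q j = u \<and> w' \<cdot> zero_arr K Z (Cod K (q j)) = v"
        then show "w' = w" using epicD[OF q'(3), of w' j w] w by simp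
      qed
    qed (use h q'[of j] c(2-4)[OF jI] ZO in simp_all)
    define Ij where "Ij = {i. (j, i) \<in> R}"
    define Rj where "Rj = R \<inter> Ij \<times> Ij"
    have limj: "is_direct_limit K Ij Rj X x M l" and Ij: "small \<kappa> Ij" "Ij \<subseteq> I"
      using direct_limit_final_segment[OF I lim jI] unfolding Ij_def Rj_def by auto
    have jIj: "j \<in> Ij" using rr[OF jI] by (simp add: Ij_def)
    have jR: "(j, i) \<in> Rj" "(j, i) \<in> R" if "i \<in> Ij" for i using that jIj by (auto simp: Rj_def Ij_def)
    have "\<exists>g \<phi>. is_pushout K h (x j i) g \<phi>" if "i \<in> Ij" for i
      using ex_pushout[of h "x j i"] h s(3-5)[OF jR(2)[OF that]] by auto
    then obtain g \<phi> where po: "\<And>i. i \<in> Ij \<Longrightarrow> is_pushout K h (x j i) (g i) (\<phi> i)" by metis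
    obtain z m where limz: "is_direct_limit K Ij Rj (\<lambda>i. Cod K (g i)) z (Cod K (q j)) m"
      and m: "\<And>i. i \<in> Ij \<Longrightarrow> m i \<cdot> g i = q j \<cdot> l i"
      using direct_limit_of_pushouts[OF limj jIj jR(1) po poL] by blast
    note m' = coconeD[OF direct_limitD(2)[OF limz]]
    obtain i f2 where i: "i \<in> Ij" and f2: "f2 \<in> Ar K" "Dom K f2 = Dom K f" "Cod K f2 = Cod K (g i)" "m i \<cdot> f2 = f1"
      "f2 \<cdot> a = zero_arr K (Dom K a) (Cod K (g i))"
      using fp_factor_kill[OF Ij(1) limz af(1) _ af(5) f1(1,3) _ f1(5)] f1(2) af(3,6) by auto
    have ji: "(j, i) \<in> R" and iI: "i \<in> I" using jR(2)[OF i] i Ij(2) by auto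
    obtain i' where i': "i' \<in> J" "(j, i') \<in> R" "x j i' = x j i" using cl[OF j ji] by blast
    have i'I: "i' \<in> I" using i'(1) J by blast
    have XX: "X i' = X i" using s(5)[OF ji] s(5)[OF i'(2)] i'(3) by simp
    note g' = pushout_arr[OF po[OF i]]
    have "(l i \<boxminus> l i') \<cdot> x j i = zero_arr K Z M \<cdot> h"
      using c(2-4)[OF iI] c(2-4)[OF i'I] XX c(5)[OF ji] c(5)[OF i'(2)] i'(3) s(3-5)[OF ji] c(2-4)[OF jI] h ZO c(1) by simp
    then obtain \<sigma> where \<sigma>: "\<sigma> \<in> Ar K" "Dom K \<sigma> = Cod K (g i)" "Cod K \<sigma> = M" "\<sigma> \<cdot> g i = l i \<boxminus> l i'"
      using pushout_factor[OF po[OF i], of "l i \<boxminus> l i'" "zero_arr K Z M"] c(2-4)[OF iI] c(2-4)[OF i'I] XX h ZO c(1) s(5)[OF ji] by auto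
    have c\<sigma>: "c \<cdot> \<sigma> = n j \<cdot> m i"
    proof (rule pushout_unique[OF po[OF i]])
      have "(c \<cdot> \<sigma>) \<cdot> g i = c \<cdot> l i"
        using \<sigma> cc p g' c(2-4)[OF iI] c(2-4)[OF i'I] XX cl0[OF i'(1)] by simp
      moreover have "(n j \<cdot> m i) \<cdot> g i = c \<cdot> l i"
        using m[OF i] reassoc[OF n[OF j], of "l i"] n'(2-4)[OF j] m'(2-4)[OF i] g' q'[of j] c(2-4)[OF iI] by simp
      ultimately show "(c \<cdot> \<sigma>) \<cdot> g i = (n j \<cdot> m i) \<cdot> g i" by simp
      have d: "\<phi> i \<in> Ar K" "Dom K (\<phi> i) = Z" "Cod K (\<phi> i) = Cod K (g i)" using g' h by simp_all
      show "(c \<cdot> \<sigma>) \<cdot> \<phi> i = (n j \<cdot> m i) \<cdot> \<phi> i"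
        using zero_object_from[OF Z, of "(c \<cdot> \<sigma>) \<cdot> \<phi> i"] zero_object_from[OF Z, of "(n j \<cdot> m i) \<cdot> \<phi> i"]
          d \<sigma>(1-3) cc(1-3) p n'(2-4)[OF j] m'(2-4)[OF i] by simp
    qed (use \<sigma> cc p n'(2-4)[OF j] m'(2-4)[OF i] in simp_all)
    define f3 where "f3 = \<sigma> \<cdot> f2"
    have f3: "f3 \<in> Ar K" "Dom K f3 = Dom K f" "Cod K f3 = M" using \<sigma> f2 by (simp_all add: f3_def)
    have "c \<cdot> f3 = (c \<cdot> \<sigma>) \<cdot> f2" using cc p \<sigma> f2 by (simp add: f3_def)
    also have "\<dots> = f" unfolding c\<sigma> using n'(2-4)[OF j] m'(2-4)[OF i] f2 f1 by simp
    finally have cf3: "c \<cdot> f3 = f" .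
    have f3a: "f3 \<cdot> a = zero_arr K (Dom K a) M" using \<sigma> f2 af by (simp add: f3_def)
    have appM: "approximable \<S> M" using direct_limit_approximable[OF I lim] X approximable_self \<S>_Ob by blast
    obtain s0 g0 where s0: "s0 \<in> Ar K" "g0 \<in> Ar K" "Dom K s0 = Dom K f" "Cod K s0 = Dom K g0" "Cod K g0 = M" "Dom K g0 \<in> \<S>"
      "g0 \<cdot> s0 = f3" "s0 \<cdot> a = zero_arr K (Dom K a) (Dom K g0)"
      using approximableD[OF appM af(1) f3(1) _ f3(3) af(5) _ f3a] f3(2) af(3,6) by auto
    then show "\<exists>s h. s \<in> Ar K \<and> h \<in> Ar K \<and> Dom K s = Dom K f \<and> Cod K s = Dom K h \<and> Cod K h = Cod K c \<and> Dom K h \<in> \<S> \<and>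
          h \<cdot> s = f \<and> s \<cdot> a = zero_arr K (Dom K a) (Dom K h)"
      using cc p cf3 by (intro exI[of _ s0] exI[of _ "c \<cdot> g0"]) simp
  qed
  then have "Cod K c \<in> direct_limits \<kappa> K \<S>" by (simp add: direct_limits_iff)
  then show ?thesis using P p pm c0 unfolding RJ_def by blast
qed

text \<open>Apply the previous lemma to the closure of an index \<open>i0\<close> with \<open>l i0 \<noteq> 0\<close>. For each transition arrow out of
  \<open>X j\<close> the operation \<open>\<Phi> j\<close> chooses one index where it occurs. As these arrows lie in the small set
  \<open>arrows T\<close>, this bounds the size of the closure, whatever the size of the index set of \<open>M\<close>.\<close>

lemma small_pure_subobject:
  assumes T: "skeleton T" and M: "M \<in> direct_limits \<kappa> K \<S>" "\<not> zero_object K M"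
  shows "\<exists>p c. monic K p \<and> Cod K p = M \<and> is_cokernel K p c \<and> p \<noteq> zero_arr K (Dom K p) M \<and>
    Dom K p \<in> direct_limits \<kappa> K \<S> \<and> Cod K c \<in> direct_limits \<kappa> K \<S> \<and> generated_by (arrows T \<times> (UNIV :: nat set)) T (Dom K p)"
proof -
  obtain I :: "'u set" and R X x l where I: "small \<kappa> I" and X: "\<And>i. i \<in> I \<Longrightarrow> X i \<in> T" and lim: "is_direct_limit K I R X x M l"
    using direct_limits_skeleton[OF T M(1)] unfolding direct_limits_def by blast
  note s = direct_systemD[OF direct_limitD(1)[OF lim]] and c = coconeD[OF direct_limitD(2)[OF lim]]
  note F = directed_poset_Field[OF s(1)]
  have XS: "X i \<in> \<S>" if "i \<in> I" for i using X[OF that] skeletonD(2)[OF T] by blast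
  have "\<exists>i\<in>I. l i \<noteq> zero_arr K (X i) M"
  proof (rule ccontr)
    assume "\<not> (\<exists>i\<in>I. l i \<noteq> zero_arr K (X i) M)"
    then have "ident K M = zero_arr K M M"
      using c s(2) by (intro direct_limit_unique[OF lim, of "ident K M" "zero_arr K M M"]) auto
    then show False using M(2) c(1) by (simp add: zero_object_iff)
  qed
  then obtain i0 where i0: "i0 \<in> I" "l i0 \<noteq> zero_arr K (X i0) M" by blast
  \<comment> \<open>The factor \<open>nat\<close> makes \<open>A\<close> infinite.\<close>
  define A where "A = arrows T \<times> (UNIV :: nat set)"
  obtain B where B: "B \<in> T" using skeleton_nonempty[OF T] by blast
  have "ident K B \<in> arrows T" using B skeletonD(2)[OF T] \<S>_Ob by auto
  then have infA: "infinite A" unfolding A_def 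
    using finite_cartesian_productD2[of "arrows T" "UNIV :: nat set"] infinite_UNIV_nat by blast
  define \<Phi> where "\<Phi> j = (\<lambda>h. SOME i. (j, i) \<in> R \<and> x j i = h) ` {x j i |i. (j, i) \<in> R}" for j
  have \<Phi>R: "(j, SOME i'. (j, i') \<in> R \<and> x j i' = x j i) \<in> R \<and> x j (SOME i'. (j, i') \<in> R \<and> x j i' = x j i) = x j i"
    if "(j, i) \<in> R" for j i
    by (rule someI[of "\<lambda>i'. (j, i') \<in> R \<and> x j i' = x j i" i]) (use that in simp)
  have \<Phi>: "\<forall>j\<in>I. \<Phi> j \<subseteq> I \<and> |\<Phi> j| \<le>o |A|"
  proof (intro ballI conjI)
    fix j assume j: "j \<in> I"
    show "\<Phi> j \<subseteq> I" using \<Phi>R F by (fastforce simp: \<Phi>_def)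
    have "{x j i |i. (j, i) \<in> R} \<subseteq> arrows T" using X s(3-5) F by fastforce
    then have "(\<lambda>h. (h, 0)) ` {x j i |i. (j, i) \<in> R} \<subseteq> A" by (auto simp: A_def)
    moreover have "inj_on (\<lambda>h. (h, 0 :: nat)) {x j i |i. (j, i) \<in> R}" by (simp add: inj_on_def)
    ultimately have "|{x j i |i. (j, i) \<in> R}| \<le>o |A|" using card_of_ordLeq by blast
    then show "|\<Phi> j| \<le>o |A|" unfolding \<Phi>_def using card_of_image ordLeq_transitive by blast
  qed
  obtain J where J: "J \<subseteq> I" "i0 \<in> J" "|J| \<le>o |A|" "\<forall>j\<in>J. \<Phi> j \<subseteq> J"
    "\<forall>j\<in>J. \<forall>k\<in>J. \<exists>m\<in>J. (j, m) \<in> R \<and> (k, m) \<in> R"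
    using directed_closure[of I R A \<Phi>, OF s(1) infA \<Phi> i0(1)] by (elim exE conjE)
  have J0: "J \<noteq> {}" using J(2) by blast
  have cl: "\<exists>i'\<in>J. (j, i') \<in> R \<and> x j i' = x j i" if "j \<in> J" "(j, i) \<in> R" for j i
  proof -
    have "(SOME i'. (j, i') \<in> R \<and> x j i' = x j i) \<in> \<Phi> j" using that(2) by (auto simp: \<Phi>_def)
    then show ?thesis using \<Phi>R[OF that(2)] J(4) that(1) by blast
  qed
  obtain P t p c' where P: "is_direct_limit K J (R \<inter> J \<times> J) X x P t" and p: "p \<in> Ar K" "Dom K p = P" "Cod K p = M"
    "\<forall>j\<in>J. p \<cdot> t j = l j" "monic K p" "is_cokernel K p c'" "Cod K c' \<in> direct_limits \<kappa> K \<S>"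
    using subsystem_pure[OF I lim XS J(1) J0 J(5)[rule_format] cl] by blast
  note t = coconeD[OF direct_limitD(2)[OF P]]
  have sJ: "small \<kappa> J" by (rule small_subset[OF I J(1)])
  have PC: "P \<in> direct_limits \<kappa> K \<S>" by (rule direct_limits_arbitrary_index[OF sJ P]) (use XS J(1) in blast)
  have "p \<noteq> zero_arr K P M" using p(4) J(2) i0(2) t(2-4)[OF J(2)] t(1) c(1) by auto
  moreover have "generated_by A T P"
  proof -
    obtain \<gamma> where \<gamma>: "inj_on \<gamma> J" "\<gamma> ` J \<subseteq> A" using J(3) unfolding card_of_ordLeq[symmetric] by blast
    have "f = zero_arr K P (Cod K f)" if f: "f \<in> Ar K" "Dom K f = P"
      "\<forall>b\<in>\<gamma> ` J. f \<cdot> t (inv_into J \<gamma> b) = zero_arr K (Dom K (t (inv_into J \<gamma> b))) (Cod K f)" for f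
      by (rule direct_limit_unique[OF P]) (use f t \<gamma>(1) in auto)
    then show ?thesis unfolding generated_by_def
      using t \<gamma> X J(1) by (intro conjI exI[of _ "\<gamma> ` J"] exI[of _ "\<lambda>b. t (inv_into J \<gamma> b)"]) auto
  qed
  ultimately show ?thesis using p PC unfolding A_def by (intro exI[of _ p] exI[of _ c']) simp
qed

end

section \<open>Filtrations\<close>

text \<open>The third isomorphism theorem. For a subobject \<open>p\<close> of \<open>M/A = Cod q\<close> with quotient \<open>c\<close>, the
  preimage of \<open>p\<close> in \<open>M\<close> is the kernel \<open>k'\<close> of \<open>c \<cdot> q\<close> (up to a monomorphism \<open>t\<close>) and maps onto
  the domain of \<open>p\<close> with kernel \<open>A\<close>. The map is epic as a pullback of \<open>q\<close>.\<close>

lemma (in abelian_category) cokernel_between_kernels: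
  assumes q: "epic K q" and p: "monic K p" "Cod K p = Cod K q" and c: "is_cokernel K p c"
    and t: "monic K t" "Dom K t = Cod K c" and r: "r = t \<cdot> c \<cdot> q"
    and k: "is_kernel K q k" and k': "is_kernel K r k'"
    and j: "j \<in> Ar K" "Dom K j = Dom K k" "Cod K j = Dom K k'" "k' \<cdot> j = k"
  shows "\<exists>e. is_cokernel K j e \<and> Cod K e = Dom K p"
proof -
  note q' = epic_arr[OF q] and p' = monic_arr[OF p(1)] and t' = monic_arr[OF t(1)]
  note cc = cokernel_arr[OF c] and kk = kernel_arr[OF k] and kk' = kernel_arr[OF k']
  note ck = monic_kernel_of_cokernel[OF p(1) c]
  have rD: "r \<in> Ar K" "Dom K r = Dom K q" "Cod K r = Cod K t" using q' cc p(2) t' t(2) by (simp_all add: r)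
  have rz: "c \<cdot> q \<cdot> u = zero_arr K (Dom K u) (Cod K c)"
    if "u \<in> Ar K" "Cod K u = Dom K q" "r \<cdot> u = zero_arr K (Dom K u) (Cod K t)" for u
    using monic_zeroD[OF t(1), of "c \<cdot> q \<cdot> u"] that q' cc p(2) t' t(2) by (simp add: r)
  have "c \<cdot> q \<cdot> k' = zero_arr K (Dom K k') (Cod K c)" using rz[of k'] kk' rD by simp
  then obtain e where e: "e \<in> Ar K" "Dom K e = Dom K k'" "Cod K e = Dom K p" "p \<cdot> e = q \<cdot> k'"
    using kernel_factor[OF ck, of "q \<cdot> k'"] kk' rD q' cc p by auto
  have pb: "is_pullback K q p e k'"
    unfolding is_pullback_def
  proof (intro conjI allI impI)
    fix u v assume uv: "u \<in> Ar K \<and> v \<in> Ar K \<and> Cod K u = Dom K p \<and> Cod K v = Dom K q \<and> Dom K u = Dom K v \<and> p \<cdot> u = q \<cdot> v"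
    have "c \<cdot> q \<cdot> v = zero_arr K (Dom K v) (Cod K c)"
      using reassoc[OF cc(4), of u] cc(1-3) uv p p' by auto
    then have "r \<cdot> v = zero_arr K (Dom K v) (Cod K r)" using uv q' cc p(2) t' t(2) by (simp add: r)
    then obtain h where h: "h \<in> Ar K" "Dom K h = Dom K v" "Cod K h = Dom K k'" "k' \<cdot> h = v"
      using kernel_factor[OF k', of v] uv rD by auto
    have "e \<cdot> h = u"
      by (rule monicD[OF p(1)]) (use reassoc[OF e(4), of h] e h uv kk' rD q' p p' in simp_all)
    then show "\<exists>!h. h \<in> Hom K (Dom K u) (Dom K e) \<and> e \<cdot> h = u \<and> k' \<cdot> h = v"
      using h e uv by (intro ex1I[of _ h]) (auto intro!: monicD[OF kernel_monic[OF k']])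
  qed (use q' p p' e kk' rD in simp_all)
  have ee: "epic K e" by (rule pullback_of_epic[OF pb q])
  have "is_kernel K e j"
  proof (rule kernelI)
    show "monic K j"
    proof (rule monicI[OF j(1)])
      fix u assume u: "u \<in> Ar K" "Cod K u = Dom K j" "j \<cdot> u = zero_arr K (Dom K u) (Cod K j)"
      have "k \<cdot> u = zero_arr K (Dom K u) (Cod K k)" using reassoc[OF j(4), of u] u j(1-3) kk kk' rD by simp
      then show "u = zero_arr K (Dom K u) (Dom K j)" using monic_zeroD[OF kernel_monic[OF k], of u] u j by simp
    qed
    have qk: "q \<cdot> k' \<cdot> j = zero_arr K (Dom K j) (Cod K q)" using j(2,4) kk by simp
    show "e \<cdot> j = zero_arr K (Dom K j) (Cod K e)"
      by (rule monicD[OF p(1)]) (use reassoc[OF e(4), of j] qk e(1-3) j(1-3) kk(2) kk' rD q' p p' in simp_all)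
    fix u assume u: "u \<in> Ar K" "Cod K u = Dom K e" "e \<cdot> u = zero_arr K (Dom K u) (Cod K e)"
    have "q \<cdot> k' \<cdot> u = zero_arr K (Dom K u) (Cod K q)"
      using reassoc[OF e(4), of u] u e(1-3) kk' rD q' p p' by simp
    then obtain v where v: "v \<in> Ar K" "Dom K v = Dom K u" "Cod K v = Dom K k" "k \<cdot> v = k' \<cdot> u"
      using kernel_factor[OF k, of "k' \<cdot> u"] u e kk' rD q' by auto
    have "j \<cdot> v = u"
      by (rule monicD[OF kernel_monic[OF k']]) (use reassoc[OF j(4), of v] v u e j(1-3) kk' rD in simp_all)
    then show "\<exists>h. h \<in> Ar K \<and> Dom K h = Dom K u \<and> Cod K h = Dom K j \<and> j \<cdot> h = u" using v j by auto
  qed (use e j in simp_all)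
  then show ?thesis using epic_cokernel_of_kernel[OF ee] e by blast
qed

context lfp_category
begin

lemma wo: "wo_rel \<kappa>"
  using inaccessibleD(1)[OF inaccessible] card_order_on_well_order_on by (simp add: wo_rel_def)

lemma ord_refl: "\<beta> \<in> Field \<kappa> \<Longrightarrow> (\<beta>, \<beta>) \<in> \<kappa>"
  using wo_rel.REFL[OF wo] by (simp add: refl_on_def)

lemma ord_trans: "(\<beta>, \<gamma>) \<in> \<kappa> \<Longrightarrow> (\<gamma>, \<delta>) \<in> \<kappa> \<Longrightarrow> (\<beta>, \<delta>) \<in> \<kappa>"
  using wo_rel.TRANS[OF wo] by (rule transD)

lemma ord_antisym: "(\<beta>, \<gamma>) \<in> \<kappa> \<Longrightarrow> (\<gamma>, \<beta>) \<in> \<kappa> \<Longrightarrow> \<beta> = \<gamma>"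
  using wo_rel.ANTISYM[OF wo] by (rule antisymD)

lemma ord_total: "\<beta> \<in> Field \<kappa> \<Longrightarrow> \<gamma> \<in> Field \<kappa> \<Longrightarrow> (\<beta>, \<gamma>) \<in> \<kappa> \<or> (\<gamma>, \<beta>) \<in> \<kappa>"
  using wo_rel.TOTALS[OF wo] by blast

lemma ord_Field: "(\<beta>, \<gamma>) \<in> \<kappa> \<Longrightarrow> \<beta> \<in> Field \<kappa>" "(\<beta>, \<gamma>) \<in> \<kappa> \<Longrightarrow> \<gamma> \<in> Field \<kappa>"
  by (auto simp: Field_def)

lemma underS_iff: "\<gamma> \<in> underS \<kappa> \<beta> \<longleftrightarrow> \<gamma> \<noteq> \<beta> \<and> (\<gamma>, \<beta>) \<in> \<kappa>"
  by (simp add: underS_def)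

lemma underS_trans: "\<gamma> \<in> underS \<kappa> \<beta> \<Longrightarrow> (\<beta>, \<delta>) \<in> \<kappa> \<Longrightarrow> \<gamma> \<in> underS \<kappa> \<delta>"
  unfolding underS_iff using ord_trans ord_antisym by blast

lemma small_underS: "\<beta> \<in> Field \<kappa> \<Longrightarrow> small \<kappa> (underS \<kappa> \<beta>)"
  unfolding small_def by (rule card_of_underS[OF inaccessibleD(1)[OF inaccessible]])

lemma ord_suc:
  assumes "\<gamma> \<in> underS \<kappa> \<beta>"
  shows "\<gamma> \<in> underS \<kappa> (wo_rel.suc \<kappa> {\<gamma>})" "(wo_rel.suc \<kappa> {\<gamma>}, \<beta>) \<in> \<kappa>"
    "underS \<kappa> (wo_rel.suc \<kappa> {\<gamma>}) = insert \<gamma> (underS \<kappa> \<gamma>)"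
proof -
  have \<gamma>: "{\<gamma>} \<subseteq> Field \<kappa>" and \<beta>: "\<beta> \<in> AboveS \<kappa> {\<gamma>}"
    using assms ord_Field by (auto simp: underS_iff AboveS_def)
  then have ne: "AboveS \<kappa> {\<gamma>} \<noteq> {}" by blast
  show 1: "\<gamma> \<in> underS \<kappa> (wo_rel.suc \<kappa> {\<gamma>})"
    using wo_rel.suc_greater[OF wo \<gamma> ne] by (metis underS_iff insertI1)
  show "(wo_rel.suc \<kappa> {\<gamma>}, \<beta>) \<in> \<kappa>" by (rule wo_rel.suc_least_AboveS[OF wo \<beta>])
  have "\<delta> \<in> insert \<gamma> (underS \<kappa> \<gamma>)" if \<delta>: "\<delta> \<in> underS \<kappa> (wo_rel.suc \<kappa> {\<gamma>})" for \<delta>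
  proof (rule ccontr)
    assume "\<delta> \<notin> insert \<gamma> (underS \<kappa> \<gamma>)"
    then have "\<delta> \<in> AboveS \<kappa> {\<gamma>}"
      using \<delta> \<gamma> ord_Field ord_total[of \<delta> \<gamma>] by (auto simp: underS_iff AboveS_def)
    then have "(wo_rel.suc \<kappa> {\<gamma>}, \<delta>) \<in> \<kappa>" by (rule wo_rel.suc_least_AboveS[OF wo])
    then show False using \<delta> ord_antisym by (auto simp: underS_iff)
  qed
  moreover have "(\<gamma>, wo_rel.suc \<kappa> {\<gamma>}) \<in> \<kappa>" using 1 by (simp add: underS_iff)
  ultimately show "underS \<kappa> (wo_rel.suc \<kappa> {\<gamma>}) = insert \<gamma> (underS \<kappa> \<gamma>)"
    using 1 underS_trans by blast
qed

lemma limit_suc: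
  assumes "limit_ordinal \<kappa> \<beta>" "\<gamma> \<in> underS \<kappa> \<beta>"
  shows "wo_rel.suc \<kappa> {\<gamma>} \<in> underS \<kappa> \<beta>"
proof -
  have "wo_rel.suc \<kappa> {\<gamma>} \<noteq> \<beta>" using assms unfolding limit_ordinal_def by blast
  then show ?thesis using ord_suc(2)[OF assms(2)] by (simp add: underS_iff)
qed

lemma underS_directed:
  assumes "underS \<kappa> \<beta> \<noteq> {}"
  shows "directed_poset (underS \<kappa> \<beta>) (\<kappa> \<inter> underS \<kappa> \<beta> \<times> underS \<kappa> \<beta>)"
  unfolding directed_poset_def partial_order_on_def preorder_on_def
proof (intro conjI ballI)
  have F: "\<gamma> \<in> Field \<kappa>" if "\<gamma> \<in> underS \<kappa> \<beta>" for \<gamma> using that ord_Field by (auto simp: underS_iff)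
  show "\<kappa> \<inter> underS \<kappa> \<beta> \<times> underS \<kappa> \<beta> \<subseteq> underS \<kappa> \<beta> \<times> underS \<kappa> \<beta>" by blast
  show "refl_on (underS \<kappa> \<beta>) (\<kappa> \<inter> underS \<kappa> \<beta> \<times> underS \<kappa> \<beta>)" using F ord_refl by (auto simp: refl_on_def)
  show "trans (\<kappa> \<inter> underS \<kappa> \<beta> \<times> underS \<kappa> \<beta>)" by (rule transI) (use ord_trans in blast)
  show "antisym (\<kappa> \<inter> underS \<kappa> \<beta> \<times> underS \<kappa> \<beta>)" by (rule antisymI) (use ord_antisym in blast)
  show "underS \<kappa> \<beta> \<noteq> {}" by fact
  show "\<exists>\<epsilon>\<in>underS \<kappa> \<beta>. (\<gamma>, \<epsilon>) \<in> \<kappa> \<inter> underS \<kappa> \<beta> \<times> underS \<kappa> \<beta> \<and> (\<delta>, \<epsilon>) \<in> \<kappa> \<inter> underS \<kappa> \<beta> \<times> underS \<kappa> \<beta>"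
    if "\<gamma> \<in> underS \<kappa> \<beta>" "\<delta> \<in> underS \<kappa> \<beta>" for \<gamma> \<delta>
    using that ord_total[OF F[OF that(1)] F[OF that(2)]] ord_refl[OF F[OF that(1)]] ord_refl[OF F[OF that(2)]] by blast
qed

text \<open>Iterating an operation on the subsets of a small set along the ordinals, with unions at each
  step, must reach a fixed point at a small ordinal, as \<open>\<kappa>\<close> does not embed into the power set.\<close>

lemma transfinite_iteration:
  assumes U: "small \<kappa> (U :: 'a set)" and nx: "\<And>D. D \<subseteq> U \<Longrightarrow> D \<subseteq> nx D \<and> nx D \<subseteq> U"
  shows "\<exists>D. (\<forall>\<beta>. D \<beta> = (\<Union>\<gamma>\<in>underS \<kappa> \<beta>. nx (D \<gamma>))) \<and> (\<forall>\<beta>. D \<beta> \<subseteq> U) \<and> (\<exists>\<alpha>\<in>Field \<kappa>. nx (D \<alpha>) = D \<alpha>)"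
proof -
  define H where "H f \<beta> = (\<Union>\<gamma>\<in>underS \<kappa> \<beta>. nx (f \<gamma>))" for f :: "'u \<Rightarrow> 'a set" and \<beta>
  define D where "D = wo_rel.worec \<kappa> H"
  have "wo_rel.adm_wo \<kappa> H" unfolding wo_rel.adm_wo_def[OF wo] by (simp add: H_def)
  then have D: "D \<beta> = (\<Union>\<gamma>\<in>underS \<kappa> \<beta>. nx (D \<gamma>))" for \<beta>
    using wo_rel.worec_fixpoint[OF wo, of H] unfolding D_def[symmetric] by (metis H_def)
  have DU: "D \<beta> \<subseteq> U" for \<beta>
  proof (induction \<beta> rule: wo_rel.well_order_induct[OF wo])
    case (1 \<beta>)
    then have "nx (D \<gamma>) \<subseteq> U" if "\<gamma> \<in> underS \<kappa> \<beta>" for \<gamma> using nx[of "D \<gamma>"] that unfolding underS_iff by blast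
    then show ?case using D[of \<beta>] by blast
  qed
  have "\<exists>\<alpha>\<in>Field \<kappa>. nx (D \<alpha>) = D \<alpha>"
  proof (rule ccontr)
    assume no: "\<not> (\<exists>\<alpha>\<in>Field \<kappa>. nx (D \<alpha>) = D \<alpha>)"
    have neq: "D \<gamma> \<noteq> D \<beta>" if "\<gamma> \<in> underS \<kappa> \<beta>" for \<gamma> \<beta>
    proof
      assume eq: "D \<gamma> = D \<beta>"
      have "nx (D \<gamma>) \<subseteq> D \<beta>" using that D[of \<beta>] by blast
      then have "nx (D \<gamma>) = D \<gamma>" using nx[OF DU[of \<gamma>]] eq by blast
      then show False using no that ord_Field by (auto simp: underS_iff)
    qed
    have "inj_on D (Field \<kappa>)"
    proof (rule inj_onI)
      fix \<beta> \<gamma> assume "\<beta> \<in> Field \<kappa>" "\<gamma> \<in> Field \<kappa>" "D \<beta> = D \<gamma>"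
      then show "\<beta> = \<gamma>" using neq ord_total[of \<beta> \<gamma>] unfolding underS_iff by metis
    qed
    then have "small \<kappa> (Field \<kappa>)"
      using DU by (intro small_inj[OF small_Pow[OF inaccessible U]]) auto
    then have "|Field \<kappa>| <o \<kappa>" by (simp add: small_def)
    then show False
      using card_of_Field_ordIso[OF inaccessibleD(1)[OF inaccessible]] not_ordLess_ordIso by blast
  qed
  then show ?thesis using D DU by blast
qed

end

context fp_class
begin

lemma iso_direct_limits: "N \<in> direct_limits \<kappa> K \<S> \<Longrightarrow> isomorphic K N M \<Longrightarrow> M \<in> direct_limits \<kappa> K \<S>"
  using approximable_iso by (simp add: direct_limits_iff)

text \<open>If \<open>M/A\<close> is a nonzero direct limit, choose a small pure subobject of it. Its preimage in \<open>M\<close> is the next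
  step of a filtration, and by the third isomorphism theorem the consecutive quotient is the chosen
  subobject.\<close>

lemma quotient_step:
  assumes T: "skeleton T" and reps: "\<And>P. P \<in> direct_limits \<kappa> K \<S> \<Longrightarrow> generated_by (arrows T \<times> (UNIV :: nat set)) T P \<Longrightarrow>
      \<exists>t\<in>T'. isomorphic K P t"
    and M: "M \<in> Ob K" and D: "D \<subseteq> elems M" "Cod K (quot M D) \<in> direct_limits \<kappa> K \<S>" "\<not> zero_object K (Cod K (quot M D))"
  shows "\<exists>D'. D \<subseteq> D' \<and> D' \<subseteq> elems M \<and> D' \<noteq> D \<and> Cod K (quot M D') \<in> direct_limits \<kappa> K \<S> \<and>
    (\<forall>k k' j. is_kernel K (quot M D) k \<and> is_kernel K (quot M D') k' \<and> j \<in> Ar K \<and> Dom K j = Dom K k \<and> Cod K j = Dom K k' \<and>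
      k' \<cdot> j = k \<longrightarrow> (\<exists>e. is_cokernel K j e \<and> (\<exists>t\<in>T'. isomorphic K (Cod K e) t)))"
proof -
  define q where "q = quot M D"
  have qq: "is_quotient K M D q" unfolding q_def by (rule quot[OF M D(1)])
  note q' = quotientD[OF qq]
  obtain p c where p: "monic K p" "Cod K p = Cod K q" "is_cokernel K p c" "p \<noteq> zero_arr K (Dom K p) (Cod K q)"
    "Dom K p \<in> direct_limits \<kappa> K \<S>" "Cod K c \<in> direct_limits \<kappa> K \<S>" "generated_by (arrows T \<times> (UNIV :: nat set)) T (Dom K p)"
    using small_pure_subobject[OF T D(2,3)] unfolding q_def by blast
  note cc = cokernel_arr[OF p(3)] and ce = cokernel_epic[OF p(3)]
  have cq: "c \<cdot> q \<in> Ar K" "Dom K (c \<cdot> q) = M" "Cod K (c \<cdot> q) = Cod K c" using cc q' p by simp_all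
  have cqe: "epic K (c \<cdot> q)"
  proof (rule epicI[OF cq(1)])
    fix f assume f: "f \<in> Ar K" "Dom K f = Cod K (c \<cdot> q)" "f \<cdot> c \<cdot> q = zero_arr K (Dom K (c \<cdot> q)) (Cod K f)"
    have "f \<cdot> c = zero_arr K (Dom K c) (Cod K f)"
      using epic_zeroD[OF q'(3), of "f \<cdot> c"] f cq cc p q' by simp
    then show "f = zero_arr K (Cod K (c \<cdot> q)) (Cod K f)" using epic_zeroD[OF ce, of f] f cq by simp
  qed
  define D' where "D' = {u \<in> elems M. (c \<cdot> q) \<cdot> u = zero_arr K (Dom K u) (Cod K (c \<cdot> q))}"
  have D'q: "is_quotient K M D' (c \<cdot> q)" unfolding D'_def by (rule epic_is_quotient[OF cqe cq(2)])
  have D'U: "D' \<subseteq> elems M" by (auto simp: D'_def)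
  have DD': "D \<subseteq> D'"
  proof
    fix u assume u: "u \<in> D"
    note ku = quotient_kills[OF qq u]
    show "u \<in> D'" using u D(1) ku q' cc p(2) by (auto simp: D'_def)
  qed
  obtain \<theta> where \<theta>: "iso_arr K \<theta>" "Dom K \<theta> = Cod K (c \<cdot> q)" "Cod K \<theta> = Cod K (quot M D')" "\<theta> \<cdot> c \<cdot> q = quot M D'"
    using quotient_iso[OF D'q quot[OF M D'U]] by blast
  have "Cod K (quot M D') \<in> direct_limits \<kappa> K \<S>"
    using iso_direct_limits[OF p(6)] iso_arr_isomorphic[OF \<theta>(1)] \<theta>(2,3) cq(3) by simp
  moreover have "D' \<noteq> D"
  proof
    assume "D' = D"
    then obtain \<eta> where \<eta>: "iso_arr K \<eta>" "Dom K \<eta> = Cod K q" "Cod K \<eta> = Cod K (c \<cdot> q)" "\<eta> \<cdot> q = c \<cdot> q"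
      using quotient_iso[OF qq] D'q by blast
    have "\<eta> \<in> Ar K" using \<eta>(1) by (rule iso_arrE)
    then have "\<eta> = c" using epicD[OF q'(3) \<eta>(4)] \<eta> cc p(2) cq by simp
    then have "monic K c" using iso_monic[OF \<eta>(1)] by simp
    then show False using monic_zeroD[of c p, OF _ _ _ cc(4)] cc p by simp
  qed
  moreover have "\<exists>e. is_cokernel K j e \<and> (\<exists>t\<in>T'. isomorphic K (Cod K e) t)"
    if k: "is_kernel K q k" "is_kernel K (quot M D') k'" "j \<in> Ar K" "Dom K j = Dom K k" "Cod K j = Dom K k'" "k' \<cdot> j = k"
    for k k' j
  proof -
    have "Dom K \<theta> = Cod K c" using \<theta>(2) cq(3) by simp
    then obtain e where e: "is_cokernel K j e" "Cod K e = Dom K p"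
      using cokernel_between_kernels[OF q'(3) p(1,2,3) iso_monic[OF \<theta>(1)] _ \<theta>(4)[symmetric] k] by blast
    then show ?thesis using reps[OF p(5,7)] by metis
  qed
  ultimately show ?thesis using DD' D'U unfolding q_def[symmetric] by (intro exI[of _ D']) blast
qed

lemma quot_empty: "M \<in> Ob K \<Longrightarrow> iso_arr K (quot M {})"
proof -
  assume M: "M \<in> Ob K"
  have "epic K (ident K M)" by (rule epicI) (use M in simp_all)
  then have "is_quotient K M {} (ident K M)"
    using M by (intro is_quotientI) (auto intro!: exI)
  then obtain \<theta> where \<theta>: "iso_arr K \<theta>" "Dom K \<theta> = M" "\<theta> \<cdot> ident K M = quot M {}"
    using quotient_iso quot[OF M, of "{}"] M by fastforce
  have "\<theta> \<in> Ar K" using \<theta>(1) by (rule iso_arrE)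
  then show ?thesis using \<theta> by simp
qed

text \<open>The filtration of \<open>M\<close> is recorded by the sets \<open>D \<beta>\<close> of elements of \<open>M\<close> that lie in its subobjects,
  and the \<open>\<beta>\<close>-th subobject is the kernel of the projection from \<open>M\<close> to \<open>quot M (D \<beta>)\<close>. As long as this
  quotient is nonzero, the next subobject is the preimage of a small pure subobject of the quotient.\<close>

lemma direct_limits_subset_Fil:
  assumes T: "skeleton T" and reps: "\<And>P. P \<in> direct_limits \<kappa> K \<S> \<Longrightarrow> generated_by (arrows T \<times> (UNIV :: nat set)) T P \<Longrightarrow>
      \<exists>t\<in>T'. isomorphic K P t"
    and M: "M \<in> direct_limits \<kappa> K \<S>"
  shows "M \<in> Fil \<kappa> K T'"
proof -
  note MO = direct_limits_Ob[OF M]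
  define good where "good D \<longleftrightarrow> D \<subseteq> elems M \<and> Cod K (quot M D) \<in> direct_limits \<kappa> K \<S>" for D
  define big where "big D \<longleftrightarrow> good D \<and> \<not> zero_object K (Cod K (quot M D))" for D
  define step where "step D D' \<longleftrightarrow> D \<subseteq> D' \<and> D' \<subseteq> elems M \<and> D' \<noteq> D \<and> Cod K (quot M D') \<in> direct_limits \<kappa> K \<S> \<and>
    (\<forall>k k' j. is_kernel K (quot M D) k \<and> is_kernel K (quot M D') k' \<and> j \<in> Ar K \<and> Dom K j = Dom K k \<and> Cod K j = Dom K k' \<and>
      k' \<cdot> j = k \<longrightarrow> (\<exists>e. is_cokernel K j e \<and> (\<exists>t\<in>T'. isomorphic K (Cod K e) t)))" for D D'
  define nx where "nx D = (if big D then SOME D'. step D D' else D)" for D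
  have step: "step D (nx D)" if "big D" for D
  proof -
    have "\<exists>D'. step D D'"
      unfolding step_def by (rule quotient_step[OF T reps MO]) (use that in \<open>auto simp: big_def good_def\<close>)
    then show ?thesis using that unfolding nx_def by (simp add: someI_ex)
  qed
  have nx: "D \<subseteq> nx D \<and> nx D \<subseteq> elems M" if "D \<subseteq> elems M" for D
    using step[of D] that by (cases "big D") (auto simp: step_def nx_def)
  have nx_good: "good (nx D)" if "good D" for D
    using step[of D] that by (cases "big D") (auto simp: step_def nx_def good_def)
  obtain D where D: "\<And>\<beta>. D \<beta> = (\<Union>\<gamma>\<in>underS \<kappa> \<beta>. nx (D \<gamma>))" and DU: "\<And>\<beta>. D \<beta> \<subseteq> elems M"
    and stop: "\<exists>\<alpha>\<in>Field \<kappa>. nx (D \<alpha>) = D \<alpha>"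
    using transfinite_iteration[OF small_elems[OF MO], of nx] nx by blast
  have nxD: "nx (D \<gamma>) \<subseteq> D \<beta>" if "\<gamma> \<in> underS \<kappa> \<beta>" for \<gamma> \<beta> using D[of \<beta>] that by blast
  have mono: "D \<gamma> \<subseteq> D \<beta>" if "(\<gamma>, \<beta>) \<in> \<kappa>" for \<gamma> \<beta>
    using nxD[of \<gamma> \<beta>] nx[OF DU[of \<gamma>]] that by (cases "\<gamma> = \<beta>") (auto simp: underS_iff)
  have suc: "D (wo_rel.suc \<kappa> {\<gamma>}) = nx (D \<gamma>)" if "\<gamma> \<in> underS \<kappa> \<beta>" for \<gamma> \<beta>
    using D[of "wo_rel.suc \<kappa> {\<gamma>}"] D[of \<gamma>] nx[OF DU[of \<gamma>]] unfolding ord_suc(3)[OF that] by auto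
  have good: "good (D \<beta>)" if "\<beta> \<in> Field \<kappa>" for \<beta>
    using that
  proof (induction \<beta> rule: wo_rel.well_order_induct[OF wo])
    case (1 \<beta>)
    show ?case
    proof (cases "underS \<kappa> \<beta> = {}")
      case True
      then have "D \<beta> = {}" using D[of \<beta>] by simp
      moreover have "isomorphic K M (Cod K (quot M {}))"
        using iso_arr_isomorphic[OF quot_empty[OF MO]] quotientD(2)[OF quot[OF MO, of "{}"]] by simp
      ultimately show ?thesis using iso_direct_limits[OF M] by (simp add: good_def)
    next
      case False
      define R where "R = \<kappa> \<inter> underS \<kappa> \<beta> \<times> underS \<kappa> \<beta>"
      have dir: "directed_poset (underS \<kappa> \<beta>) R" unfolding R_def by (rule underS_directed[OF False])
      have g: "good (nx (D \<gamma>))" if "\<gamma> \<in> underS \<kappa> \<beta>" for \<gamma>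
        using that 1 nx_good ord_Field(1) unfolding underS_iff by blast
      have m: "nx (D \<gamma>) \<subseteq> nx (D \<delta>)" if "(\<gamma>, \<delta>) \<in> R" for \<gamma> \<delta>
        using that nxD[of \<gamma> \<delta>] nx[OF DU[of \<delta>]] by (cases "\<gamma> = \<delta>") (auto simp: R_def underS_iff)
      have "is_quotient K M (nx (D \<gamma>)) (quot M (nx (D \<gamma>)))" if "\<gamma> \<in> underS \<kappa> \<beta>" for \<gamma>
        by (rule quot[OF MO]) (use nx[OF DU] in blast)
      moreover have "is_quotient K M (\<Union>\<gamma>\<in>underS \<kappa> \<beta>. nx (D \<gamma>)) (quot M (D \<beta>))"
        using quot[OF MO DU[of \<beta>]] D[of \<beta>] by simp
      ultimately obtain x l where
        "is_direct_limit K (underS \<kappa> \<beta>) R (\<lambda>\<gamma>. Cod K (quot M (nx (D \<gamma>)))) x (Cod K (quot M (D \<beta>))) l"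
        using direct_limit_of_quotients[OF dir, of "\<lambda>\<gamma>. nx (D \<gamma>)" M "\<lambda>\<gamma>. quot M (nx (D \<gamma>))" "quot M (D \<beta>)"] m
        by blast
      then have "Cod K (quot M (D \<beta>)) \<in> direct_limits \<kappa> K \<S>"
        by (rule direct_limits_limit[OF small_underS[OF 1(2)]]) (use g in \<open>simp add: good_def\<close>)
      then show ?thesis using DU by (simp add: good_def)
    qed
  qed
  \<comment> \<open>Beyond the least stage at which the quotient vanishes, the consecutive quotients would be zero
    instead of isomorphic to an object in \<open>T'\<close>.\<close>
  define Z where "Z = {\<alpha> \<in> Field \<kappa>. zero_object K (Cod K (quot M (D \<alpha>)))}"
  obtain \<alpha>0 where "\<alpha>0 \<in> Field \<kappa>" "nx (D \<alpha>0) = D \<alpha>0" using stop by blast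
  then have "\<alpha>0 \<in> Z" using step[of "D \<alpha>0"] good[of \<alpha>0] by (auto simp: Z_def big_def step_def)
  define \<alpha> where "\<alpha> = wo_rel.minim \<kappa> Z"
  have ZF: "Z \<subseteq> Field \<kappa>" "Z \<noteq> {}" using \<open>\<alpha>0 \<in> Z\<close> by (auto simp: Z_def)
  have \<alpha>: "\<alpha> \<in> Z" "\<And>\<beta>. \<beta> \<in> Z \<Longrightarrow> (\<alpha>, \<beta>) \<in> \<kappa>"
    using wo_rel.minim_in[OF wo ZF] wo_rel.minim_least[OF wo ZF(1)] by (auto simp: \<alpha>_def)
  have \<alpha>F: "\<alpha> \<in> Field \<kappa>" and \<alpha>z: "zero_object K (Cod K (quot M (D \<alpha>)))" using \<alpha>(1) by (auto simp: Z_def)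
  have big: "big (D \<beta>)" if "\<beta> \<in> underS \<kappa> \<alpha>" for \<beta>
    using that \<alpha>(2)[of \<beta>] good[of \<beta>] ord_Field ord_antisym unfolding big_def Z_def underS_iff by blast
  have qD: "is_quotient K M (D \<beta>) (quot M (D \<beta>))" for \<beta> by (rule quot[OF MO DU])
  note qD' = quotientD[OF qD]
  define m where "m \<beta> = (SOME k. is_kernel K (quot M (D \<beta>)) k)" for \<beta>
  have m: "is_kernel K (quot M (D \<beta>)) (m \<beta>)" for \<beta>
    unfolding m_def by (rule someI_ex) (rule ex_kernel[OF qD'(1)])
  note m' = kernel_arr[OF m] and mm = kernel_monic[OF m]
  have msub: "subobject K M (m \<beta>)" for \<beta> using mm m' qD' by (simp add: subobject_def)
  have qm: "g \<cdot> m \<beta> = zero_arr K (Dom K (m \<beta>)) (Cod K g)"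
    if g: "g \<in> Ar K" "Dom K g = M" "\<And>u. u \<in> D \<beta> \<Longrightarrow> g \<cdot> u = zero_arr K (Dom K u) (Cod K g)" for g \<beta>
  proof -
    obtain h where h: "h \<in> Ar K" "Dom K h = Cod K (quot M (D \<beta>))" "Cod K h = Cod K g" "h \<cdot> quot M (D \<beta>) = g"
      using quotient_factor[OF qD g(1,2)] g(3) by blast
    show ?thesis using reassoc[OF h(4), of "m \<beta>"] h(1-3) m'[of \<beta>] qD'[of \<beta>] by simp
  qed
  have le: "\<exists>h. h \<in> Ar K \<and> Dom K h = Dom K (m \<gamma>) \<and> Cod K h = Dom K (m \<beta>) \<and> m \<beta> \<cdot> h = m \<gamma>" if "(\<gamma>, \<beta>) \<in> \<kappa>" for \<gamma> \<beta>
  proof -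
    have "quot M (D \<beta>) \<cdot> m \<gamma> = zero_arr K (Dom K (m \<gamma>)) (Cod K (quot M (D \<beta>)))"
      using qm[of "quot M (D \<beta>)" \<gamma>] qD'[of \<beta>] quotient_kills[OF qD, of _ \<beta>] mono[OF that] by blast
    then show ?thesis using kernel_factor[OF m[of \<beta>], of "m \<gamma>"] m' qD' by simp
  qed
  have mle: "sub_le K (m \<gamma>) (m \<beta>)" if "(\<gamma>, \<beta>) \<in> \<kappa>" for \<gamma> \<beta>
    using le[OF that] by (auto simp: sub_le_def)
  have "is_filtration \<kappa> K M \<alpha> m"
    unfolding is_filtration_def
  proof (intro conjI allI impI)
    show "\<alpha> \<in> Field \<kappa>" by fact
    show "subobject K M (m \<beta>)" for \<beta> by (rule msub)
    show "sub_le K (m \<beta>) (m \<gamma>)" if "(\<beta>, \<gamma>) \<in> \<kappa> \<and> (\<gamma>, \<alpha>) \<in> \<kappa>" for \<beta> \<gamma> using mle that by blast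
  next
    fix \<beta> assume "(\<beta>, \<alpha>) \<in> \<kappa> \<and> underS \<kappa> \<beta> = {}"
    then have D0: "D \<beta> = {}" using D[of \<beta>] by simp
    have "m \<beta> = zero_arr K (Dom K (m \<beta>)) M"
      using monic_zeroD[OF iso_monic[OF quot_empty[OF MO]], of "m \<beta>"] m'[of \<beta>] qD'[of \<beta>] unfolding D0 by simp
    then have "m \<beta> \<cdot> ident K (Dom K (m \<beta>)) = zero_arr K (Dom K (m \<beta>)) (Cod K (m \<beta>))"
      using m'[of \<beta>] qD'[of \<beta>] by simp
    then have "ident K (Dom K (m \<beta>)) = zero_arr K (Dom K (m \<beta>)) (Dom K (m \<beta>))"
      using monic_zeroD[OF mm[of \<beta>], of "ident K (Dom K (m \<beta>))"] m'[of \<beta>] by simp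
    then show "zero_object K (Dom K (m \<beta>))" using m'[of \<beta>] by (simp add: zero_object_iff)
  next
    have "quot M (D \<alpha>) \<cdot> ident K M = zero_arr K M (Cod K (quot M (D \<alpha>)))"
      using zero_object_to[OF \<alpha>z qD'(1)[of \<alpha>] refl] qD'[of \<alpha>] MO by simp
    then obtain h where h: "h \<in> Ar K" "Dom K h = M" "Cod K h = Dom K (m \<alpha>)" "m \<alpha> \<cdot> h = ident K M"
      using kernel_factor[OF m[of \<alpha>], of "ident K M"] qD'[of \<alpha>] MO by auto
    have "h \<cdot> m \<alpha> = ident K (Dom K (m \<alpha>))"
      by (rule monicD[OF mm[of \<alpha>]]) (use h m'[of \<alpha>] qD'[of \<alpha>] in \<open>simp_all add: reassoc[OF h(4)]\<close>)
    then show "iso_arr K (m \<alpha>)" using h m'[of \<alpha>] qD'[of \<alpha>] by (intro iso_arrI[of "m \<alpha>" h]) simp_all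
  next
    fix \<beta> assume \<beta>: "(\<beta>, \<alpha>) \<in> \<kappa> \<and> limit_ordinal \<kappa> \<beta>"
    show "is_union K M (m ` underS \<kappa> \<beta>) (m \<beta>)"
      unfolding is_union_def
    proof (intro conjI ballI allI impI)
      show "subobject K M (m \<beta>)" by (rule msub)
      show "sub_le K n (m \<beta>)" if "n \<in> m ` underS \<kappa> \<beta>" for n using that mle by (auto simp: underS_iff)
      fix v assume v: "subobject K M v \<and> (\<forall>n\<in>m ` underS \<kappa> \<beta>. sub_le K n v)"
      then have vm: "monic K v" "Cod K v = M" by (simp_all add: subobject_def)
      note va = monic_arr[OF vm(1)]
      obtain c where c: "is_cokernel K v c" using obtain_cokernel[OF va] .
      note cc = cokernel_arr[OF c]
      have "c \<cdot> u = zero_arr K (Dom K u) (Cod K c)" if u: "u \<in> D \<beta>" for u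
      proof -
        obtain \<gamma> where \<gamma>: "\<gamma> \<in> underS \<kappa> \<beta>" "u \<in> nx (D \<gamma>)" using u D[of \<beta>] by blast
        define \<delta> where "\<delta> = wo_rel.suc \<kappa> {\<gamma>}"
        have \<delta>: "\<delta> \<in> underS \<kappa> \<beta>" "u \<in> D \<delta>"
          using limit_suc[of \<beta> \<gamma>] \<beta> \<gamma> suc[OF \<gamma>(1)] by (auto simp: \<delta>_def)
        note ku = quotient_kills[OF qD \<delta>(2)]
        obtain w where w: "w \<in> Ar K" "Dom K w = Dom K u" "Cod K w = Dom K (m \<delta>)" "m \<delta> \<cdot> w = u"
          using kernel_factor[OF m[of \<delta>], of u] ku qD'[of \<delta>] by auto
        have "sub_le K (m \<delta>) v" using v \<delta>(1) by blast
        then obtain h where h: "h \<in> Ar K" "Dom K h = Dom K (m \<delta>)" "Cod K h = Dom K v" "v \<cdot> h = m \<delta>"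
          by (auto simp: sub_le_def)
        have "v \<cdot> h \<cdot> w = u" using reassoc[OF h(4), of w] h(1-3) w va by simp
        then show ?thesis using reassoc[OF cc(4), of "h \<cdot> w"] cc(1-3) h(1-3) w(1-3) by auto
      qed
      then have "c \<cdot> m \<beta> = zero_arr K (Dom K (m \<beta>)) (Cod K c)" using qm[of c \<beta>] cc vm by simp
      then obtain h where "h \<in> Ar K" "Dom K h = Dom K (m \<beta>)" "Cod K h = Dom K v" "v \<cdot> h = m \<beta>"
        using kernel_factor[OF monic_kernel_of_cokernel[OF vm(1) c], of "m \<beta>"] m'[of \<beta>] qD'[of \<beta>] cc vm by auto
      then show "sub_le K (m \<beta>) v" by (auto simp: sub_le_def)
    qed
  qed
  moreover have "\<exists>j q t. j \<in> Hom K (Dom K (m \<beta>)) (Dom K (m (wo_rel.suc \<kappa> {\<beta>}))) \<and> m (wo_rel.suc \<kappa> {\<beta>}) \<cdot> j = m \<beta> \<and>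
        is_cokernel K j q \<and> t \<in> T' \<and> isomorphic K (Cod K q) t" if \<beta>: "\<beta> \<in> underS \<kappa> \<alpha>" for \<beta>
  proof -
    define \<delta> where "\<delta> = wo_rel.suc \<kappa> {\<beta>}"
    have "(\<beta>, \<delta>) \<in> \<kappa>" using ord_suc(1)[OF \<beta>] by (simp add: \<delta>_def underS_iff)
    then obtain j where j: "j \<in> Ar K" "Dom K j = Dom K (m \<beta>)" "Cod K j = Dom K (m \<delta>)" "m \<delta> \<cdot> j = m \<beta>"
      using le by blast
    have "D \<delta> = nx (D \<beta>)" unfolding \<delta>_def by (rule suc[OF \<beta>])
    then have "step (D \<beta>) (D \<delta>)" using step[OF big[OF \<beta>]] by simp
    then obtain e where "is_cokernel K j e" "\<exists>t\<in>T'. isomorphic K (Cod K e) t"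
      using m[of \<beta>] m[of \<delta>] j unfolding step_def by blast
    then show ?thesis using j unfolding \<delta>_def[symmetric] by auto
  qed
  ultimately show ?thesis unfolding Fil_def using MO by blast
qed

text \<open>Conversely, all subobjects in a filtration are in a class closed under extensions and direct
  limits, by transfinite induction: at a limit ordinal the direct limit of the previous subobjects maps
  monomorphically to the whole object, hence is their union.\<close>

lemma Fil_subset_direct_limits:
  assumes ext: "closed_under_extensions K (direct_limits \<kappa> K \<S>)" and T': "T' \<subseteq> direct_limits \<kappa> K \<S>"
    and M: "M \<in> Fil \<kappa> K T'"
  shows "M \<in> direct_limits \<kappa> K \<S>"
proof -
  let ?C = "direct_limits \<kappa> K \<S>"
  obtain \<alpha> m where fil: "is_filtration \<kappa> K M \<alpha> m"
    and quo: "\<forall>\<beta> \<in> underS \<kappa> \<alpha>. \<exists>j q T.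
        j \<in> Hom K (Dom K (m \<beta>)) (Dom K (m (wo_rel.suc \<kappa> {\<beta>}))) \<and>
        m (wo_rel.suc \<kappa> {\<beta>}) \<cdot> j = m \<beta> \<and> is_cokernel K j q \<and> T \<in> T' \<and> isomorphic K (Cod K q) T"
    using M unfolding Fil_def by blast
  have \<alpha>: "\<alpha> \<in> Field \<kappa>" and iso: "iso_arr K (m \<alpha>)"
    using fil by (simp_all add: is_filtration_def)
  have sub: "monic K (m \<beta>)" "Cod K (m \<beta>) = M" if "(\<beta>, \<alpha>) \<in> \<kappa>" for \<beta>
    using fil that by (simp_all add: is_filtration_def subobject_def)
  note ma = monic_arr[OF sub(1)]
  have le: "sub_le K (m \<beta>) (m \<gamma>)" if "(\<beta>, \<gamma>) \<in> \<kappa>" "(\<gamma>, \<alpha>) \<in> \<kappa>" for \<beta> \<gamma>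
    using fil that unfolding is_filtration_def by blast
  have "Dom K (m \<beta>) \<in> ?C" if "(\<beta>, \<alpha>) \<in> \<kappa>" for \<beta>
    using that
  proof (induction \<beta> rule: wo_rel.well_order_induct[OF wo])
    case (1 \<beta>)
    have IH: "Dom K (m \<gamma>) \<in> ?C" "(\<gamma>, \<alpha>) \<in> \<kappa>" if "\<gamma> \<in> underS \<kappa> \<beta>" for \<gamma>
      using 1 that ord_trans unfolding underS_iff by blast+
    have \<beta>F: "\<beta> \<in> Field \<kappa>" using 1(2) ord_Field by blast
    consider "underS \<kappa> \<beta> = {}" | \<gamma> where "\<gamma> \<in> underS \<kappa> \<beta>" "\<beta> = wo_rel.suc \<kappa> {\<gamma>}" | "limit_ordinal \<kappa> \<beta>"
      using \<beta>F unfolding limit_ordinal_def by blast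
    then show ?case
    proof cases
      case 1
      then have z: "zero_object K (Dom K (m \<beta>))" using fil \<open>(\<beta>, \<alpha>) \<in> \<kappa>\<close> unfolding is_filtration_def by blast
      obtain Z where Z: "Z \<in> ?C" "zero_object K Z" using ext unfolding closed_under_extensions_def by blast
      have "isomorphic K Z (Dom K (m \<beta>))"
        by (rule isomorphicI[of "zero_arr K Z (Dom K (m \<beta>))" "zero_arr K (Dom K (m \<beta>)) Z"])
          (use z Z in \<open>simp_all add: zero_object_iff\<close>)
      then show ?thesis by (rule iso_direct_limits[OF Z(1)])
    next
      case (2 \<gamma>)
      have "\<gamma> \<in> underS \<kappa> \<alpha>" by (rule underS_trans[OF 2(1) \<open>(\<beta>, \<alpha>) \<in> \<kappa>\<close>])
      then obtain j q t where j: "j \<in> Ar K" "Dom K j = Dom K (m \<gamma>)" "Cod K j = Dom K (m \<beta>)" "m \<beta> \<cdot> j = m \<gamma>"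
        "is_cokernel K j q" "t \<in> T'" "isomorphic K (Cod K q) t"
        using quo 2(2) by auto
      have "monic K j"
      proof (rule monicI[OF j(1)])
        fix u assume u: "u \<in> Ar K" "Cod K u = Dom K j" "j \<cdot> u = zero_arr K (Dom K u) (Cod K j)"
        have "m \<gamma> \<cdot> u = zero_arr K (Dom K u) M"
          using reassoc[OF j(4), of u] u j(1-3) ma[OF \<open>(\<beta>, \<alpha>) \<in> \<kappa>\<close>] sub(2)[OF \<open>(\<beta>, \<alpha>) \<in> \<kappa>\<close>] by simp
        then show "u = zero_arr K (Dom K u) (Dom K j)"
          using monic_zeroD[OF sub(1)[OF IH(2)[OF 2(1)]], of u] u j sub(2)[OF IH(2)[OF 2(1)]] by simp
      qed
      then have "short_exact K j q" using short_exact_monicI j(5) by blast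
      moreover have "Cod K q \<in> ?C" using iso_direct_limits[OF _ isomorphic_sym[OF j(7)]] j(6) T' by blast
      ultimately have "Cod K j \<in> ?C"
        using ext IH(1)[OF 2(1)] j(2) unfolding closed_under_extensions_def by metis
      then show ?thesis using j(3) by simp
    next
      case 3
      have un: "is_union K M (m ` underS \<kappa> \<beta>) (m \<beta>)" using fil \<open>(\<beta>, \<alpha>) \<in> \<kappa>\<close> 3 unfolding is_filtration_def by blast
      have ne: "underS \<kappa> \<beta> \<noteq> {}" using 3 by (simp add: limit_ordinal_def)
      define R where "R = \<kappa> \<inter> underS \<kappa> \<beta> \<times> underS \<kappa> \<beta>"
      have dir: "directed_poset (underS \<kappa> \<beta>) R" unfolding R_def by (rule underS_directed[OF ne])
      note F = directed_poset_Field[OF dir]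
      note mU = ma[OF IH(2)] sub(1)[OF IH(2)] sub(2)[OF IH(2)]
      have mb: "m \<beta> \<in> Ar K" "monic K (m \<beta>)" "Cod K (m \<beta>) = M" using ma sub \<open>(\<beta>, \<alpha>) \<in> \<kappa>\<close> by auto
      have "\<exists>h. h \<in> Ar K \<and> Dom K h = Dom K (m \<gamma>) \<and> Cod K h = Dom K (m \<delta>) \<and> m \<delta> \<cdot> h = m \<gamma>"
        if "(\<gamma>, \<delta>) \<in> R" for \<gamma> \<delta>
        using le[of \<gamma> \<delta>] that IH(2)[of \<delta>] F[OF that] by (auto simp: R_def sub_le_def)
      then obtain x where x: "\<And>\<gamma> \<delta>. (\<gamma>, \<delta>) \<in> R \<Longrightarrow> x \<gamma> \<delta> \<in> Ar K \<and> Dom K (x \<gamma> \<delta>) = Dom K (m \<gamma>) \<and>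
          Cod K (x \<gamma> \<delta>) = Dom K (m \<delta>) \<and> m \<delta> \<cdot> x \<gamma> \<delta> = m \<gamma>" by metis
      have sys: "direct_system K (underS \<kappa> \<beta>) R (\<lambda>\<gamma>. Dom K (m \<gamma>)) x"
        unfolding direct_system_def
      proof (intro conjI allI impI ballI)
        show "directed_poset (underS \<kappa> \<beta>) R" by (rule dir)
        fix \<gamma> assume \<gamma>: "\<gamma> \<in> underS \<kappa> \<beta>"
        show "Dom K (m \<gamma>) \<in> Ob K" using mU(1)[OF \<gamma>] by simp
        show "x \<gamma> \<gamma> = ident K (Dom K (m \<gamma>))"
          by (rule monicD[OF mU(2)[OF \<gamma>]]) (use x[OF directed_poset_refl[OF dir \<gamma>]] mU(1)[OF \<gamma>] in simp_all)
      next
        fix \<gamma> \<delta> assume "(\<gamma>, \<delta>) \<in> R"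
        then show "x \<gamma> \<delta> \<in> Hom K (Dom K (m \<gamma>)) (Dom K (m \<delta>))" using x by simp
      next
        fix \<gamma> \<delta> \<epsilon> assume a: "(\<gamma>, \<delta>) \<in> R \<and> (\<delta>, \<epsilon>) \<in> R"
        then have c: "(\<gamma>, \<delta>) \<in> R" "(\<delta>, \<epsilon>) \<in> R" "(\<gamma>, \<epsilon>) \<in> R" using directed_poset_trans[OF dir] by blast+
        have \<epsilon>: "\<epsilon> \<in> underS \<kappa> \<beta>" using F[OF c(2)] by simp
        have "m \<epsilon> \<cdot> x \<delta> \<epsilon> \<cdot> x \<gamma> \<delta> = m \<gamma>"
          using reassoc[of "m \<epsilon>" "x \<delta> \<epsilon>" _ "x \<gamma> \<delta>"] x[OF c(1)] x[OF c(2)] mU(1)[OF \<epsilon>] by simp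
        then show "x \<delta> \<epsilon> \<cdot> x \<gamma> \<delta> = x \<gamma> \<epsilon>"
          by (intro monicD[OF mU(2)[OF \<epsilon>], of "x \<delta> \<epsilon> \<cdot> x \<gamma> \<delta>" "x \<gamma> \<epsilon>"])
            (use x[OF c(1)] x[OF c(2)] x[OF c(3)] in simp_all)
      qed
      obtain L l where lim: "is_direct_limit K (underS \<kappa> \<beta>) R (\<lambda>\<gamma>. Dom K (m \<gamma>)) x L l"
        using ex_direct_limit[OF small_underS[OF \<beta>F] sys] by blast
      note l = coconeD[OF direct_limitD(2)[OF lim]]
      have "is_cocone K (underS \<kappa> \<beta>) R (\<lambda>\<gamma>. Dom K (m \<gamma>)) x M m"
        by (rule coconeI) (use arr_Ob(2)[OF mb(1)] mb(3) mU x in simp_all)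
      then obtain p where p: "p \<in> Ar K" "Dom K p = L" "Cod K p = M" "\<And>\<gamma>. \<gamma> \<in> underS \<kappa> \<beta> \<Longrightarrow> p \<cdot> l \<gamma> = m \<gamma>"
        using direct_limit_hom[OF lim] by blast
      have pm: "monic K p"
      proof (rule direct_limit_monicI[OF small_underS[OF \<beta>F] lim p(1,2)])
        fix \<gamma> u assume \<gamma>: "\<gamma> \<in> underS \<kappa> \<beta>" and u: "u \<in> elems (Dom K (m \<gamma>))"
          and 0: "p \<cdot> l \<gamma> \<cdot> u = zero_arr K (Dom K u) (Cod K p)"
        note u' = elemsD[OF u]
        have "m \<gamma> \<cdot> u = zero_arr K (Dom K u) M"
          using reassoc[OF p(4)[OF \<gamma>], of u] 0 u' l(2-4)[OF \<gamma>] p(1-3) by simp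
        then have "u = zero_arr K (Dom K u) (Dom K (m \<gamma>))"
          using monic_zeroD[OF mU(2)[OF \<gamma>], of u] u' mU(3)[OF \<gamma>] by simp
        then show "l \<gamma> \<cdot> u = zero_arr K (Dom K u) L"
          using comp_zero(1)[of "l \<gamma>" "Dom K (m \<gamma>)" "Dom K u"] l(2-4)[OF \<gamma>] u' by simp
      qed
      have "sub_le K (m \<gamma>) p" if "\<gamma> \<in> underS \<kappa> \<beta>" for \<gamma>
        unfolding sub_le_def by (rule bexI[of _ "l \<gamma>"]) (use that p l(2-4) in simp_all)
      then have "subobject K M p" "\<forall>n \<in> m ` underS \<kappa> \<beta>. sub_le K n p"
        using pm p(3) by (auto simp: subobject_def)
      then have "sub_le K (m \<beta>) p" using un unfolding is_union_def by blast
      then obtain h where h: "h \<in> Ar K" "Dom K h = Dom K (m \<beta>)" "Cod K h = L" "p \<cdot> h = m \<beta>"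
        using p by (auto simp: sub_le_def)
      have "\<exists>h. h \<in> Ar K \<and> Dom K h = Dom K (m \<gamma>) \<and> Cod K h = Dom K (m \<beta>) \<and> m \<beta> \<cdot> h = m \<gamma>"
        if "\<gamma> \<in> underS \<kappa> \<beta>" for \<gamma>
        using le[of \<gamma> \<beta>] that \<open>(\<beta>, \<alpha>) \<in> \<kappa>\<close> by (auto simp: underS_iff sub_le_def)
      then obtain t where t: "\<And>\<gamma>. \<gamma> \<in> underS \<kappa> \<beta> \<Longrightarrow> t \<gamma> \<in> Ar K \<and> Dom K (t \<gamma>) = Dom K (m \<gamma>) \<and>
          Cod K (t \<gamma>) = Dom K (m \<beta>) \<and> m \<beta> \<cdot> t \<gamma> = m \<gamma>" by metis
      have "is_cocone K (underS \<kappa> \<beta>) R (\<lambda>\<gamma>. Dom K (m \<gamma>)) x (Dom K (m \<beta>)) t"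
      proof (rule coconeI)
        fix \<gamma> \<delta> assume c: "(\<gamma>, \<delta>) \<in> R"
        have u: "\<gamma> \<in> underS \<kappa> \<beta>" "\<delta> \<in> underS \<kappa> \<beta>" using F[OF c] by simp_all
        have "m \<beta> \<cdot> t \<delta> \<cdot> x \<gamma> \<delta> = m \<gamma>" using reassoc[of "m \<beta>" "t \<delta>" _ "x \<gamma> \<delta>"] t[OF u(2)] x[OF c] mb by simp
        then show "t \<delta> \<cdot> x \<gamma> \<delta> = t \<gamma>"
          by (intro monicD[OF mb(2), of "t \<delta> \<cdot> x \<gamma> \<delta>" "t \<gamma>"]) (use t[OF u(1)] t[OF u(2)] x[OF c] in simp_all)
      qed (use t mb in simp_all)
      then obtain k where k: "k \<in> Ar K" "Dom K k = L" "Cod K k = Dom K (m \<beta>)" "\<And>\<gamma>. \<gamma> \<in> underS \<kappa> \<beta> \<Longrightarrow> k \<cdot> l \<gamma> = t \<gamma>"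
        using direct_limit_hom[OF lim] by blast
      have mk: "m \<beta> \<cdot> k = p"
      proof (rule direct_limit_unique[OF lim])
        fix \<gamma> assume \<gamma>: "\<gamma> \<in> underS \<kappa> \<beta>"
        show "(m \<beta> \<cdot> k) \<cdot> l \<gamma> = p \<cdot> l \<gamma>" using k mb l(2-4)[OF \<gamma>] p(4)[OF \<gamma>] t[OF \<gamma>] \<gamma> by simp
      qed (use k mb p in simp_all)
      have "h \<cdot> k = ident K L"
        by (rule monicD[OF pm]) (use h k p mk l(1) in \<open>simp_all add: reassoc[OF h(4)]\<close>)
      moreover have "k \<cdot> h = ident K (Dom K (m \<beta>))"
        by (rule monicD[OF mb(2)]) (use h k p mk mb in \<open>simp_all add: reassoc[OF mk]\<close>)
      ultimately have "isomorphic K L (Dom K (m \<beta>))"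
        using h k by (intro isomorphicI[of k h]) simp_all
      moreover have "L \<in> ?C" by (rule direct_limits_limit[OF small_underS[OF \<beta>F] lim]) (rule IH(1))
      ultimately show ?thesis using iso_direct_limits by blast
    qed
  qed
  then have "Dom K (m \<alpha>) \<in> ?C" using ord_refl[OF \<alpha>] by blast
  then show ?thesis using iso_direct_limits iso_arr_isomorphic[OF iso] sub(2)[OF ord_refl[OF \<alpha>]] by simp
qed

theorem direct_limits_deconstructible:
  assumes ext: "closed_under_extensions K (direct_limits \<kappa> K \<S>)"
  shows "deconstructible \<kappa> K (direct_limits \<kappa> K \<S>)"
proof -
  obtain T where T: "skeleton T" using ex_skeleton by blast
  have TO: "T \<subseteq> Ob K" using skeletonD(2)[OF T] \<S>_Ob by blast
  have sB: "small \<kappa> (arrows T \<times> (UNIV :: nat set))"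
    by (intro small_Times inaccessible small_arrows T small_countable)
  obtain T1 where T1: "small \<kappa> T1" "\<forall>P. generated_by (arrows T \<times> (UNIV :: nat set)) T P \<longrightarrow> (\<exists>t\<in>T1. isomorphic K P t)"
    using small_generated_reps[OF skeletonD(1)[OF T] TO sB] by blast
  define T' where "T' = T1 \<inter> direct_limits \<kappa> K \<S>"
  have reps: "\<exists>t\<in>T'. isomorphic K P t"
    if "P \<in> direct_limits \<kappa> K \<S>" "generated_by (arrows T \<times> (UNIV :: nat set)) T P" for P
    using T1(2) that iso_direct_limits unfolding T'_def by blast
  have sub: "T' \<subseteq> direct_limits \<kappa> K \<S>" by (simp add: T'_def)
  have "direct_limits \<kappa> K \<S> = Fil \<kappa> K T'"
    using direct_limits_subset_Fil[OF T reps] Fil_subset_direct_limits[OF ext sub] by blast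
  moreover have "small \<kappa> T'" by (rule small_subset[OF T1(1)]) (simp add: T'_def)
  moreover have "T' \<subseteq> Ob K" using sub direct_limits_Ob by blast
  ultimately show ?thesis unfolding deconstructible_def by blast
qed

end

theorem propositionA:
  fixes \<kappa> :: "'u rel" and K :: "('o, 'm) abcat" and \<S> :: "'o set"
  assumes "inaccessible \<kappa>"
    and "locally_finitely_presentable_abelian \<kappa> K"
    and "\<forall>S \<in> \<S>. finitely_presentable \<kappa> K S"
    and "closed_under_extensions K \<S>"
  shows "((\<forall>S \<in> \<S>. type_FP \<kappa> K 2 S) \<longrightarrow> closed_under_extensions K (direct_limits \<kappa> K \<S>)) \<and>
    (closed_under_extensions K (direct_limits \<kappa> K \<S>) \<longrightarrow>
       deconstructible \<kappa> K (direct_limits \<kappa> K \<S>))"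
proof -
  obtain \<G> where ab: "abelian_category K" and lfp: "locally_small \<kappa> K" "has_small_coproducts \<kappa> K"
    "small \<kappa> \<G>" "generating K \<G>" and \<G>: "\<forall>G \<in> \<G>. finitely_presentable \<kappa> K G"
    using assms(2) unfolding locally_finitely_presentable_abelian_def by blast
  interpret abelian_category K by (rule ab)
  interpret fp_class K \<kappa> \<G> \<S>
    by unfold_locales (use assms lfp \<G> finitely_presentable_fp in auto)
  show ?thesis using direct_limits_closed_under_extensions direct_limits_deconstructible by blast
qed

end
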